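(* Let $K$ be a convex billiard table with $C^2$-smooth boundary in either the hyperbolic plane $\mathbb{H}^2$ or the open hemisphere $\mathbb{S}^2_+$. Let $\kappa_{\min}$ be the minimal (geodesic) curvature of the boundary $\partial K$ and let $D$ be the diameter of $K$. In the case of $\mathbb{S}^2_+$, assume further that $D<\frac{\pi}{2}$. Let $$\varepsilon=\begin{cases}\operatorname{arctanh}\left(\sqrt{2}\,\kappa_{\min}\tanh^{\frac32}(D)\,\sinh^{\frac12}(D)\right), & \text{in } \mathbb{H}^2,\\[4pt] 2\arctan\left(\frac{\sqrt{\pi}}{2}\,\kappa_{\min}\tan^{2}(D)\right), & \text{in } \mathbb{S}^2_+,\end{cases}$$ where $\operatorname{arctanh}(x)$ is interpreted as $+\infty$ if $x\ge 1$. Then every convex caustic $\gamma$ in $K$ lies in the $\varepsilon$-neighborhood of the boundary: every $x\in\gamma$ satisfies $d(x,\partial K)\le\varepsilon$.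
   Context: $\mathbb{H}^2$ is the hyperbolic plane (curvature $-1$), $\mathbb{S}^2_+$ is an open hemisphere of the unit sphere (curvature $+1$), $d$ is the Riemannian distance, and $d(x,A)=\inf_{a\in A}d(x,a)$. A set is convex if for every two of its points the unique geodesic segment joining them is contained in the set. A convex billiard table is a compact convex set $K$ with nonempty interior. The curvature of $\partial K$ is its geodesic curvature, with the sign making it nonnegative for convex $K$. The diameter is $D=\max\{d(x,y): x,y\in\partial K\}$. Billiard dynamics: a point particle moves along geodesics inside $K$ and reflects at $\partial K$ making equal angles with the tangent line to $\partial K$ at the impact point. A convex caustic in $K$ is a simple closed curve $\gamma\subset K$ which bounds a convex set and is such that any billiard trajectory tangent to $\gamma$ remains tangent to $\gamma$ after the reflection at $\partial K$. (If $\gamma$ is not smooth, a tangent line to $\gamma$ means a supporting geodesic line of the convex set it bounds.) *)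

theory Defs
  imports "HOL-Analysis.Analysis"
begin

text \<open>
  Both surfaces are realised inside \<^typ>\<open>real^3\<close>.  The hyperbolic plane is the upper sheet of the
  hyperboloid \<open>x1^2 + x2^2 - x3^2 = -1\<close> in Minkowski space, the open hemisphere is the part
  \<open>x3 > 0\<close> of the unit sphere.  The Riemannian metric is the restriction of \<open>form\<close> to the tangent
  spaces; it is positive definite there and has constant curvature \<open>curv\<close>.
\<close>

datatype geometry = Hyperbolic | Spherical

fun curv :: "geometry \<Rightarrow> real" where
  "curv Hyperbolic = -1"
| "curv Spherical = 1"

definition form :: "geometry \<Rightarrow> real^3 \<Rightarrow> real^3 \<Rightarrow> real" where
  "form G x y = x$1 * y$1 + x$2 * y$2 + curv G * x$3 * y$3"

definition surface :: "geometry \<Rightarrow> (real^3) set" where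
  "surface G = {x. form G x x = curv G \<and> x$3 > 0}"

text \<open>The Riemannian distance of the two models (for the hemisphere, the angle).\<close>

fun gdist :: "geometry \<Rightarrow> real^3 \<Rightarrow> real^3 \<Rightarrow> real" where
  "gdist Hyperbolic x y = arcosh (- form Hyperbolic x y)"
| "gdist Spherical x y = arccos (form Spherical x y)"

definition unit_tangent :: "geometry \<Rightarrow> real^3 \<Rightarrow> real^3 \<Rightarrow> bool" where
  "unit_tangent G p v \<longleftrightarrow> p \<in> surface G \<and> form G p v = 0 \<and> form G v v = 1"

text \<open>The unit speed geodesic starting at \<open>p\<close> with velocity \<open>v\<close>.  In the spherical case it runs
  through the full great circle and hence leaves the hemisphere.\<close>

fun geo :: "geometry \<Rightarrow> real^3 \<Rightarrow> real^3 \<Rightarrow> real \<Rightarrow> real^3" where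
  "geo Hyperbolic p v t = cosh t *\<^sub>R p + sinh t *\<^sub>R v"
| "geo Spherical p v t = cos t *\<^sub>R p + sin t *\<^sub>R v"

definition geodesic_segment :: "geometry \<Rightarrow> real^3 \<Rightarrow> real^3 \<Rightarrow> (real^3) set" where
  "geodesic_segment G x y =
     {geo G x v t | v t. unit_tangent G x v \<and> geo G x v (gdist G x y) = y \<and>
                         0 \<le> t \<and> t \<le> gdist G x y}"

definition geodesic_line :: "geometry \<Rightarrow> real^3 \<Rightarrow> real^3 \<Rightarrow> (real^3) set" where
  "geodesic_line G p v = range (geo G p v) \<inter> surface G"

definition geo_convex :: "geometry \<Rightarrow> (real^3) set \<Rightarrow> bool" where
  "geo_convex G A \<longleftrightarrow> A \<subseteq> surface G \<and> (\<forall>x\<in>A. \<forall>y\<in>A. geodesic_segment G x y \<subseteq> A)"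

definition boundary :: "geometry \<Rightarrow> (real^3) set \<Rightarrow> (real^3) set" where
  "boundary G A = (top_of_set (surface G)) frontier_of A"

definition convex_table :: "geometry \<Rightarrow> (real^3) set \<Rightarrow> bool" where
  "convex_table G K \<longleftrightarrow>
     compact K \<and> geo_convex G K \<and> (top_of_set (surface G)) interior_of K \<noteq> {}"

text \<open>For a unit tangent vector \<open>v\<close> at \<open>p\<close> this is \<open>v\<close> turned by a right angle inside the tangent
  plane: the cross product of \<open>p\<close> and \<open>v\<close>, taken with respect to \<open>form G\<close>.  It satisfies
  \<open>form G (left_normal G p v) x = det (p, v, x)\<close>, so it is also a normal vector of the plane which
  cuts out the geodesic through \<open>p\<close> in direction \<open>v\<close>.\<close>

definition left_normal :: "geometry \<Rightarrow> real^3 \<Rightarrow> real^3 \<Rightarrow> real^3" where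
  "left_normal G p v = (let w = cross3 p v in vector [w$1, w$2, curv G * w$3])"

definition left_half_plane :: "geometry \<Rightarrow> real^3 \<Rightarrow> real^3 \<Rightarrow> (real^3) set" where
  "left_half_plane G p v = {x \<in> surface G. form G (left_normal G p v) x \<ge> 0}"

definition supporting_line :: "geometry \<Rightarrow> (real^3) set \<Rightarrow> real^3 \<Rightarrow> real^3 \<Rightarrow> bool" where
  "supporting_line G C p v \<longleftrightarrow>
     geodesic_line G p v \<inter> C \<noteq> {} \<and>
     (C \<subseteq> left_half_plane G p v \<or> C \<subseteq> left_half_plane G p (- v))"

abbreviation velocity :: "(real \<Rightarrow> real^3) \<Rightarrow> real \<Rightarrow> real^3" where
  "velocity c t \<equiv> vector_derivative c (at t)"

abbreviation acceleration :: "(real \<Rightarrow> real^3) \<Rightarrow> real \<Rightarrow> real^3" where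
  "acceleration c t \<equiv> vector_derivative (velocity c) (at t)"

text \<open>\<open>c\<close> is an \<open>L\<close>-periodic parametrisation of the boundary of \<open>K\<close> by arc length, of class \<open>C^2\<close>,
  with \<open>K\<close> on its left.  Arc length is no restriction: reparametrising a regular \<open>C^2\<close> curve by arc
  length keeps it \<open>C^2\<close>.\<close>

definition boundary_param ::
  "geometry \<Rightarrow> (real^3) set \<Rightarrow> real \<Rightarrow> (real \<Rightarrow> real^3) \<Rightarrow> bool" where
  "boundary_param G K L c \<longleftrightarrow>
     L > 0 \<and> (\<forall>t. c (t + L) = c t) \<and> inj_on c {0..<L} \<and> c ` {0..<L} = boundary G K \<and>
     c C1_differentiable_on UNIV \<and> velocity c C1_differentiable_on UNIV \<and>
     (\<forall>t. form G (velocity c t) (velocity c t) = 1) \<and>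
     (\<forall>t. \<exists>\<delta>>0. \<forall>s\<in>{0<..<\<delta>}. geo G (c t) (left_normal G (c t) (velocity c t)) s \<in> K)"

definition C2_boundary :: "geometry \<Rightarrow> (real^3) set \<Rightarrow> bool" where
  "C2_boundary G K \<longleftrightarrow> (\<exists>L c. boundary_param G K L c)"

text \<open>The covariant derivative of the velocity is the tangential part of the acceleration, so the
  geodesic curvature is the component of the acceleration along the normal.  Since \<open>K\<close> lies on the
  left of \<open>c\<close>, this is the inner normal, and the curvature is nonnegative for convex \<open>K\<close>.\<close>

definition geodesic_curvature :: "geometry \<Rightarrow> (real \<Rightarrow> real^3) \<Rightarrow> real \<Rightarrow> real" where
  "geodesic_curvature G c t = form G (acceleration c t) (left_normal G (c t) (velocity c t))"

text \<open>The set of curvature values does not depend on the parametrisation, and its infimum is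
  attained, because the curvature is continuous and the boundary is compact.\<close>

definition min_curvature :: "geometry \<Rightarrow> (real^3) set \<Rightarrow> real" where
  "min_curvature G K = Inf {geodesic_curvature G c t | L c t. boundary_param G K L c}"

definition table_diameter :: "geometry \<Rightarrow> (real^3) set \<Rightarrow> real" where
  "table_diameter G K = Sup {gdist G x y | x y. x \<in> boundary G K \<and> y \<in> boundary G K}"

definition dist_to_set :: "geometry \<Rightarrow> real^3 \<Rightarrow> (real^3) set \<Rightarrow> real" where
  "dist_to_set G x A = (INF a\<in>A. gdist G x a)"

definition boundary_tangent :: "geometry \<Rightarrow> (real^3) set \<Rightarrow> real^3 \<Rightarrow> real^3 \<Rightarrow> bool" where
  "boundary_tangent G K q T \<longleftrightarrow>
     (\<exists>L c t. boundary_param G K L c \<and> c t = q \<and> velocity c t = T)"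

text \<open>A particle moving inside \<open>K\<close> hits the boundary at \<open>q\<close> with velocity \<open>u\<close> and leaves with
  velocity \<open>u'\<close>, the mirror image of \<open>u\<close> in the tangent line of the boundary.\<close>

definition billiard_reflection ::
  "geometry \<Rightarrow> (real^3) set \<Rightarrow> real^3 \<Rightarrow> real^3 \<Rightarrow> real^3 \<Rightarrow> bool" where
  "billiard_reflection G K q u u' \<longleftrightarrow>
     unit_tangent G q u \<and> (\<exists>\<delta>>0. \<forall>s\<in>{0..\<delta>}. geo G q (- u) s \<in> K) \<and>
     (\<exists>T. boundary_tangent G K q T \<and> u' = (2 * form G u T) *\<^sub>R T - u)"

definition simple_closed_curve :: "(real^3) set \<Rightarrow> bool" where
  "simple_closed_curve \<Gamma> \<longleftrightarrow>
     (\<exists>g. simple_path g \<and> pathfinish g = pathstart g \<and> path_image g = \<Gamma>)"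

text \<open>\<open>C\<close> is the closed convex region bounded by \<open>\<Gamma>\<close>.  As \<open>C\<close> lies in the convex set \<open>K\<close>, the part
  of a line inside \<open>K\<close> touches \<open>C\<close> if and only if the whole line does.\<close>

definition convex_caustic :: "geometry \<Rightarrow> (real^3) set \<Rightarrow> (real^3) set \<Rightarrow> bool" where
  "convex_caustic G K \<Gamma> \<longleftrightarrow>
     simple_closed_curve \<Gamma> \<and> \<Gamma> \<subseteq> K \<and>
     (\<exists>C. compact C \<and> geo_convex G C \<and> boundary G C = \<Gamma> \<and>
          (\<forall>q u u'. billiard_reflection G K q u u' \<and> supporting_line G C q u
                     \<longrightarrow> supporting_line G C q u'))"

fun caustic_eps :: "geometry \<Rightarrow> real \<Rightarrow> real \<Rightarrow> ereal" where
  "caustic_eps Hyperbolic \<kappa> D =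
     (let a = sqrt 2 * \<kappa> * tanh D powr (3/2) * sinh D powr (1/2)
      in if a \<ge> 1 then \<infinity> else ereal (artanh a))"
| "caustic_eps Spherical \<kappa> D = ereal (2 * arctan (sqrt pi / 2 * \<kappa> * (tan D)\<^sup>2))"

end

theory Submission
  imports Defs
begin

text \<open>
  Let \<open>\<theta>\<close> be the angle which the tangent lines to the caustic make with the boundary; both tangent
  lines at a boundary point make the same angle.  Subtracting from the chord length the integral of
  \<open>cos \<theta>\<close> along the arc cut off by the chord gives a function \<open>U\<close> of two boundary points that, in
  each variable, increases up to the tangent chords and decreases afterwards.  Its maximum in one
  variable therefore does not depend on the other one; let \<open>M\<close> be this common value.  (It is the
  length parameter of the string construction, obtained without rectifying the caustic.)

  If \<open>p\<close>, \<open>p'\<close> are the ends of a chord tangent to the caustic at \<open>x\<close> and \<open>q\<close> is the point where the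
  perpendicular at \<open>x\<close> meets the arc cut off, then \<open>U\<close> gives \<open>|pq| + |qp'| - |pp'| \<le> M\<close>, which bounds
  the distance from \<open>x\<close> to \<open>q\<close> in terms of \<open>M\<close>.  If \<open>p\<close>, \<open>q\<close>, \<open>r\<close> are consecutive points of a billiard
  trajectory tangent to the caustic, then \<open>M \<le> |pq| + |qr| - |pr|\<close>, and since \<open>q\<close> maximises
  \<open>|pq| + |qr|\<close> over the arc from \<open>p\<close> to \<open>r\<close>, the second derivative test yields \<open>sin \<theta> \<le> \<kappa> tan D\<close> (\<open>tanh D\<close> in the
  hyperbolic plane) at \<open>q\<close>.  As \<open>q\<close> is arbitrary, \<open>M\<close> is bounded in terms of the minimal curvature.
\<close>

section \<open>The two model surfaces\<close>

text \<open>The caustic is only the boundary curve of a convex set: it may have corners and may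
  touch the table, and the reflection law only sends supporting lines to supporting lines, so that a
  line might be sent to itself. That the two tangent lines at a boundary point make equal angles
  therefore has to be proved. Maximisers of \<open>U\<close> in one variable need not be unique, so
  none can be followed smoothly; but the signs of the partial derivatives of \<open>U\<close> are
  governed by the side on which the chord passes the caustic, and this suffices for a one-sided
  envelope argument. The second derivative test reads
  \<open>2 * \<kappa> \<ge> sin \<theta> * (cot a + cot b)\<close> with \<open>a\<close>,
  \<open>b\<close> the two chords at \<open>q\<close>, and each cotangent is at least that of
  \<open>D\<close> (hyperbolic functions in the hyperbolic plane). The hyperbolic constant
  \<open>sqrt 2\<close> comes from \<open>1 - 1 / (1 + y)\<^sup>2 \<le> 2 * y\<close>; on the sphere
  the factor 3/4 is reached and enlarged to \<open>pi / 4\<close>. Geodesics are sections by planes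
  through the origin, so almost everything before these estimates is done for both geometries at
  once, in cones of \<open>real^3\<close>.\<close>

lemma curv_square [simp]: "curv G * curv G = 1"
  by (cases G) auto

lemma curv_square_mult [simp]: "curv G * (curv G * x) = x"
  using curv_square[of G] by (metis mult.assoc mult_1)

lemma curv_nonzero [simp]: "curv G \<noteq> 0"
  by (cases G) auto

lemma form_commute: "form G x y = form G y x"
  by (simp add: form_def mult.commute mult.left_commute)

lemma bounded_bilinear_form: "bounded_bilinear (form G)"
proof -
  have eq: "form G x y = x \<bullet> (\<chi> i. if i = 3 then curv G * y$3 else y$i)" for x y
    by (simp add: form_def inner_vec_def sum_3)
  have lin: "bounded_linear (\<lambda>y::real^3. (\<chi> i. if i = 3 then curv G * y$3 else y$i)::real^3)"
    by (intro linear_conv_bounded_linear[THEN iffD1] linearI) (auto simp: vec_eq_iff algebra_simps)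
  show ?thesis
    unfolding eq[abs_def] by (rule bounded_bilinear.comp[OF bounded_bilinear_inner bounded_linear_ident lin])
qed

lemmas form_linear = bounded_bilinear.add_left[OF bounded_bilinear_form]
  bounded_bilinear.add_right[OF bounded_bilinear_form]
  bounded_bilinear.diff_left[OF bounded_bilinear_form]
  bounded_bilinear.diff_right[OF bounded_bilinear_form]
  bounded_bilinear.scaleR_left[OF bounded_bilinear_form]
  bounded_bilinear.scaleR_right[OF bounded_bilinear_form]
  bounded_bilinear.minus_left[OF bounded_bilinear_form]
  bounded_bilinear.minus_right[OF bounded_bilinear_form]
  bounded_bilinear.zero_left[OF bounded_bilinear_form]
  bounded_bilinear.zero_right[OF bounded_bilinear_form]

lemmas continuous_on_form [continuous_intros] =
  bounded_bilinear.continuous_on[OF bounded_bilinear_form]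

lemmas tendsto_form [tendsto_intros] = bounded_bilinear.tendsto[OF bounded_bilinear_form]

text \<open>The sign of this determinant tells on which side of the plane through the origin,
  \<open>x\<close> and \<open>y\<close> the vector \<open>z\<close> lies. It does not involve
  \<open>curv G\<close>, so orientation arguments are the same in both geometries, and linearity
  allows them for combinations that leave the surface.\<close>

definition det3 :: "real^3 \<Rightarrow> real^3 \<Rightarrow> real^3 \<Rightarrow> real" where
  "det3 x y z = cross3 x y \<bullet> z"

lemma det3_expand:
  "det3 x y z = (x$2 * y$3 - x$3 * y$2) * z$1 + (x$3 * y$1 - x$1 * y$3) * z$2 + (x$1 * y$2 - x$2 * y$1) * z$3"
  by (simp add: det3_def cross3_def inner_vec_def sum_3)

lemma bounded_linear_det3: "bounded_linear (det3 x y)"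
  unfolding det3_def[abs_def] by (rule bounded_linear_inner_right)

lemmas det3_linear = linear_add[OF bounded_linear.linear[OF bounded_linear_det3]]
  linear_scale[OF bounded_linear.linear[OF bounded_linear_det3]]
  linear_diff[OF bounded_linear.linear[OF bounded_linear_det3]]

lemma det3_rotate: "det3 x y z = det3 y z x" and det3_swap: "det3 x y z = - det3 y x z"
  by (simp_all add: det3_expand algebra_simps)

lemma det3_self [simp]: "det3 x x y = 0" "det3 x y x = 0" "det3 y x x = 0"
  by (simp_all add: det3_expand algebra_simps)

lemma form_left_normal: "form G (left_normal G p v) x = det3 p v x"
  by (simp add: form_def left_normal_def det3_def Let_def inner_vec_def sum_3 algebra_simps)

lemma vec3_eqI: "x$1 = y$1 \<Longrightarrow> x$2 = y$2 \<Longrightarrow> x$3 = y$3 \<Longrightarrow> x = (y::real^3)"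
  by (simp add: vec_eq_iff forall_3)

text \<open>The Lagrange formula for a double cross product, transported to \<open>form G\<close>;
  the factor \<open>curv G\<close> is the determinant of the form.\<close>

lemma left_normal_left_normal:
  "left_normal G a (left_normal G b c) = curv G *\<^sub>R (form G a c *\<^sub>R b - form G a b *\<^sub>R c)"
  by (cases G; intro vec3_eqI; simp add: left_normal_def form_def Let_def cross3_def algebra_simps)

lemma cramer3: "det3 a b c *\<^sub>R z = det3 z b c *\<^sub>R a + det3 a z c *\<^sub>R b + det3 a b z *\<^sub>R c"
  by (intro vec3_eqI; simp add: det3_expand algebra_simps)

lemma form_normal_normal:
  "form G (left_normal G p v) (left_normal G p v) = curv G * (form G p p * form G v v - (form G p v)\<^sup>2)"
  by (cases G; simp add: left_normal_def form_def Let_def cross3_def power2_eq_square algebra_simps)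

lemma surfaceD: "x \<in> surface G \<Longrightarrow> form G x x = curv G" "x \<in> surface G \<Longrightarrow> x $ 3 > 0"
  by (auto simp: surface_def)

text \<open>\<open>q\<close>, \<open>T\<close> and \<open>N\<close> are orthogonal for
  \<open>form G\<close>, with squares \<open>curv G\<close>, 1 and 1. Since
  \<open>det3 q T N\<close> is 1, Cramer's rule yields the coordinates of any vector.\<close>

locale frame =
  fixes G q T
  assumes unit: "unit_tangent G q T"
begin

definition "N = left_normal G q T"

lemma qT: "q \<in> surface G" "form G q q = curv G" "form G q T = 0" "form G T q = 0" "form G T T = 1"
  using unit by (auto simp: unit_tangent_def surface_def form_commute[of G T q])

lemma N: "form G q N = 0" "form G N q = 0" "form G T N = 0" "form G N T = 0" "form G N N = 1"
proof -
  show 1: "form G N q = 0" "form G N T = 0" by (auto simp: N_def form_left_normal)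
  then show "form G q N = 0" "form G T N = 0" by (simp_all add: form_commute)
  show "form G N N = 1" unfolding N_def form_normal_normal using qT by simp
qed

lemma form_N: "form G N z = det3 q T z" "form G z N = det3 q T z"
  using form_commute[of G z N] by (simp_all add: N_def form_left_normal)

lemma expand: "z = (curv G * form G q z) *\<^sub>R q + form G T z *\<^sub>R T + form G N z *\<^sub>R N"
proof -
  have 1: "left_normal G q N = - T" unfolding N_def left_normal_left_normal using qT by simp
  have 2: "left_normal G T N = curv G *\<^sub>R q" unfolding N_def left_normal_left_normal using qT by simp
  have a: "det3 q T N = 1" using N(5) by (simp add: form_N)
  have b: "det3 z T N = curv G * form G q z"
    using arg_cong[OF 2, of "\<lambda>x. form G x z"] by (simp add: form_left_normal form_linear det3_rotate[of z T N])
  have c: "det3 q z N = form G T z"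
    using arg_cong[OF 1, of "\<lambda>x. form G x z"] det3_rotate[of q N z] det3_swap[of q z N] det3_rotate[of z q N]
    by (simp add: form_left_normal form_linear)
  show ?thesis using cramer3[of q T N z] by (simp add: a b c form_N)
qed

lemma form_expand: "form G y z = curv G * form G q y * form G q z + form G T y * form G T z + form G N y * form G N z"
proof -
  have "form G y z = form G y ((curv G * form G q z) *\<^sub>R q + form G T z *\<^sub>R T + form G N z *\<^sub>R N)"
    using expand[of z] by simp
  then show ?thesis
    by (simp add: form_linear form_commute[of G y q] form_commute[of G y T] form_commute[of G y N])
qed

text \<open>With the base point in the first slot the coordinate along \<open>q\<close> drops out,
  leaving the planar determinant of the tangential coordinates.\<close>

lemma det3_expand_frame: "det3 q y z = form G T y * form G N z - form G N y * form G T z"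
proof -

  have 1: "left_normal G q N = - T" unfolding N_def left_normal_left_normal using qT by simp
  have "det3 q N z = - form G T z"
    using arg_cong[OF 1, of "\<lambda>x. form G x z"] by (simp add: form_left_normal form_linear)
  moreover have "det3 q T z = form G N z" by (simp add: form_N)
  moreover have "det3 q y z = form G T y * det3 q T z + form G N y * det3 q N z"
  proof -
    have "det3 z q y = det3 z q ((curv G * form G q y) *\<^sub>R q + form G T y *\<^sub>R T + form G N y *\<^sub>R N)"
      using expand[of y] by simp
    also have "\<dots> = form G T y * det3 z q T + form G N y * det3 z q N"
      by (simp add: det3_linear)
    finally show ?thesis by (simp only: det3_rotate[of z q])
  qed
  ultimately show ?thesis by simp
qed

end

lemma unit_tangent_exists:
  assumes "x \<in> surface G" shows "\<exists>v. unit_tangent G x v"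
proof -
  \<comment> \<open>The first and third coordinates of \<open>x\<close> are exchanged, with the
    signs that make the product with \<open>x\<close> vanish. In the hyperbolic case the square is
    \<open>1 + (x$2)^2\<close>.\<close>
  define v :: "real^3" where "v = vector [curv G * x$3, 0, - x$1]"
  have 0: "form G x v = 0" by (simp add: form_def v_def)
  have p: "form G v v > 0"
  proof (cases G)
    case Hyperbolic
    have "form G v v = (x$3)^2 - (x$1)^2" using Hyperbolic by (simp add: form_def v_def power2_eq_square)
    moreover have "(x$3)^2 - (x$1)^2 = 1 + (x$2)^2"
      using surfaceD(1)[OF assms] Hyperbolic by (simp add: form_def power2_eq_square)
    ultimately show ?thesis by (simp add: add_pos_nonneg)
  next
    case Spherical
    then show ?thesis using surfaceD(2)[OF assms] by (simp add: form_def v_def add_pos_nonneg)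
  qed
  show ?thesis
    using assms 0 p by (intro exI[of _ "(1 / sqrt (form G v v)) *\<^sub>R v"])
      (simp add: unit_tangent_def form_linear)
qed

lemma unit_tangent_minus: "unit_tangent G p (- v) = unit_tangent G p v"
  by (simp add: unit_tangent_def form_linear)

section \<open>Sine, cosine and distance common to both geometries\<close>

definition cg :: "geometry \<Rightarrow> real \<Rightarrow> real" where
  "cg G t = (case G of Hyperbolic \<Rightarrow> cosh t | Spherical \<Rightarrow> cos t)"
definition sg :: "geometry \<Rightarrow> real \<Rightarrow> real" where
  "sg G t = (case G of Hyperbolic \<Rightarrow> sinh t | Spherical \<Rightarrow> sin t)"

lemma geo_cg: "geo G p v t = cg G t *\<^sub>R p + sg G t *\<^sub>R v"
  by (cases G) (auto simp: cg_def sg_def)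

lemma cg_sg_square: "(cg G t)\<^sup>2 + curv G * (sg G t)\<^sup>2 = 1"
  using cosh_square_eq[of t] by (cases G) (auto simp: cg_def sg_def)

lemma cg_add: "cg G (s + t) = cg G s * cg G t - curv G * sg G s * sg G t"
  by (cases G) (simp_all add: cg_def sg_def cosh_add cos_add)

lemma sg_add: "sg G (s + t) = sg G s * cg G t + cg G s * sg G t"
  by (cases G) (simp_all add: cg_def sg_def sinh_add sin_add)

lemma cg_minus [simp]: "cg G (- t) = cg G t"
  by (cases G) (simp_all add: cg_def)

lemma sg_minus [simp]: "sg G (- t) = - sg G t"
  by (cases G) (simp_all add: sg_def)

lemma cg_0 [simp]: "cg G 0 = 1"
  by (cases G) (simp_all add: cg_def)

lemma sg_0 [simp]: "sg G 0 = 0"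
  by (cases G) (simp_all add: sg_def)

lemma continuous_on_cg [continuous_intros]: "continuous_on (A :: 'a::t2_space set) f \<Longrightarrow> continuous_on A (\<lambda>x. cg G (f x))"
  by (cases G) (auto simp: cg_def intro: continuous_intros)

lemma continuous_on_sg [continuous_intros]: "continuous_on (A :: 'a::t2_space set) f \<Longrightarrow> continuous_on A (\<lambda>x. sg G (f x))"
  by (cases G) (auto simp: sg_def intro: continuous_intros)

lemma form_geo:
  assumes "unit_tangent G p v"
  shows "form G (geo G p v t) (geo G p v t) = curv G"
    and "form G p (geo G p v t) = curv G * cg G t"
proof -
  interpret frame G p v by unfold_locales fact
  show "form G p (geo G p v t) = curv G * cg G t"
    by (simp add: geo_cg form_linear qT)
  have "form G (geo G p v t) (geo G p v t) = curv G * ((cg G t)\<^sup>2 + curv G * (sg G t)\<^sup>2)"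
    by (simp add: geo_cg form_linear qT power2_eq_square algebra_simps)
  then show "form G (geo G p v t) (geo G p v t) = curv G" by (simp add: cg_sg_square)
qed

text \<open>A vector of square -1 lies on one of two sheets. On the lower one, Cauchy-Schwarz for
  the first two coordinates would make the product with \<open>x\<close> nonnegative.\<close>

lemma hyperbolic_third_pos:
  assumes x: "x \<in> surface Hyperbolic" and y: "form Hyperbolic y y = -1" "form Hyperbolic x y < 0"
  shows "y $ 3 > 0"
proof (rule ccontr)
  assume "\<not> y $ 3 > 0"
  then have y3: "- y$3 \<ge> 0" by simp
  have x3: "x$3 > 0" using x by (simp add: surface_def)
  define u v where "u = (vector [x$1, x$2] :: real^2)" and "v = (vector [y$1, y$2] :: real^2)"
  have nu: "norm u < x$3"
  proof (rule power2_less_imp_less)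
    show "(norm u)\<^sup>2 < (x$3)\<^sup>2"
      using x unfolding power2_norm_eq_inner
      by (simp add: surface_def form_def u_def inner_vec_def sum_2 power2_eq_square)
  qed (use x3 in simp)
  have nv: "norm v \<le> - y$3"
  proof (rule power2_le_imp_le)
    show "(norm v)\<^sup>2 \<le> (- y$3)\<^sup>2"
      using y unfolding power2_norm_eq_inner
      by (simp add: form_def v_def inner_vec_def sum_2 power2_eq_square)
  qed (use y3 in simp)
  have "\<bar>u \<bullet> v\<bar> \<le> norm u * norm v" by (rule Cauchy_Schwarz_ineq2)
  also have "\<dots> \<le> x$3 * (- y$3)" using nu nv x3 by (intro mult_mono) auto
  finally have "form Hyperbolic x y \<ge> 0"
    by (simp add: form_def u_def v_def inner_vec_def sum_2)
  then show False using y by simp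
qed

text \<open>Reversed Cauchy-Schwarz inequality: in a frame at \<open>x\<close> the tangential part
  of \<open>y\<close> has nonnegative square, so the coordinate along \<open>x\<close> has absolute
  value at least 1. Its sign is settled by \<open>hyperbolic_third_pos\<close>, applied to
  \<open>- y\<close>.\<close>

lemma surface_form_hyperbolic:
  assumes x: "x \<in> surface Hyperbolic" and y: "y \<in> surface Hyperbolic"
  shows "form Hyperbolic x y \<le> -1"
proof -
  have neg: "form Hyperbolic x y < 0"
  proof (rule ccontr)
    assume n: "\<not> form Hyperbolic x y < 0"
    have "form Hyperbolic x y \<noteq> 0"
    proof
      assume 0: "form Hyperbolic x y = 0"
      obtain T where T: "unit_tangent Hyperbolic x T" using unit_tangent_exists[OF x] by blast
      interpret frame Hyperbolic x T by unfold_locales fact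
      have "- 1 = form Hyperbolic T y * form Hyperbolic T y + form Hyperbolic N y * form Hyperbolic N y"
        using form_expand[of y y] surfaceD(1)[OF y] 0 by simp
      then show False
        using zero_le_square[of "form Hyperbolic T y"] zero_le_square[of "form Hyperbolic N y"] by linarith
    qed
    then have "form Hyperbolic x (- y) < 0" using n by (simp add: form_linear)
    then have "(- y) $ 3 > 0"
      using y by (intro hyperbolic_third_pos[OF x]) (auto simp: form_linear surface_def)
    then show False using y by (simp add: surface_def)
  qed
  obtain T where T: "unit_tangent Hyperbolic x T" using unit_tangent_exists[OF x] by blast
  interpret frame Hyperbolic x T by unfold_locales fact
  have "- 1 = - (form Hyperbolic x y * form Hyperbolic x y) + form Hyperbolic T y * form Hyperbolic T y
      + form Hyperbolic N y * form Hyperbolic N y"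
    using form_expand[of y y] surfaceD(1)[OF y] by simp
  then have "(form Hyperbolic x y)\<^sup>2 \<ge> 1\<^sup>2"
    using zero_le_square[of "form Hyperbolic T y"] zero_le_square[of "form Hyperbolic N y"]
    unfolding power2_eq_square by linarith
  then have "\<bar>form Hyperbolic x y\<bar> \<ge> 1" using abs_le_square_iff[of 1 "form Hyperbolic x y"] by simp
  then show ?thesis using neg by linarith
qed

text \<open>This is \<open>sg\<close> of the distance, written without an inverse function; being
  algebraic in the form, it is easy to differentiate.\<close>

definition sn :: "geometry \<Rightarrow> real^3 \<Rightarrow> real^3 \<Rightarrow> real" where
  "sn G x y = sqrt (curv G * (1 - (form G x y)\<^sup>2))"

lemma sn_commute: "sn G x y = sn G y x"
  by (simp add: sn_def form_commute)

lemma (in frame) frame_square: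
  assumes "z \<in> surface G"
  shows "(form G T z)\<^sup>2 + (form G N z)\<^sup>2 = curv G * (1 - (form G q z)\<^sup>2)"
  using form_expand[of z z] surfaceD(1)[OF assms] by (simp add: power2_eq_square algebra_simps)

lemma (in frame) sn_eq:
  assumes "z \<in> surface G" shows "sn G q z = sqrt ((form G T z)\<^sup>2 + (form G N z)\<^sup>2)"
  using frame_square[OF assms] by (simp add: sn_def)

lemma sn_square:
  assumes "x \<in> surface G" "y \<in> surface G"
  shows "(sn G x y)\<^sup>2 = curv G * (1 - (form G x y)\<^sup>2)" "sn G x y \<ge> 0"
proof -
  obtain T where T: "unit_tangent G x T" using unit_tangent_exists assms by blast
  interpret frame G x T by unfold_locales fact
  have "curv G * (1 - (form G x y)\<^sup>2) \<ge> 0" using frame_square[OF assms(2)] by (metis add_nonneg_nonneg zero_le_power2)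
  then show "(sn G x y)\<^sup>2 = curv G * (1 - (form G x y)\<^sup>2)" "sn G x y \<ge> 0" by (simp_all add: sn_def)
qed

text \<open>Squares scale by \<open>r^2\<close>, and the positive third coordinate excludes
  \<open>r = -1\<close>. This carries facts about cones back to the surface.\<close>

lemma surface_scale_eq:
  assumes "x \<in> surface G" "r *\<^sub>R x \<in> surface G" shows "r = 1"
proof -
  have "r * (r * curv G) = curv G" using assms by (simp add: surface_def form_linear)
  then have "r\<^sup>2 = 1"
    by (metis curv_nonzero mult.assoc mult_cancel_right1 power2_eq_square)
  moreover have "r > 0" using assms by (simp add: surface_def zero_less_mult_iff)
  ultimately show ?thesis by (simp add: power2_eq_1_iff)
qed

lemma sn_pos:
  assumes "x \<in> surface G" "y \<in> surface G" "x \<noteq> y" shows "sn G x y > 0"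
proof -
  obtain T where T: "unit_tangent G x T" using unit_tangent_exists assms by blast
  interpret frame G x T by unfold_locales fact
  have "sn G x y \<noteq> 0"
  proof
    assume "sn G x y = 0"
    then have "form G T y = 0" "form G N y = 0"
      using sn_eq[OF assms(2)] by (simp_all add: sum_power2_eq_zero_iff)
    then have "y = (curv G * form G x y) *\<^sub>R x" using expand[of y] by simp
    then show False using surface_scale_eq[OF assms(1), of "curv G * form G x y"] assms by simp
  qed
  then show ?thesis using sn_square(2)[OF assms(1,2)] by simp
qed

text \<open>The identity between \<open>cg\<close> and \<open>sg\<close> determines
  \<open>sg\<close> of the distance up to sign; the ranges of \<open>arcosh\<close> and
  \<open>arccos\<close> fix the sign.\<close>

lemma gdist_facts:
  assumes x: "x \<in> surface G" and y: "y \<in> surface G"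
  shows "cg G (gdist G x y) = curv G * form G x y" "sg G (gdist G x y) = sn G x y" "gdist G x y \<ge> 0"
    "G = Spherical \<Longrightarrow> gdist G x y \<le> pi" "gdist G x y = gdist G y x"
proof -
  have 1: "cg G (gdist G x y) = curv G * form G x y \<and> gdist G x y \<ge> 0 \<and> sg G (gdist G x y) \<ge> 0 \<and>
    (G = Spherical \<longrightarrow> gdist G x y \<le> pi)"
  proof (cases G)
    case Hyperbolic
    have "- form Hyperbolic x y \<ge> 1" using surface_form_hyperbolic x y Hyperbolic by fastforce
    then show ?thesis
      using Hyperbolic by (simp add: cg_def sg_def cosh_arcosh_real arcosh_nonneg_real)
  next
    case Spherical
    have "(form G x y)\<^sup>2 \<le> 1" using sn_square[OF x y] Spherical
      by (metis curv.simps(2) diff_ge_0_iff_ge mult_1 zero_le_power2)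
    then have "\<bar>form G x y\<bar> \<le> 1" by (simp add: abs_square_le_1)
    then have "-1 \<le> form G x y \<and> form G x y \<le> 1" by auto
    then show ?thesis
      using Spherical by (auto simp: cg_def sg_def arccos_lbound arccos_ubound intro!: sin_ge_zero)
  qed
  then show "cg G (gdist G x y) = curv G * form G x y" "gdist G x y \<ge> 0" "G = Spherical \<Longrightarrow> gdist G x y \<le> pi" by auto
  have "(sg G (gdist G x y))\<^sup>2 = (sn G x y)\<^sup>2"
    using cg_sg_square[of G "gdist G x y"] 1 sn_square(1)[OF x y]
    by (cases G) (simp_all add: power_mult_distrib algebra_simps)
  then show "sg G (gdist G x y) = sn G x y"
    using 1 sn_square(2)[OF x y] by (simp add: power2_eq_iff_nonneg)
  show "gdist G x y = gdist G y x" by (cases G) (simp_all add: form_commute)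
qed

lemma gdist_eqI:
  assumes "x \<in> surface G" "y \<in> surface G" "0 \<le> t" "G = Spherical \<Longrightarrow> t \<le> pi"
    "form G x y = curv G * cg G t"
  shows "gdist G x y = t"
  using assms by (cases G) (simp_all add: cg_def arcosh_cosh_real arccos_cos)

lemma gdist_self [simp]: "x \<in> surface G \<Longrightarrow> gdist G x x = 0"
  by (rule gdist_eqI) (auto simp: surfaceD)

definition towards :: "geometry \<Rightarrow> real^3 \<Rightarrow> real^3 \<Rightarrow> real^3" where
  "towards G x y = (1 / sn G x y) *\<^sub>R (y - (curv G * form G x y) *\<^sub>R x)"

lemma towards:
  assumes x: "x \<in> surface G" and y: "y \<in> surface G" and ne: "x \<noteq> y"
  shows "unit_tangent G x (towards G x y)" "geo G x (towards G x y) (gdist G x y) = y"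
    "y = (curv G * form G x y) *\<^sub>R x + sn G x y *\<^sub>R towards G x y"
proof -
  have s: "sn G x y > 0" by (rule sn_pos) fact+
  have "form G (y - (curv G * form G x y) *\<^sub>R x) (y - (curv G * form G x y) *\<^sub>R x) = (sn G x y)\<^sup>2"
    using x y unfolding sn_square(1)[OF x y]
    by (simp add: form_linear surfaceD form_commute[of G y x] power2_eq_square algebra_simps)
  then show "unit_tangent G x (towards G x y)"
    using x s unfolding towards_def unit_tangent_def bounded_bilinear.scaleR_left[OF bounded_bilinear_form]
      bounded_bilinear.scaleR_right[OF bounded_bilinear_form]
    by (simp add: power2_eq_square) (simp add: form_linear surfaceD)
  show e: "y = (curv G * form G x y) *\<^sub>R x + sn G x y *\<^sub>R towards G x y"
    using s by (simp add: towards_def)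
  then show "geo G x (towards G x y) (gdist G x y) = y"
    using gdist_facts[OF x y] by (simp add: geo_cg)
qed

section \<open>Convex sets and cones\<close>

lemma sg_pos: "0 < t \<Longrightarrow> (G = Spherical \<Longrightarrow> t < pi) \<Longrightarrow> sg G t > 0"
  by (cases G) (auto simp: sg_def sin_gt_zero)

lemma sg_diff: "sg G (s - t) = sg G s * cg G t - cg G s * sg G t"
  using sg_add[of G s "- t"] by simp

text \<open>A geodesic is a section of the surface by a plane through the origin, so geodesic
  convexity of \<open>A\<close> becomes ordinary convexity of the union of rays through
  \<open>A\<close>, and separation by hyperplanes is available. The origin is left out so that every
  element determines a point of \<open>A\<close>.\<close>

definition ocone :: "(real^3) set \<Rightarrow> (real^3) set" where
  "ocone A = {r *\<^sub>R x | r x. r > 0 \<and> x \<in> A}"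

lemma oconeI: "r > 0 \<Longrightarrow> x \<in> A \<Longrightarrow> r *\<^sub>R x \<in> ocone A"
  by (auto simp: ocone_def)

lemma ocone_superset: "x \<in> A \<Longrightarrow> x \<in> ocone A"
  using oconeI[of 1 x A] by simp

lemma ocone_scale: "r > 0 \<Longrightarrow> x \<in> ocone A \<Longrightarrow> r *\<^sub>R x \<in> ocone A"
  by (auto simp: ocone_def) (metis mult_pos_pos)

lemma ocone_surface:
  assumes "A \<subseteq> surface G" "x \<in> surface G" "x \<in> ocone A" shows "x \<in> A"
proof -
  obtain r y where "x = r *\<^sub>R y" "y \<in> A" using assms(3) by (auto simp: ocone_def)
  then show ?thesis using surface_scale_eq[of y G r] assms by auto
qed

text \<open>The point at distance \<open>t\<close> from \<open>x\<close> on the segment to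
  \<open>y\<close> is proportional to \<open>sg G (d - t)\<close> times \<open>x\<close> plus
  \<open>sg G t\<close> times \<open>y\<close>; the intermediate value theorem finds the
  \<open>t\<close> with the prescribed ratio.\<close>

lemma ocone_combination:
  assumes A: "geo_convex G A" and x: "x \<in> A" and y: "y \<in> A" and ab: "0 \<le> a" "0 \<le> b" "a + b > 0"
  shows "a *\<^sub>R x + b *\<^sub>R y \<in> ocone A"
proof (cases "x = y")
  case True
  then have "a *\<^sub>R x + b *\<^sub>R y = (a + b) *\<^sub>R x" by (simp add: scaleR_left_distrib)
  then show ?thesis using oconeI[OF ab(3) x] by simp
next
  case False
  have xs: "x \<in> surface G" and ys: "y \<in> surface G" using A x y by (auto simp: geo_convex_def)
  define v d where "v = towards G x y" and "d = gdist G x y"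
  have v: "unit_tangent G x v" "geo G x v d = y" using towards[OF xs ys False] by (auto simp: v_def d_def)
  have sd: "sg G d > 0" "d \<ge> 0" using gdist_facts[OF xs ys] sn_pos[OF xs ys False] by (auto simp: d_def)
  have "continuous_on {0..d} (\<lambda>t. a * sg G t - b * sg G (d - t))" by (intro continuous_intros)
  then obtain t where t: "0 \<le> t" "t \<le> d" "a * sg G t - b * sg G (d - t) = 0"
    using IVT'[of "\<lambda>t. a * sg G t - b * sg G (d - t)" 0 0 d] sd ab by auto
  define p where "p = geo G x v t"
  have p: "p \<in> A"
    using A x y v t unfolding geo_convex_def geodesic_segment_def p_def d_def by blast
  then have ps: "p \<in> surface G" using A by (auto simp: geo_convex_def)
  have e: "sg G d *\<^sub>R p = sg G (d - t) *\<^sub>R x + sg G t *\<^sub>R y"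
    unfolding p_def v(2)[symmetric] by (simp add: geo_cg sg_diff algebra_simps)
  define s where "s = sg G (d - t) + sg G t"
  have "((a + b) * sg G d) *\<^sub>R p = (a + b) *\<^sub>R (sg G (d - t) *\<^sub>R x + sg G t *\<^sub>R y)"
    by (simp flip: e)
  also have "\<dots> = (a * sg G (d - t) + b * sg G (d - t)) *\<^sub>R x + (a * sg G t + b * sg G t) *\<^sub>R y"
    by (simp add: algebra_simps)
  also have "\<dots> = s *\<^sub>R (a *\<^sub>R x + b *\<^sub>R y)"
    using t(3) by (simp add: s_def algebra_simps)
  finally have e2: "((a + b) * sg G d) *\<^sub>R p = s *\<^sub>R (a *\<^sub>R x + b *\<^sub>R y)" .
  \<comment> \<open>Third coordinates are positive on the surface, so comparing them gives
    \<open>s > 0\<close>.\<close>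
  have "(((a + b) * sg G d) *\<^sub>R p)$3 > 0" using ab sd surfaceD(2)[OF ps] by simp
  then have "s * (a * x$3 + b * y$3) > 0" unfolding e2 by simp
  moreover have "a * x$3 + b * y$3 \<ge> 0" using ab surfaceD(2)[OF xs] surfaceD(2)[OF ys] by simp
  ultimately have s: "s > 0" by (simp add: zero_less_mult_iff)
  have "a *\<^sub>R x + b *\<^sub>R y = (((a + b) * sg G d) / s) *\<^sub>R p"
  proof -
    have "(1 / s) *\<^sub>R (s *\<^sub>R (a *\<^sub>R x + b *\<^sub>R y)) = (1 / s) *\<^sub>R (((a + b) * sg G d) *\<^sub>R p)"
      unfolding e2 ..
    then show ?thesis using s by simp
  qed
  then show ?thesis using oconeI[OF _ p, of "((a + b) * sg G d) / s"] s ab sd by simp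
qed

lemma convex_ocone:
  assumes A: "geo_convex G A" shows "convex (ocone A)"
proof (rule convexI)
  fix p q and u v :: real
  assume p: "p \<in> ocone A" and q: "q \<in> ocone A" and uv: "0 \<le> u" "0 \<le> v" "u + v = 1"
  obtain r x s y where "p = r *\<^sub>R x" "q = s *\<^sub>R y" "r > 0" "s > 0" "x \<in> A" "y \<in> A"
    using p q by (auto simp: ocone_def)
  moreover have "u * r + v * s > 0"
  proof (cases "u > 0")
    case True
    then show ?thesis using \<open>r > 0\<close> \<open>s > 0\<close> uv by (simp add: add_pos_nonneg)
  next
    case False
    then have "v = 1" "u = 0" using uv by auto
    then show ?thesis using \<open>s > 0\<close> by simp
  qed
  ultimately show "u *\<^sub>R p + v *\<^sub>R q \<in> ocone A"
    using ocone_combination[OF A, of x y "u * r" "v * s"] uv by simp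
qed

text \<open>From the cone to the surface it is a restriction. Conversely, radial projection to the
  surface is continuous near \<open>x\<close> and pulls a relative neighbourhood contained in
  \<open>A\<close> back to an open set in the cone.\<close>

lemma interior_ocone_iff:
  assumes A: "A \<subseteq> surface G" and x: "x \<in> surface G"
  shows "x \<in> interior (ocone A) \<longleftrightarrow> x \<in> (top_of_set (surface G)) interior_of A"
proof
  assume "x \<in> interior (ocone A)"
  moreover have "openin (top_of_set (surface G)) (surface G \<inter> interior (ocone A))" by blast
  moreover have "surface G \<inter> interior (ocone A) \<subseteq> A"
    using ocone_surface[OF A] interior_subset by blast
  ultimately show "x \<in> (top_of_set (surface G)) interior_of A"
    using x unfolding interior_of_def by blast
next
  assume "x \<in> (top_of_set (surface G)) interior_of A"
  then obtain W where W: "open W" "x \<in> W" "surface G \<inter> W \<subseteq> A"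
    unfolding interior_of_def openin_open by blast
  define \<Omega> where "\<Omega> = {y::real^3. y$3 > 0 \<and> curv G * form G y y > 0}"
  define \<nu> where "\<nu> y = (1 / sqrt (curv G * form G y y)) *\<^sub>R y" for y
  have "open \<Omega>" unfolding \<Omega>_def
    by (intro open_Collect_conj open_Collect_less continuous_intros)
  moreover have "continuous_on \<Omega> \<nu>" unfolding \<nu>_def[abs_def] \<Omega>_def
    by (intro continuous_intros) auto
  ultimately have op: "open (\<Omega> \<inter> \<nu> -` W)"
    using W(1) by (simp add: continuous_on_open_vimage Int_commute)
  have "\<nu> x = x" "x \<in> \<Omega>" using x by (auto simp: \<nu>_def \<Omega>_def surface_def)
  then have "x \<in> \<Omega> \<inter> \<nu> -` W" using W by simp
  moreover have "\<Omega> \<inter> \<nu> -` W \<subseteq> ocone A"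
  proof
    fix y assume y: "y \<in> \<Omega> \<inter> \<nu> -` W"
    then have pos: "y$3 > 0" "curv G * form G y y > 0" by (auto simp: \<Omega>_def)
    have "form G (\<nu> y) (\<nu> y) = curv G"
    proof -
      have "form G (\<nu> y) (\<nu> y) = form G y y / (curv G * form G y y)"
        using pos(2) by (cases "form G y y = 0") (auto simp: \<nu>_def form_linear field_simps)
      then show ?thesis using pos(2) by (cases G) auto
    qed
    then have "\<nu> y \<in> surface G" using pos by (simp add: surface_def \<nu>_def)
    then have "\<nu> y \<in> A" using y W by auto
    moreover have "form G y y \<noteq> 0" using pos(2) by auto
    then have "y = sqrt (curv G * form G y y) *\<^sub>R \<nu> y" by (simp add: \<nu>_def)
    ultimately show "y \<in> ocone A" using oconeI[of "sqrt (curv G * form G y y)" "\<nu> y" A] pos by simp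
  qed
  ultimately show "x \<in> interior (ocone A)" using op by (meson interiorI)
qed

lemma boundary_iff:
  assumes "compact A" "A \<subseteq> surface G"
  shows "x \<in> boundary G A \<longleftrightarrow> x \<in> A \<and> x \<notin> interior (ocone A)"
proof -
  have "closedin (top_of_set (surface G)) A"
    using assms by (simp add: closed_subset compact_imp_closed)
  then have "boundary G A = A - (top_of_set (surface G)) interior_of A"
    by (simp add: boundary_def frontier_of_def closure_of_closedin)
  then show ?thesis using interior_ocone_iff[OF assms(2), of x] assms(2) by auto
qed

text \<open>A small step in the direction \<open>- w\<close> stays in the cone, where
  \<open>w\<close> is still nonnegative, but lowers the value by a positive amount.\<close>

lemma interior_ocone_pos:
  assumes "w \<noteq> 0" "\<And>z. z \<in> A \<Longrightarrow> 0 \<le> w \<bullet> z" "x \<in> interior (ocone A)"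
  shows "0 < w \<bullet> x"
proof -
  obtain e where e: "e > 0" "ball x e \<subseteq> ocone A" using assms(3) mem_interior by blast
  define y where "y = x - (e / (2 * norm w)) *\<^sub>R w"
  have "y \<in> ball x e" using e(1) assms(1) by (simp add: y_def dist_norm)
  then obtain r z where "y = r *\<^sub>R z" "r > 0" "z \<in> A" using e(2) by (auto simp: ocone_def)
  then have "0 \<le> w \<bullet> y" using assms(2)[of z] by simp
  moreover have "w \<bullet> y = w \<bullet> x - e / (2 * norm w) * (w \<bullet> w)" by (simp add: y_def inner_diff_right)
  moreover have "e / (2 * norm w) * (w \<bullet> w) > 0" using e(1) assms(1) by simp
  ultimately show ?thesis by linarith
qed

text \<open>A hyperplane supports the convex cone at \<open>x\<close>. As the cone also contains
  twice and half of \<open>x\<close>, this hyperplane passes through the origin and cuts out a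
  supporting geodesic.\<close>

lemma supporting_functional:
  assumes A: "geo_convex G A" and x: "x \<in> A" "x \<notin> interior (ocone A)"
    and ne: "interior (ocone A) \<noteq> {}"
  obtains w where "w \<noteq> 0" "w \<bullet> x = 0" "\<And>z. z \<in> A \<Longrightarrow> 0 \<le> w \<bullet> z"
proof -
  have ri: "rel_interior (ocone A) = interior (ocone A)" using ne by (rule rel_interior_nonempty_interior)
  obtain w where w: "w \<noteq> 0" "\<And>y. y \<in> ocone A \<Longrightarrow> w \<bullet> x \<le> w \<bullet> y"
    using supporting_hyperplane_rel_boundary[OF convex_ocone[OF A] ocone_superset[OF x(1)]] x(2) ri
    by metis
  have "w \<bullet> x \<le> w \<bullet> (2 *\<^sub>R x)" "w \<bullet> x \<le> w \<bullet> ((1/2) *\<^sub>R x)"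
    by (auto intro!: w(2) oconeI[OF _ x(1)] simp del: inner_scaleR_right)
  then have 0: "w \<bullet> x = 0" by simp
  show ?thesis
  proof (rule that[OF w(1) 0])
    show "0 \<le> w \<bullet> z" if "z \<in> A" for z using w(2)[OF ocone_superset[OF that]] 0 by simp
  qed
qed

section \<open>Chords through a point of a compact set\<close>

lemma geodesic_exit:
  assumes A: "compact A" "A \<subseteq> surface G" and x: "x \<in> A" "x \<notin> boundary G A" and v: "unit_tangent G x v"
  shows "\<exists>t>0. (G = Spherical \<longrightarrow> t < pi) \<and> geo G x v t \<in> boundary G A"
proof -
  have xs: "x \<in> surface G" using A x by auto
  have cont: "continuous_on B (geo G x v)" for B
    unfolding geo_cg[abs_def] by (intro continuous_intros)
  have "\<exists>t0>0. (G = Spherical \<longrightarrow> t0 < pi) \<and> geo G x v t0 \<notin> A \<and> (\<forall>s\<in>{0..t0}. geo G x v s \<in> surface G)"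
  proof (cases G)
    case Hyperbolic
    have in_surf: "geo G x v s \<in> surface G" for s
    proof -
      have f: "form G (geo G x v s) (geo G x v s) = curv G" "form G x (geo G x v s) = curv G * cg G s"
        using form_geo[OF v] by auto
      have "geo G x v s $ 3 > 0"
        using hyperbolic_third_pos[of x "geo G x v s"] f xs Hyperbolic by (simp add: cg_def)
      then show ?thesis using f(1) by (simp add: surface_def)
    qed
    \<comment> \<open>The product with \<open>x\<close> is bounded on \<open>A\<close> but grows
      like \<open>cosh\<close> along the geodesic.\<close>
    have "bounded ((\<lambda>z. form G x z) ` A)"
      by (intro compact_imp_bounded compact_continuous_image A continuous_intros)
    then obtain b where b: "\<And>z. z \<in> A \<Longrightarrow> \<bar>form G x z\<bar> \<le> b" by (auto simp: bounded_iff)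
    define t where "t = arcosh (\<bar>b\<bar> + 2)"
    have t: "cosh t = \<bar>b\<bar> + 2" "t > 0" by (auto simp: t_def arcosh_real_gt_1_iff)
    have "\<bar>form G x (geo G x v t)\<bar> = \<bar>b\<bar> + 2"
      unfolding form_geo(2)[OF v] using Hyperbolic t(1) by (simp add: cg_def)
    then have "geo G x v t \<notin> A" using b by force
    then show ?thesis using t in_surf Hyperbolic by blast
  next
    case Spherical
    obtain z0 where z0: "z0 \<in> A" "\<And>z. z \<in> A \<Longrightarrow> z0 $ 3 \<le> z $ 3"
    proof -
      have "A \<noteq> {}" "continuous_on A (\<lambda>z. z $ 3)" using x(1) by (auto intro: continuous_intros)
      then show ?thesis using continuous_attains_inf[OF A(1)] that by blast
    qed
    \<comment> \<open>Half the least height of \<open>A\<close>: when the great circle first sinks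
      to this level it has left \<open>A\<close> but not yet the hemisphere, so the arc up to that
      time is a connected subset of the surface.\<close>
    define h where "h = z0 $ 3 / 2"
    have h: "0 < h" "h < x $ 3" using z0(1) z0(2)[OF x(1)] A(2) surfaceD(2)[of z0 G] by (auto simp: h_def)
    define \<phi> where "\<phi> t = geo G x v t $ 3" for t
    have c\<phi>: "continuous_on B \<phi>" for B unfolding \<phi>_def[abs_def] by (intro continuous_intros cont)
    have \<phi>0: "\<phi> 0 = x $ 3" "\<phi> pi = - x $ 3" by (auto simp: \<phi>_def geo_cg cg_def sg_def Spherical)
    define S where "S = {t\<in>{0..pi}. \<phi> t = h}"
    have ivt: "\<exists>t\<in>S. t \<le> s" if "0 \<le> s" "s \<le> pi" "\<phi> s \<le> h" for s
      using IVT2'[of \<phi> s h 0, OF that(3) _ that(1) c\<phi>] h \<phi>0 that by (auto simp: S_def)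
    have "S \<noteq> {}" using ivt[of pi] h \<phi>0 by auto
    moreover have "compact S"
    proof -
      have "closed S" unfolding S_def by (rule continuous_closed_preimage_constant[OF c\<phi>]) auto
      moreover have "bounded S" by (rule bounded_subset[of "{0..pi}"]) (auto simp: S_def)
      ultimately show ?thesis by (simp add: compact_eq_bounded_closed)
    qed
    ultimately obtain t where t: "t \<in> S" "\<And>s. s \<in> S \<Longrightarrow> t \<le> s"
      using compact_attains_inf[of S] by blast
    have tp: "0 < t" "t < pi" "\<phi> t = h" using t(1) h \<phi>0 by (auto simp: S_def less_le)
    have "geo G x v t \<notin> A" using z0(2) tp(3) z0(1) h by (force simp: \<phi>_def h_def)
    moreover have "geo G x v s \<in> surface G" if "s \<in> {0..t}" for s
    proof -
      have "\<phi> s \<ge> h"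
      proof (rule ccontr)
        assume "\<not> \<phi> s \<ge> h"
        then have "0 \<le> s" "s \<le> pi" "\<phi> s \<le> h" using that tp(2) by auto
        then obtain u where "u \<in> S" "u \<le> s" using ivt[of s] by blast
        then show False using t(2)[of u] that \<open>\<not> \<phi> s \<ge> h\<close> tp(3) by (cases "s = t") auto
      qed
      then show ?thesis using form_geo(1)[OF v] h by (simp add: surface_def \<phi>_def)
    qed
    ultimately show ?thesis using tp by blast
  qed
  then obtain t0 where t0: "t0 > 0" "G = Spherical \<Longrightarrow> t0 < pi" "geo G x v t0 \<notin> A"
    "\<And>s. s \<in> {0..t0} \<Longrightarrow> geo G x v s \<in> surface G" by blast
  have g0: "geo G x v 0 = x" by (simp add: geo_cg)
  have "connected (geo G x v ` {0..t0})"
    by (intro connected_continuous_image cont) auto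
  then have "connectedin (top_of_set (surface G)) (geo G x v ` {0..t0})"
    using t0(4) by (auto simp: connectedin_subtopology)
  moreover have "geo G x v ` {0..t0} \<inter> A \<noteq> {}" using g0 x(1) t0(1) by force
  moreover have "geo G x v t0 \<in> geo G x v ` {0..t0} - A" using t0(1,3) by simp
  then have "geo G x v ` {0..t0} - A \<noteq> {}" by blast
  ultimately have "geo G x v ` {0..t0} \<inter> boundary G A \<noteq> {}"
    unfolding boundary_def by (rule connectedin_Int_frontier_of)
  then obtain t where t: "t \<in> {0..t0}" "geo G x v t \<in> boundary G A" by blast
  moreover have "t \<noteq> 0" using t(2) x(2) g0 by auto
  ultimately have "t > 0" "G = Spherical \<longrightarrow> t < pi" using t0(2) by force+
  then show ?thesis using t(2) by blast
qed

text \<open>The point \<open>x\<close> is a combination of the two exit points with weights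
  \<open>sg G b\<close> and \<open>sg G a\<close>. Comparing third coordinates gives
  \<open>sg G (a + b) > 0\<close>, so on the sphere the chord is shorter than a half circle and its
  length is \<open>a + b\<close>.\<close>

lemma geodesic_chord:
  assumes A: "compact A" "A \<subseteq> surface G" and x: "x \<in> A" "x \<notin> boundary G A" and v: "unit_tangent G x v"
  obtains a b where "a > 0" "b > 0" "sg G a > 0" "sg G b > 0" "sg G (a + b) > 0"
    "geo G x v a \<in> boundary G A" "geo G x (- v) b \<in> boundary G A"
    "gdist G (geo G x v a) (geo G x (- v) b) = a + b"
    "sg G (a + b) *\<^sub>R x = sg G b *\<^sub>R geo G x v a + sg G a *\<^sub>R geo G x (- v) b"
proof -
  have v': "unit_tangent G x (- v)" using v by (simp add: unit_tangent_minus)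
  obtain a where a: "a > 0" "G = Spherical \<Longrightarrow> a < pi" "geo G x v a \<in> boundary G A"
    using geodesic_exit[OF A x v] by blast
  obtain b where b: "b > 0" "G = Spherical \<Longrightarrow> b < pi" "geo G x (- v) b \<in> boundary G A"
    using geodesic_exit[OF A x v'] by blast
  have s: "sg G a > 0" "sg G b > 0" using a b by (auto intro: sg_pos)
  have e: "sg G (a + b) *\<^sub>R x = sg G b *\<^sub>R geo G x v a + sg G a *\<^sub>R geo G x (- v) b"
    by (simp add: geo_cg sg_add algebra_simps)
  have surf: "geo G x v a \<in> surface G" "geo G x (- v) b \<in> surface G" "x \<in> surface G"
    using a(3) b(3) A x by (auto simp: boundary_iff)
  have "sg G (a + b) * x$3 = (sg G b *\<^sub>R geo G x v a + sg G a *\<^sub>R geo G x (- v) b)$3"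
    by (simp flip: e)
  also have "\<dots> > 0" using s surfaceD(2)[OF surf(1)] surfaceD(2)[OF surf(2)] by (simp add: add_pos_pos)
  finally have sab: "sg G (a + b) > 0" using surfaceD(2)[OF surf(3)] by (simp add: zero_less_mult_iff)
  interpret frame G x v by unfold_locales fact
  have "form G (geo G x v a) (geo G x (- v) b) = curv G * cg G (a + b)"
    by (simp add: geo_cg form_linear qT cg_add algebra_simps)
  moreover have "a + b \<le> pi" if "G = Spherical"
  proof (rule ccontr)
    assume "\<not> a + b \<le> pi"
    then have "sin (a + b - pi) \<ge> 0" using a b that by (intro sin_ge_zero) auto
    then show False using sab that by (simp add: sg_def sin_diff)
  qed
  ultimately have "gdist G (geo G x v a) (geo G x (- v) b) = a + b"
    using a b surf by (intro gdist_eqI) auto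
  then show ?thesis using that a b s sab e by blast
qed

text \<open>A caustic is required to lie in the table as a curve. Each further point of the region
  it bounds lies on a chord with ends on the curve, and the table is convex.\<close>

lemma subset_if_boundary_subset:
  assumes C: "compact C" "C \<subseteq> surface G" and K: "geo_convex G K" and sub: "boundary G C \<subseteq> K"
  shows "C \<subseteq> K"
proof
  fix z assume z: "z \<in> C"
  show "z \<in> K"
  proof (cases "z \<in> boundary G C")
    case True then show ?thesis using sub by auto
  next
    case False
    have zs: "z \<in> surface G" using z C by auto
    obtain v where v: "unit_tangent G z v" using unit_tangent_exists[OF zs] by blast
    obtain a b where ab: "sg G a > 0" "sg G b > 0" "sg G (a + b) > 0"
      "geo G z v a \<in> boundary G C" "geo G z (- v) b \<in> boundary G C"
      "sg G (a + b) *\<^sub>R z = sg G b *\<^sub>R geo G z v a + sg G a *\<^sub>R geo G z (- v) b"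
      using geodesic_chord[OF C z False v] .
    have "sg G (a + b) *\<^sub>R z \<in> ocone K"
      unfolding ab(6) using ab sub by (intro ocone_combination[OF K]) auto
    then have "(1 / sg G (a + b)) *\<^sub>R (sg G (a + b) *\<^sub>R z) \<in> ocone K"
      using ab(3) by (intro ocone_scale[where r = "1 / sg G (a + b)"]) auto
    then have "z \<in> ocone K" using ab(3) by simp
    then show ?thesis using ocone_surface zs K by (auto simp: geo_convex_def)
  qed
qed

text \<open>A geodesic in the surface has an injective continuous real coordinate, but no simple
  closed curve can be mapped injectively and continuously to the real line.\<close>

lemma closed_curve_not_in_line:
  assumes \<Gamma>: "simple_closed_curve \<Gamma>" "\<Gamma> \<subseteq> surface G" and a: "a \<noteq> 0" "\<And>z. z \<in> \<Gamma> \<Longrightarrow> a \<bullet> z = 0"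
  shows False
proof -
  obtain g where g: "simple_path g" "pathfinish g = pathstart g" "path_image g = \<Gamma>"
    using \<Gamma>(1) by (auto simp: simple_closed_curve_def)
  \<comment> \<open>After central projection to the plane of height 1 the geodesic is a straight
    line with normal \<open>(a$1, a$2)\<close>; this is the coordinate along it, up to
    scale.\<close>
  define \<psi> where "\<psi> z = (a$2 * z$1 - a$1 * z$2) / z$3" for z :: "real^3"
  have pos: "z$3 > 0" if "z \<in> \<Gamma>" for z using \<Gamma>(2) that surfaceD(2) by blast
  have inj: "z = z'" if z: "z \<in> \<Gamma>" "z' \<in> \<Gamma>" "\<psi> z = \<psi> z'" for z z'
  proof -
    have p: "z$3 > 0" "z'$3 > 0" using pos z by auto
    define r where "r = z$3 / z'$3"
    have r: "z$3 = r * z'$3" using p by (simp add: r_def)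
    have o: "a$1 * z$1 + a$2 * z$2 + a$3 * z$3 = 0" "a$1 * z'$1 + a$2 * z'$2 + a$3 * z'$3 = 0"
      using a(2) z by (auto simp: inner_vec_def sum_3)
    have e1: "a$2 * (z$1 - r * z'$1) - a$1 * (z$2 - r * z'$2) = 0"
    proof -
      have "a$2 * z$1 - a$1 * z$2 = r * (a$2 * z'$1 - a$1 * z'$2)"
        using z(3) p by (simp add: \<psi>_def r_def divide_eq_eq)
      then show ?thesis by (simp add: algebra_simps)
    qed
    have "r * (a$1 * z'$1 + a$2 * z'$2 + a$3 * z'$3) = 0" using o(2) by simp
    then have e2: "a$1 * (z$1 - r * z'$1) + a$2 * (z$2 - r * z'$2) = 0"
      using o(1) r by (simp add: algebra_simps)
    have n: "(a$1)\<^sup>2 + (a$2)\<^sup>2 \<noteq> 0"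
    proof
      assume "(a$1)\<^sup>2 + (a$2)\<^sup>2 = 0"
      then have "a$1 = 0" "a$2 = 0" by (simp_all add: sum_power2_eq_zero_iff)
      moreover then have "a$3 = 0" using o(1) p by simp
      ultimately have "a = 0" by (intro vec3_eqI) simp_all
      then show False using a(1) by simp
    qed
    define u w where "u = z$1 - r * z'$1" and "w = z$2 - r * z'$2"
    have e: "a$2 * u - a$1 * w = 0" "a$1 * u + a$2 * w = 0" using e1 e2 by (auto simp: u_def w_def)
    have "((a$1)\<^sup>2 + (a$2)\<^sup>2) * u = a$2 * (a$2 * u - a$1 * w) + a$1 * (a$1 * u + a$2 * w)"
      by (simp add: power2_eq_square algebra_simps)
    then have "((a$1)\<^sup>2 + (a$2)\<^sup>2) * u = 0" using e by simp
    then have "u = 0" using n mult_eq_0_iff by blast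
    moreover have "((a$1)\<^sup>2 + (a$2)\<^sup>2) * w = a$2 * (a$1 * u + a$2 * w) - a$1 * (a$2 * u - a$1 * w)"
      by (simp add: power2_eq_square algebra_simps)
    then have "((a$1)\<^sup>2 + (a$2)\<^sup>2) * w = 0" using e by simp
    then have "w = 0" using n mult_eq_0_iff by blast
    ultimately have "z = r *\<^sub>R z'" using r by (intro vec3_eqI) (simp_all add: u_def w_def)
    moreover have "z \<in> surface G" "z' \<in> surface G" using z \<Gamma>(2) by auto
    ultimately have "r = 1" using surface_scale_eq[of z' G r] by simp
    then show ?thesis using \<open>z = r *\<^sub>R z'\<close> by simp
  qed
  define f where "f = \<psi> \<circ> g"
  have im: "g t \<in> \<Gamma>" if "t \<in> {0..1}" for t using g(3) that by (auto simp: path_image_def)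
  have cg: "continuous_on {0..1} g" using g(1) by (simp add: simple_path_def path_def)
  have "continuous_on {0..1} (\<lambda>t. (a$2 * g t$1 - a$1 * g t$2) / g t$3)"
    using pos im by (intro continuous_intros cg) force
  then have cf: "continuous_on {0..1} f" by (simp add: f_def \<psi>_def o_def)
  have inj01: "s = t \<or> s = 0 \<and> t = 1 \<or> s = 1 \<and> t = 0" if "s \<in> {0..1}" "t \<in> {0..1}" "f s = f t" for s t
    using g(1) inj[of "g s" "g t"] im that unfolding simple_path_def loop_free_def f_def by auto
  have f1: "f 1 = f 0" using g(2) by (simp add: f_def pathfinish_def pathstart_def)
  have ne: "f (1/2) \<noteq> f 0" using inj01[of "1/2" 0] by auto
  \<comment> \<open>A value strictly between those at the ends of the half intervals; each half of
    the loop attains it.\<close>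
  define y where "y = (f 0 + f (1/2)) / 2"
  have cf1: "continuous_on {0..1/2} f" and cf2: "continuous_on {1/2..1} f"
    by (auto intro: continuous_on_subset[OF cf])
  obtain s where s: "0 \<le> s" "s \<le> 1/2" "f s = y"
    using IVT'[of f 0 y "1/2"] IVT2'[of f "1/2" y 0] cf1 by (cases "f 0 \<le> f (1/2)") (auto simp: y_def)
  obtain t where t: "1/2 \<le> t" "t \<le> 1" "f t = y"
    using IVT'[of f "1/2" y 1] IVT2'[of f 1 y "1/2"] cf2 f1 by (cases "f 0 \<le> f (1/2)") (auto simp: y_def)
  have yn: "y \<noteq> f (1/2)" "y \<noteq> f 0" using ne by (auto simp: y_def)
  have "s \<noteq> 1/2" using s(3) yn by metis
  then have "s \<noteq> t \<and> s \<noteq> 0" using s t yn by auto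
  moreover have "t \<noteq> 1" using t yn f1 by auto
  ultimately show False using inj01[of s t] s t by auto
qed

text \<open>Interior points of \<open>C\<close> are not part of the definition of a caustic. Without
  any, the convex cone lies in a plane and \<open>C\<close> is its own boundary, so the closed curve
  would lie on a geodesic.\<close>

lemma caustic_region_interior:
  assumes \<Gamma>: "simple_closed_curve (boundary G C)" and C: "compact C" "geo_convex G C"
  shows "interior (ocone C) \<noteq> {}"
proof
  assume empty: "interior (ocone C) = {}"
  have sub: "C \<subseteq> surface G" using C by (auto simp: geo_convex_def)
  have bC: "boundary G C = C" using boundary_iff[OF C(1) sub] empty by blast
  obtain a b where a: "a \<noteq> 0" "ocone C \<subseteq> {x. a \<bullet> x = b}"
    using empty_interior_subset_hyperplane[OF convex_ocone[OF C(2)] empty] .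
  have "a \<bullet> z = 0" if "z \<in> C" for z
  proof -
    have "a \<bullet> (1 *\<^sub>R z) = b" "a \<bullet> (2 *\<^sub>R z) = b"
      using subsetD[OF a(2) oconeI[of 1 z C]] subsetD[OF a(2) oconeI[of 2 z C]] that by simp_all
    then show ?thesis by simp
  qed
  then show False using closed_curve_not_in_line[OF \<Gamma>, of G a] a(1) sub bC by auto
qed

section \<open>The boundary curve\<close>

lemma form_pos_self:
  assumes "x \<in> surface G" "y \<in> surface G"
  shows "G = Hyperbolic \<Longrightarrow> curv G * form G x y \<ge> 1" "G = Spherical \<Longrightarrow> \<bar>form G x y\<bar> \<le> 1"
proof -
  show "curv G * form G x y \<ge> 1" if "G = Hyperbolic"
    using surface_form_hyperbolic[of x y] assms that by simp
  show "\<bar>form G x y\<bar> \<le> 1" if "G = Spherical"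
    using sn_square(1)[OF assms] that zero_le_power2[of "sn G x y"] by (simp add: abs_square_le_1)
qed

lemma continuous_on_gdist [continuous_intros]:
  assumes "continuous_on A f" "continuous_on A g" "f ` A \<subseteq> surface G" "g ` A \<subseteq> surface G"
  shows "continuous_on A (\<lambda>x. gdist G (f x) (g x))"
proof (cases G)
  case Hyperbolic
  have 1: "- form G (f x) (g x) \<ge> 1" if "x \<in> A" for x
    using form_pos_self(1)[OF _ _ Hyperbolic, of "f x" "g x"] assms(3,4) Hyperbolic that
    by (simp add: image_subset_iff)
  have "continuous_on A (\<lambda>x. arcosh (- form G (f x) (g x)))"
    by (intro continuous_on_compose2[OF continuous_on_arcosh[OF order_refl]]
        continuous_on_minus continuous_on_form assms) (use 1 in auto)
  then show ?thesis using Hyperbolic by simp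
next
  case Spherical
  have "\<bar>form G (f x) (g x)\<bar> \<le> 1" if "x \<in> A" for x
    using form_pos_self(2)[OF _ _ Spherical, of "f x" "g x"] assms(3,4) that by (simp add: image_subset_iff)
  then have 1: "\<forall>x\<in>A. -1 \<le> form G (f x) (g x) \<and> form G (f x) (g x) \<le> 1"
    by (simp add: abs_le_iff minus_le_iff)
  have "continuous_on A (\<lambda>x. arccos (form G (f x) (g x)))"
    by (intro continuous_on_arccos continuous_on_form assms 1)
  then show ?thesis using Spherical by simp
qed

lemma continuous_on_sn [continuous_intros]:
  assumes "continuous_on A f" "continuous_on A g"
  shows "continuous_on A (\<lambda>x. sn G (f x) (g x))"
  unfolding sn_def by (intro continuous_intros assms)

text \<open>With \<open>F x = 0\<close> and a negative derivative at this one point,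
  \<open>F\<close> is negative just to the right of \<open>x\<close>, and \<open>f\<close> would
  decrease there.\<close>

lemma second_derivative_min:
  fixes f F :: "real \<Rightarrow> real"
  assumes d: "d > 0" and f: "\<And>y. \<bar>y - x\<bar> < d \<Longrightarrow> (f has_real_derivative F y) (at y)"
    and min: "\<And>y. \<bar>y - x\<bar> < d \<Longrightarrow> f x \<le> f y" and l: "(F has_real_derivative l) (at x)"
  shows "F x = 0" "l \<ge> 0"
proof -
  show 0: "F x = 0"
    using DERIV_local_min[OF f[of x] d] d min by (simp add: abs_minus_commute)
  show "l \<ge> 0"
  proof (rule ccontr)
    assume "\<not> l \<ge> 0"
    then obtain e where e: "e > 0" "\<And>h. 0 < h \<Longrightarrow> h < e \<Longrightarrow> F (x + h) < F x"
      using DERIV_neg_dec_right[OF l] by auto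
    define h where "h = min d e / 2"
    have h: "h > 0" "h < d" "h < e" using d e(1) by (auto simp: h_def)
    have "f (x + h) < f x"
    proof (rule DERIV_neg_imp_decreasing_open[where f = f])
      show "\<exists>z. (f has_real_derivative z) (at y) \<and> z < 0" if "x < y" "y < x + h" for y
        using f[of y] e(2)[of "y - x"] that h 0 by (intro exI[of _ "F y"]) auto
      show "continuous_on {x..x + h} f"
        using h by (intro continuous_at_imp_continuous_on ballI DERIV_isCont[OF f]) auto
    qed (use h in auto)
    then show False using min[of "x + h"] h by auto
  qed
qed

text \<open>First variation of distance: for unit speed, \<open>form G v y / sn G (c r) y\<close> is
  the cosine of the angle between the velocity and the geodesic to \<open>y\<close>.\<close>

lemma gdist_has_derivative:
  assumes c: "(c has_vector_derivative v) (at r)" and c_surf: "\<And>s. c s \<in> surface G"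
    and y: "y \<in> surface G" and ne: "c r \<noteq> y"
  shows "((\<lambda>s. gdist G (c s) y) has_real_derivative - (form G v y / sn G (c r) y)) (at r)"
proof -
  have B: "((\<lambda>s. form G (c s) y) has_real_derivative form G v y) (at r)"
    using bounded_bilinear.has_vector_derivative[OF bounded_bilinear_form c has_vector_derivative_const[of y]]
    by (simp add: form_linear has_real_derivative_iff_has_vector_derivative)
  have s: "(sn G (c r) y)\<^sup>2 = curv G * (1 - (form G (c r) y)\<^sup>2)" "sn G (c r) y > 0"
    using sn_square(1) sn_pos c_surf y ne by auto
  show ?thesis
  proof (cases G)
    case Hyperbolic
    have "- form G (c r) y \<ge> 1" using form_pos_self(1)[OF c_surf y Hyperbolic, of r] Hyperbolic by simp
    moreover have "- form G (c r) y \<noteq> 1"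
    proof
      assume "- form G (c r) y = 1"
      then have "(form G (c r) y)\<^sup>2 = 1" by (metis power2_minus one_power2)
      then show False using s by simp
    qed
    ultimately have "- form G (c r) y > 1" by simp
    then have "((\<lambda>s. arcosh (- form G (c s) y)) has_real_derivative
        1 / sqrt ((- form G (c r) y)\<^sup>2 - 1) * - form G v y) (at r)"
      by (intro DERIV_chain2[OF arcosh_real_has_field_derivative] DERIV_minus B)
    then show ?thesis using Hyperbolic by (simp add: sn_def)
  next
    case Spherical
    have "\<bar>form G (c r) y\<bar> \<le> 1" using form_pos_self(2)[OF c_surf y Spherical] by simp
    moreover have "\<bar>form G (c r) y\<bar> \<noteq> 1"
    proof
      assume "\<bar>form G (c r) y\<bar> = 1"
      then have "(form G (c r) y)\<^sup>2 = 1" by (metis power2_abs one_power2)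
      then show False using s by simp
    qed
    ultimately have "-1 < form G (c r) y" "form G (c r) y < 1" by linarith+
    then have "((\<lambda>s. arccos (form G (c s) y)) has_real_derivative
        inverse (- sqrt (1 - (form G (c r) y)\<^sup>2)) * form G v y) (at r)"
      by (intro DERIV_chain2[OF DERIV_arccos] B)
    then show ?thesis using Spherical by (simp add: sn_def divide_inverse mult.commute)
  qed
qed

text \<open>On the upper half circle a larger abscissa means a smaller angle, and
  \<open>g * h' - h * g'\<close> is the sine of the difference of the two angles.\<close>

lemma half_circle_order:
  fixes g h g' h' :: real
  assumes "g\<^sup>2 + h\<^sup>2 = 1" "g'\<^sup>2 + h'\<^sup>2 = 1" "0 \<le> h" "0 \<le> h'" "g' \<le> g"
  shows "h * g' \<le> g * h'"
proof (cases "0 \<le> g'")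
  case True
  have "h\<^sup>2 \<le> h'\<^sup>2" using assms power_mono[of g' g 2] True by linarith
  then have "h \<le> h'" using assms(4) by (rule power2_le_imp_le)
  then have "h * g' \<le> h' * g" using assms True by (intro mult_mono) auto
  then show ?thesis by (simp add: mult.commute)
next
  case False
  show ?thesis
  proof (cases "0 \<le> g")
    case True
    have "h * g' \<le> 0" using assms False by (intro mult_nonneg_nonpos) auto
    moreover have "0 \<le> g * h'" using True assms by simp
    ultimately show ?thesis by linarith
  next
    case F: False
    have "(- g)\<^sup>2 \<le> (- g')\<^sup>2" using F False assms by (intro power_mono) auto
    then have "h'\<^sup>2 \<le> h\<^sup>2" using assms(1,2) by simp
    then have "h' \<le> h" using assms(3) by (rule power2_le_imp_le)
    then have "h' * (- g) \<le> h * (- g')" using F False assms by (intro mult_mono) auto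
    then show ?thesis by (simp add: mult.commute)
  qed
qed

section \<open>Support, curvature and angles along the parametrised boundary\<close>

locale table =
  fixes G :: geometry and K :: "(real^3) set" and L :: real and c :: "real \<Rightarrow> real^3"
  assumes table: "convex_table G K" and param: "boundary_param G K L c"
begin

lemma K: "compact K" "geo_convex G K" "K \<subseteq> surface G"
  using table by (auto simp: convex_table_def geo_convex_def)

lemma K_interior: "interior (ocone K) \<noteq> {}"
proof -
  obtain z where "z \<in> (top_of_set (surface G)) interior_of K"
    using table by (auto simp: convex_table_def)
  moreover then have "z \<in> surface G" using K interior_of_subset by fastforce
  ultimately show ?thesis using interior_ocone_iff[OF K(3), of z] by auto
qed

lemma L: "L > 0" and c_period: "c (t + L) = c t"
  using param by (auto simp: boundary_param_def)

sublocale per: periodic_fun_simple c L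
  by unfold_locales (rule c_period)

lemma boundary_eq: "boundary G K = range c"
proof
  have "boundary G K = c ` {0..<L}" using param by (simp add: boundary_param_def)
  then show "boundary G K \<subseteq> range c" by auto
  have "c t \<in> c ` {0..<L}" for t
  proof -
    have "t + of_int (- \<lfloor>t / L\<rfloor>) * L \<in> {0..<L}"
      using L floor_divide_lower[of L t] floor_divide_upper[of L t] by (auto simp: algebra_simps)
    then show ?thesis using per.plus_of_int[of t "- \<lfloor>t / L\<rfloor>"] by (metis imageI)
  qed
  then show "range c \<subseteq> boundary G K" using \<open>boundary G K = c ` {0..<L}\<close> by auto
qed

lemma c_ne: assumes "s < t" "t < s + L" shows "c s \<noteq> c t"
proof
  assume eq: "c s = c t"
  define n where "n = - \<lfloor>s / L\<rfloor>"
  define s' t' where "s' = s + of_int n * L" and "t' = t + of_int n * L"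
  have s': "s' \<in> {0..<L}"
    using L floor_divide_lower[of L s] floor_divide_upper[of L s] by (auto simp: s'_def n_def algebra_simps)
  have inj: "inj_on c {0..<L}" using param by (simp add: boundary_param_def)
  have e: "c s' = c t'" using eq by (simp add: s'_def t'_def per.plus_of_int)
  have t': "s' < t'" "t' < s' + L" using assms by (auto simp: s'_def t'_def)
  show False
  proof (cases "t' < L")
    case True
    then show False using inj_onD[OF inj e] s' t' by auto
  next
    case False
    have "c (t' - L) = c t'" using c_period[of "t' - L"] by simp
    then show False using inj_onD[OF inj, of s' "t' - L"] e s' t' False by auto
  qed
qed

lemma boundary_point:
  assumes "q \<in> boundary G K" obtains t where "s \<le> t" "t < s + L" "c t = q"
proof -
  obtain r where r: "c r = q" using assms boundary_eq by auto
  define t where "t = r + of_int (- \<lfloor>(r - s) / L\<rfloor>) * L"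
  have "c t = q" unfolding t_def per.plus_of_int by (rule r)
  moreover have "s \<le> t" "t < s + L"
    using L floor_divide_lower[of L "r - s"] floor_divide_upper[of L "r - s"]
    by (auto simp: t_def algebra_simps)
  ultimately show ?thesis using that by blast
qed

lemma c_boundary: "c t \<in> boundary G K" and c_K: "c t \<in> K" and c_surf: "c t \<in> surface G"
  and c_not_interior: "c t \<notin> interior (ocone K)"
proof -
  show "c t \<in> boundary G K" using boundary_eq by auto
  then show "c t \<in> K" "c t \<notin> interior (ocone K)" using boundary_iff[OF K(1,3)] by auto
  then show "c t \<in> surface G" using K by auto
qed

lemma c_deriv: "(c has_vector_derivative velocity c t) (at t)"
  and v_deriv: "(velocity c has_vector_derivative acceleration c t) (at t)"
  and v_cont: "continuous_on A (velocity c)"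
  using param by (auto simp: boundary_param_def C1_differentiable_on_eq vector_derivative_works intro: continuous_on_subset)

lemma c_cont: "continuous_on A c"
  using c_deriv by (meson continuous_at_imp_continuous_on has_vector_derivative_continuous)

lemma form_c_deriv: "((\<lambda>s. form G (c s) y) has_real_derivative form G (velocity c t) y) (at t)"
  using bounded_bilinear.has_vector_derivative[OF bounded_bilinear_form c_deriv has_vector_derivative_const[of y]]
  by (simp add: form_linear has_real_derivative_iff_has_vector_derivative)

lemma form_v_deriv: "((\<lambda>s. form G (velocity c s) y) has_real_derivative form G (acceleration c t) y) (at t)"
  using bounded_bilinear.has_vector_derivative[OF bounded_bilinear_form v_deriv has_vector_derivative_const[of y]]
  by (simp add: form_linear has_real_derivative_iff_has_vector_derivative)

lemma form_v_v: "form G (velocity c t) (velocity c t) = 1"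
  using param by (simp add: boundary_param_def)

lemma form_c_v: "form G (c t) (velocity c t) = 0" "form G (velocity c t) (c t) = 0"
proof -
  have "((\<lambda>s. form G (c s) (c s)) has_real_derivative
      form G (c t) (velocity c t) + form G (velocity c t) (c t)) (at t)"
    using bounded_bilinear.has_vector_derivative[OF bounded_bilinear_form c_deriv c_deriv]
    by (simp add: has_real_derivative_iff_has_vector_derivative)
  then have "((\<lambda>s. curv G) has_real_derivative
      form G (c t) (velocity c t) + form G (velocity c t) (c t)) (at t)"
    using surfaceD(1)[OF c_surf] by simp
  then have "form G (c t) (velocity c t) + form G (velocity c t) (c t) = 0"
    using DERIV_const DERIV_unique by blast
  then show "form G (c t) (velocity c t) = 0" "form G (velocity c t) (c t) = 0"
    using form_commute[of G "c t" "velocity c t"] by auto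
qed

lemma unit: "unit_tangent G (c t) (velocity c t)"
  by (simp add: unit_tangent_def c_surf form_c_v form_v_v)

sublocale fr: frame G "c t" "velocity c t" for t
  by unfold_locales (rule unit)

lemma N_eq: "fr.N t = left_normal G (c t) (velocity c t)"
  by (simp add: fr.N_def)

lemma v_period: "velocity c (t + L) = velocity c t"
proof -
  have "((\<lambda>s. c (s + L)) has_vector_derivative velocity c (t + L)) (at t)"
    using vector_diff_chain_at[of "\<lambda>s. s + L" 1 t c "velocity c (t + L)"] c_deriv[of "t + L"]
    by (simp add: o_def has_vector_derivative_add_const)
  then have "(c has_vector_derivative velocity c (t + L)) (at t)" by (simp add: c_period)
  then show ?thesis using c_deriv vector_derivative_unique_at by blast
qed

text \<open>A functional supporting \<open>K\<close> at \<open>c t\<close> is minimal along the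
  boundary there, hence vanishes on the velocity as well as on \<open>c t\<close> and is a multiple
  of the product with the normal. The last clause of \<open>boundary_param\<close> makes the factor
  positive.\<close>

lemma left: "z \<in> K \<Longrightarrow> 0 \<le> det3 (c t) (velocity c t) z"
  and left_interior: "z \<in> interior (ocone K) \<Longrightarrow> 0 < det3 (c t) (velocity c t) z"
proof -
  obtain w where w: "w \<noteq> 0" "w \<bullet> c t = 0" "\<And>z. z \<in> K \<Longrightarrow> 0 \<le> w \<bullet> z"
    using supporting_functional[OF K(2) c_K c_not_interior K_interior] by blast
  have "((\<lambda>s. w \<bullet> c s) has_real_derivative w \<bullet> velocity c t) (at t)"
    using bounded_bilinear.has_vector_derivative[OF bounded_bilinear_inner has_vector_derivative_const[of w] c_deriv]
    by (simp add: has_real_derivative_iff_has_vector_derivative)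
  then have wv: "w \<bullet> velocity c t = 0"
    by (rule DERIV_local_min[OF _ zero_less_one]) (use w c_K in auto)
  have wz: "w \<bullet> z = (w \<bullet> fr.N t) * det3 (c t) (velocity c t) z" for z
    by (subst fr.expand[of z t]) (simp add: inner_add_right w wv fr.form_N)
  obtain d where d: "d > 0" "\<And>s. s \<in> {0<..<d} \<Longrightarrow> geo G (c t) (fr.N t) s \<in> K"
    using param unfolding boundary_param_def N_eq by blast
  \<comment> \<open>Small enough for the inward geodesic to be in \<open>K\<close>, and below
    \<open>pi\<close> so that \<open>sg G s\<close> is positive.\<close>
  define s where "s = min d pi / 2"
  have s: "s \<in> {0<..<d}" "s < pi" using d(1) by (auto simp: s_def min_def)
  then have sg: "sg G s > 0" by (intro sg_pos) auto
  have "0 \<le> w \<bullet> geo G (c t) (fr.N t) s" using w(3) d(2)[OF s(1)] by blast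
  then have "0 \<le> sg G s * (w \<bullet> fr.N t)" by (simp add: geo_cg inner_add_right w)
  then have "0 \<le> w \<bullet> fr.N t" using sg by (simp add: zero_le_mult_iff)
  moreover have "w \<bullet> fr.N t \<noteq> 0" using wz[of w] w(1) by auto
  ultimately have pos: "0 < w \<bullet> fr.N t" by simp
  show "0 \<le> det3 (c t) (velocity c t) z" if "z \<in> K"
    using w(3)[OF that] wz[of z] pos by (simp add: zero_le_mult_iff)
  show "0 < det3 (c t) (velocity c t) z" if "z \<in> interior (ocone K)"
    using interior_ocone_pos[OF w(1,3) that] wz[of z] pos by (simp add: zero_less_mult_iff)
qed

text \<open>The signed height above the tangent at \<open>c t\<close> is minimal at
  \<open>t\<close>, and the curvature is its second derivative there.\<close>

lemma curvature_nonneg: "0 \<le> geodesic_curvature G c t"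
proof -
  have "geodesic_curvature G c t = form G (acceleration c t) (fr.N t)"
    by (simp add: geodesic_curvature_def N_eq)
  moreover have "0 \<le> form G (acceleration c t) (fr.N t)"
  proof (rule second_derivative_min(2)[OF zero_less_one, where f = "\<lambda>s. form G (c s) (fr.N t)" and x = t])
    show "form G (c t) (fr.N t) \<le> form G (c s) (fr.N t)" for s
      using left[OF c_K, of t s] by (simp add: fr.form_N)
  qed (rule form_c_deriv form_v_deriv)+
  ultimately show ?thesis by simp
qed

text \<open>Frenet equation in the ambient space, paired with \<open>z\<close>. The components along
  the velocity and along the point come from differentiating \<open>form_v_v\<close> and
  \<open>form_c_v\<close>.\<close>

lemma acceleration_expand:
  "form G (acceleration c t) z = geodesic_curvature G c t * det3 (c t) (velocity c t) z - curv G * form G (c t) z"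
proof -
  have 0: "form G (velocity c t) (acceleration c t) = 0"
  proof -
    have "((\<lambda>s. form G (velocity c s) (velocity c s)) has_real_derivative
        form G (velocity c t) (acceleration c t) + form G (acceleration c t) (velocity c t)) (at t)"
      using bounded_bilinear.has_vector_derivative[OF bounded_bilinear_form v_deriv v_deriv]
      by (simp add: has_real_derivative_iff_has_vector_derivative)
    then have "((\<lambda>s. 1) has_real_derivative
        form G (velocity c t) (acceleration c t) + form G (acceleration c t) (velocity c t)) (at t)"
      by (simp add: form_v_v)
    then have "form G (velocity c t) (acceleration c t) + form G (acceleration c t) (velocity c t) = 0"
      using DERIV_const DERIV_unique by blast
    then show ?thesis using form_commute[of G "velocity c t" "acceleration c t"] by simp
  qed
  have 1: "form G (c t) (acceleration c t) = - 1"
  proof -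
    have "((\<lambda>s. form G (c s) (velocity c s)) has_real_derivative
        form G (c t) (acceleration c t) + form G (velocity c t) (velocity c t)) (at t)"
      using bounded_bilinear.has_vector_derivative[OF bounded_bilinear_form c_deriv v_deriv]
      by (simp add: has_real_derivative_iff_has_vector_derivative)
    then have "((\<lambda>s. 0) has_real_derivative
        form G (c t) (acceleration c t) + form G (velocity c t) (velocity c t)) (at t)"
      by (simp add: form_c_v)
    then have "form G (c t) (acceleration c t) + form G (velocity c t) (velocity c t) = 0"
      using DERIV_const DERIV_unique by blast
    then show ?thesis by (simp add: form_v_v)
  qed
  show ?thesis
    using fr.form_expand[of "acceleration c t" z t]
    by (simp add: 0 1 geodesic_curvature_def N_eq[symmetric] fr.form_N form_commute[of G "acceleration c t" "fr.N t"])
qed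

text \<open>Cosine and sine of the angle at \<open>c s\<close> from the direction of travel to the
  geodesic towards \<open>z\<close>. At \<open>z = c s\<close> the denominator is zero and both take
  the default value 0.\<close>

definition cosang :: "real \<Rightarrow> real^3 \<Rightarrow> real" where
  "cosang s z = form G (velocity c s) z / sn G (c s) z"
definition sinang :: "real \<Rightarrow> real^3 \<Rightarrow> real" where
  "sinang s z = det3 (c s) (velocity c s) z / sn G (c s) z"

lemma sn_c:
  assumes "z \<in> K" "z \<noteq> c s"
  shows "sn G (c s) z > 0" "(sn G (c s) z)\<^sup>2 = (form G (velocity c s) z)\<^sup>2 + (det3 (c s) (velocity c s) z)\<^sup>2"
proof -
  have z: "z \<in> surface G" using assms K by auto
  show "sn G (c s) z > 0" using sn_pos[OF c_surf z] assms by auto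
  show "(sn G (c s) z)\<^sup>2 = (form G (velocity c s) z)\<^sup>2 + (det3 (c s) (velocity c s) z)\<^sup>2"
    using fr.frame_square[OF z, of s] sn_square(1)[OF c_surf z, of s] by (simp add: fr.form_N)
qed

lemma ang:
  assumes "z \<in> K" "z \<noteq> c s"
  shows "form G (velocity c s) z = sn G (c s) z * cosang s z"
    "det3 (c s) (velocity c s) z = sn G (c s) z * sinang s z"
    "(cosang s z)\<^sup>2 + (sinang s z)\<^sup>2 = 1" "0 \<le> sinang s z" "\<bar>cosang s z\<bar> \<le> 1"
proof -
  note s = sn_c[OF assms]
  show "form G (velocity c s) z = sn G (c s) z * cosang s z"
    "det3 (c s) (velocity c s) z = sn G (c s) z * sinang s z"
    using s by (simp_all add: cosang_def sinang_def)
  show 1: "(cosang s z)\<^sup>2 + (sinang s z)\<^sup>2 = 1"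
    using s(1) unfolding cosang_def sinang_def power_divide add_divide_distrib[symmetric] s(2)[symmetric] by simp
  show "0 \<le> sinang s z" using s left[OF assms(1)] by (simp add: sinang_def)
  have "(cosang s z)\<^sup>2 \<le> 1" using 1 zero_le_power2[of "sinang s z"] by linarith
  then show "\<bar>cosang s z\<bar> \<le> 1" by (simp add: abs_square_le_1)
qed

lemma sinang_zero:
  assumes "z \<in> K" "z \<noteq> c s" "\<not> 0 < sinang s z" shows "sinang s z = 0" "cosang s z = 1 \<or> cosang s z = -1"
proof -
  show 0: "sinang s z = 0" using ang(4)[OF assms(1,2)] assms(3) by simp
  have "(cosang s z)\<^sup>2 = 1" using ang(3)[OF assms(1,2)] 0 by simp
  then show "cosang s z = 1 \<or> cosang s z = -1" by (simp add: power2_eq_1_iff)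
qed

lemma det3_ang:
  assumes "y \<in> K" "y \<noteq> c s" "z \<in> K" "z \<noteq> c s"
  shows "det3 (c s) y z = sn G (c s) y * sn G (c s) z * (cosang s y * sinang s z - sinang s y * cosang s z)"
  unfolding fr.det3_expand_frame[of s y z] fr.form_N ang(1,2)[OF assms(1,2)] ang(1,2)[OF assms(3,4)]
  by (simp add: algebra_simps)

text \<open>The determinant is a positive multiple of the sine of the angle from \<open>y\<close> to
  \<open>z\<close>, so a smaller cosine puts \<open>z\<close> to the left of the direction of
  \<open>y\<close>.\<close>

lemma det3_nonneg_if_cosang_le:
  assumes y: "y \<in> K" "y \<noteq> c s" and z: "z \<in> K" "z \<noteq> c s" and le: "cosang s z \<le> cosang s y"
  shows "0 \<le> det3 (c s) y z"
proof -
  have "sinang s y * cosang s z \<le> cosang s y * sinang s z"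
    using half_circle_order ang[OF y] ang[OF z] le by blast
  then show ?thesis unfolding det3_ang[OF y z] using sn_c(1)[OF y] sn_c(1)[OF z] by simp
qed

text \<open>If both sines vanish, \<open>y\<close> and \<open>z\<close> may lie in opposite
  directions along the tangent, and the determinant is zero in either order; \<open>nondeg\<close>
  excludes this.\<close>

lemma cosang_le_if_det3_nonneg:
  assumes y: "y \<in> K" "y \<noteq> c s" and z: "z \<in> K" "z \<noteq> c s" and det: "0 \<le> det3 (c s) y z"
    and nondeg: "sinang s y > 0 \<or> sinang s z > 0"
  shows "cosang s z \<le> cosang s y"
proof (rule ccontr)
  assume n: "\<not> cosang s z \<le> cosang s y"
  note a = ang[OF y] and b = ang[OF z]
  have "sinang s z * cosang s y \<le> cosang s z * sinang s y"
    using half_circle_order a b n by (meson linear)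
  moreover have "0 \<le> cosang s y * sinang s z - sinang s y * cosang s z"
    using det mult_pos_pos[OF sn_c(1)[OF y] sn_c(1)[OF z]] unfolding det3_ang[OF y z]
    by (simp add: zero_le_mult_iff del: mult_pos_pos)
  ultimately have e: "cosang s y * sinang s z = sinang s y * cosang s z" by (simp add: algebra_simps)
  have "(cosang s y)\<^sup>2 * (sinang s z)\<^sup>2 = (sinang s y)\<^sup>2 * (cosang s z)\<^sup>2"
    using arg_cong[OF e, of "\<lambda>x. x\<^sup>2"] by (simp add: power_mult_distrib)
  moreover have "(sinang s y)\<^sup>2 = 1 - (cosang s y)\<^sup>2" "(sinang s z)\<^sup>2 = 1 - (cosang s z)\<^sup>2"
    using a b by linarith+
  ultimately have "(cosang s y)\<^sup>2 = (cosang s z)\<^sup>2" by (simp add: algebra_simps)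
  moreover then have "(sinang s y)\<^sup>2 = (sinang s z)\<^sup>2" using a b by linarith
  then have "sinang s y = sinang s z" using a b by (simp add: power2_eq_iff_nonneg)
  ultimately show False using e n nondeg by auto
qed

lemma cosang_less_if_det3_neg:
  assumes "y \<in> K" "y \<noteq> c s" "z \<in> K" "z \<noteq> c s" "det3 (c s) y z < 0"
  shows "cosang s y < cosang s z"
  using det3_nonneg_if_cosang_le[OF assms(1-4)] assms(5) by fastforce

lemma c_ne': assumes "s < t" "t < s + L" shows "c t \<noteq> c s"
  using c_ne[OF assms] by auto

text \<open>Seen from \<open>c s\<close>, a point running along the boundary turns to the left,
  because \<open>c s\<close> lies left of the tangent at the running point.\<close>

lemma cosang_antitone:
  assumes "s < t" "t \<le> u" "u < s + L"
  shows "cosang s (c u) \<le> cosang s (c t)"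
proof (rule DERIV_nonpos_imp_nonincreasing[where f = "\<lambda>r. cosang s (c r)", OF assms(2)])
  fix r assume r: "t \<le> r" "r \<le> u"
  define X where "X r = form G (velocity c s) (c r)" for r
  define Y where "Y r = form G (fr.N s) (c r)" for r
  have dX: "(X has_real_derivative form G (velocity c s) (velocity c r)) (at r)"
    using form_c_deriv[of "velocity c s" r] unfolding X_def[abs_def]
    by (simp add: form_commute[of G "velocity c s"])
  have dY: "(Y has_real_derivative form G (fr.N s) (velocity c r)) (at r)"
    using form_c_deriv[of "fr.N s" r] unfolding Y_def[abs_def]
    by (simp add: form_commute[of G "fr.N s"])
  have ne: "c r \<noteq> c s" using c_ne'[of s r] r assms by auto
  have sn: "sn G (c s) (c r) = sqrt ((X r)\<^sup>2 + (Y r)\<^sup>2)" for r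
    using fr.sn_eq[OF c_surf, of s r] by (simp add: X_def Y_def)
  have R: "(X r)\<^sup>2 + (Y r)\<^sup>2 > 0"
    using sn_c(1)[OF c_K ne] unfolding sn by simp
  have "((\<lambda>r. X r / sqrt ((X r)\<^sup>2 + (Y r)\<^sup>2)) has_real_derivative
     (form G (velocity c s) (velocity c r) * sqrt ((X r)\<^sup>2 + (Y r)\<^sup>2) -
      X r * ((2 * X r * form G (velocity c s) (velocity c r) + 2 * Y r * form G (fr.N s) (velocity c r))
        / (2 * sqrt ((X r)\<^sup>2 + (Y r)\<^sup>2)))) / (sqrt ((X r)\<^sup>2 + (Y r)\<^sup>2) * sqrt ((X r)\<^sup>2 + (Y r)\<^sup>2))) (at r)"
    (is "(_ has_real_derivative ?d) _")
    using R by (auto intro!: derivative_eq_intros dX dY simp: field_simps)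
  moreover have "?d \<le> 0"
  proof -
    define S x y where "S = sqrt ((X r)\<^sup>2 + (Y r)\<^sup>2)" and "x = form G (velocity c s) (velocity c r)"
      and "y = form G (fr.N s) (velocity c r)"
    have S: "S > 0" "S\<^sup>2 = (X r)\<^sup>2 + (Y r)\<^sup>2" using R by (auto simp: S_def)
    have "0 \<le> det3 (c s) (c r) (velocity c r)"
      using left[OF c_K, of r s] by (simp add: det3_rotate[of "c r" "velocity c r"] det3_rotate[of "velocity c r" "c s"])
    then have "0 \<le> X r * y - Y r * x"
      unfolding fr.det3_expand_frame[of s] by (simp add: X_def Y_def x_def y_def)
    moreover have "0 \<le> Y r" using left[OF c_K, of s r] by (simp add: Y_def fr.form_N)
    ultimately have p: "0 \<le> Y r * (X r * y - Y r * x)" by simp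
    have "?d = (x * S - X r * ((2 * X r * x + 2 * Y r * y) / (2 * S))) / (S * S)"
      by (simp add: S_def x_def y_def)
    also have "\<dots> = (x * S\<^sup>2 - X r * (X r * x + Y r * y)) / (S * S * S)"
      using S(1) by (simp add: field_simps power2_eq_square)
    also have "\<dots> = - (Y r * (X r * y - Y r * x)) / (S * S * S)"
      unfolding S(2) by (simp add: power2_eq_square algebra_simps)
    also have "\<dots> \<le> 0" using p S(1) by (simp add: divide_le_0_iff)
    finally show ?thesis .
  qed
  ultimately show "\<exists>y. ((\<lambda>r. cosang s (c r)) has_real_derivative y) (at r) \<and> y \<le> 0"
    unfolding cosang_def sn X_def[symmetric] by blast
qed

text \<open>Short chords approach the length of their arc and the direction of the tangent;
  \<open>sgn\<close> records whether the chord points forwards or backwards. In the last limit the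
  base point moves, which uses continuity of the velocity; it serves the continuity of
  \<open>tcos\<close> at touching points.\<close>

lemma chord_limits:
  shows sn_limit: "((\<lambda>t. sn G (c s) (c t) / \<bar>t - s\<bar>) \<longlongrightarrow> 1) (at s)"
    and cosang_limit: "((\<lambda>t. cosang s (c t) * sgn (t - s)) \<longlongrightarrow> 1) (at s)"
    and cosang_limit': "((\<lambda>t. cosang t (c s) * sgn (s - t)) \<longlongrightarrow> 1) (at s)"
proof -
  have X: "((\<lambda>t. form G (velocity c s) (c t) / (t - s)) \<longlongrightarrow> 1) (at s)"
    using form_c_deriv[of "velocity c s" s]
    by (simp add: has_field_derivative_iff form_c_v form_v_v form_commute[of G "velocity c s"])
  have Y: "((\<lambda>t. form G (fr.N s) (c t) / (t - s)) \<longlongrightarrow> 0) (at s)"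
    using form_c_deriv[of "fr.N s" s]
    by (simp add: has_field_derivative_iff fr.N form_commute[of G "fr.N s"])
  have "((\<lambda>t. sqrt ((form G (velocity c s) (c t) / (t - s))\<^sup>2 + (form G (fr.N s) (c t) / (t - s))\<^sup>2))
      \<longlongrightarrow> sqrt (1\<^sup>2 + 0\<^sup>2)) (at s)"
    by (intro tendsto_intros X Y)
  moreover have "sqrt ((form G (velocity c s) (c t) / (t - s))\<^sup>2 + (form G (fr.N s) (c t) / (t - s))\<^sup>2)
      = sn G (c s) (c t) / \<bar>t - s\<bar>" for t
    unfolding fr.sn_eq[OF c_surf, of s t]
    by (simp add: power_divide add_divide_distrib[symmetric] real_sqrt_divide)
  ultimately show sn: "((\<lambda>t. sn G (c s) (c t) / \<bar>t - s\<bar>) \<longlongrightarrow> 1) (at s)" by simp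
  have "((\<lambda>t. (form G (velocity c s) (c t) / (t - s)) / (sn G (c s) (c t) / \<bar>t - s\<bar>)) \<longlongrightarrow> 1 / 1) (at s)"
    by (intro tendsto_divide X sn) simp
  moreover have "(form G (velocity c s) (c t) / (t - s)) / (sn G (c s) (c t) / \<bar>t - s\<bar>)
      = cosang s (c t) * sgn (t - s)" for t
    by (cases t s rule: linorder_cases) (simp_all add: cosang_def divide_simps algebra_simps)
  ultimately show "((\<lambda>t. cosang s (c t) * sgn (t - s)) \<longlongrightarrow> 1) (at s)" by simp
  have "((\<lambda>t. (c t - c s) /\<^sub>R (t - s)) \<longlongrightarrow> velocity c s) (at s)"
  proof -
    have "((\<lambda>t. (1 / norm (t - s)) *\<^sub>R (c t - (c s + (t - s) *\<^sub>R velocity c s))) \<longlongrightarrow> 0) (at s)"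
      using c_deriv[of s] by (simp add: has_vector_derivative_def has_derivative_at2)
    then have "((\<lambda>t. norm ((1 / norm (t - s)) *\<^sub>R (c t - (c s + (t - s) *\<^sub>R velocity c s)))) \<longlongrightarrow> 0) (at s)"
      by (rule tendsto_norm_zero)
    moreover have "\<forall>\<^sub>F t in at s. norm ((1 / norm (t - s)) *\<^sub>R (c t - (c s + (t - s) *\<^sub>R velocity c s)))
        = norm ((c t - c s) /\<^sub>R (t - s) - velocity c s)"
      unfolding eventually_at_filter
    proof (intro always_eventually allI impI)
      fix t assume "t \<noteq> s"
      then have "(c t - c s) /\<^sub>R (t - s) - velocity c s = (1 / (t - s)) *\<^sub>R (c t - (c s + (t - s) *\<^sub>R velocity c s))"
        unfolding diff_diff_eq[symmetric] scaleR_diff_right[of _ "c t - c s"]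
        by (simp add: inverse_eq_divide)
      then show "norm ((1 / norm (t - s)) *\<^sub>R (c t - (c s + (t - s) *\<^sub>R velocity c s)))
          = norm ((c t - c s) /\<^sub>R (t - s) - velocity c s)" by simp
    qed
    ultimately have "((\<lambda>t. norm ((c t - c s) /\<^sub>R (t - s) - velocity c s)) \<longlongrightarrow> 0) (at s)"
      by (rule Lim_transform_eventually)
    then have "((\<lambda>t. (c t - c s) /\<^sub>R (t - s) - velocity c s) \<longlongrightarrow> 0) (at s)"
      by (rule tendsto_norm_zero_cancel)
    then show ?thesis by (rule LIM_zero_cancel)
  qed
  then have "((\<lambda>t. form G (velocity c t) ((c t - c s) /\<^sub>R (t - s))) \<longlongrightarrow> form G (velocity c s) (velocity c s)) (at s)"
    using v_cont[of UNIV] by (intro tendsto_intros) (auto simp: continuous_on_def)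
  then have Z: "((\<lambda>t. form G (velocity c t) (c s) / (s - t)) \<longlongrightarrow> 1) (at s)"
    by (simp add: form_linear form_c_v form_v_v divide_inverse mult.commute)
       (simp add: inverse_eq_divide minus_divide_right)
  have "((\<lambda>t. (form G (velocity c t) (c s) / (s - t)) / (sn G (c s) (c t) / \<bar>t - s\<bar>)) \<longlongrightarrow> 1 / 1) (at s)"
    by (intro tendsto_divide Z sn) simp
  moreover have eq: "(form G (velocity c t) (c s) / (s - t)) / (sn G (c s) (c t) / \<bar>t - s\<bar>)
      = cosang t (c s) * sgn (s - t)" for t
    unfolding cosang_def sn_commute[of G "c s" "c t"]
    by (cases t s rule: linorder_cases) (simp_all add: divide_simps algebra_simps)
  ultimately show "((\<lambda>t. cosang t (c s) * sgn (s - t)) \<longlongrightarrow> 1) (at s)" by (simp only: eq div_by_1)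
qed

end

section \<open>Tangent lines to the caustic\<close>

lemma det3_linear2:
  "det3 x (y + y') z = det3 x y z + det3 x y' z" "det3 x (r *\<^sub>R y) z = r * det3 x y z"
  "det3 x (- y) z = - det3 x y z"
  by (simp_all add: det3_expand algebra_simps)

lemma det3_swap23: "det3 x z y = - det3 x y z"
  by (simp add: det3_expand algebra_simps)

lemma supporting_line_iff:
  assumes "C \<subseteq> surface G"
  shows "supporting_line G C q u \<longleftrightarrow>
    (\<exists>y\<in>C. \<exists>t. y = geo G q u t) \<and> ((\<forall>z\<in>C. 0 \<le> det3 q u z) \<or> (\<forall>z\<in>C. det3 q u z \<le> 0))"
proof -
  have "(geodesic_line G q u \<inter> C \<noteq> {}) \<longleftrightarrow> (\<exists>y\<in>C. \<exists>t. y = geo G q u t)"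
    using assms unfolding geodesic_line_def by blast
  moreover have "(C \<subseteq> left_half_plane G q u) \<longleftrightarrow> (\<forall>z\<in>C. 0 \<le> det3 q u z)"
    "(C \<subseteq> left_half_plane G q (- u)) \<longleftrightarrow> (\<forall>z\<in>C. det3 q u z \<le> 0)"
    using assms by (auto simp: left_half_plane_def form_left_normal det3_linear2)
  ultimately show ?thesis unfolding supporting_line_def by simp
qed

text \<open>\<open>acute\<close> says that \<open>cg\<close> of the distance from a boundary point
  to a point of the table is positive. In the hemisphere this means distances below
  \<open>pi / 2\<close>, which \<open>acute_of_diameter\<close> derives from the bound on the
  diameter.\<close>

locale caustic = table +
  fixes C :: "(real^3) set"
  assumes C: "compact C" "geo_convex G C" "C \<subseteq> K" and C_interior: "interior (ocone C) \<noteq> {}"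
    and reflect: "\<And>q u u'. billiard_reflection G K q u u' \<Longrightarrow> supporting_line G C q u \<Longrightarrow> supporting_line G C q u'"
    and acute: "\<And>t z. z \<in> K \<Longrightarrow> 0 < curv G * form G (c t) z"
begin

lemma C_surf: "C \<subseteq> surface G"
  using C K by auto

text \<open>A reference point strictly left of every boundary tangent. It serves to exclude
  degenerate configurations along a tangent of the boundary.\<close>

lemma C_point: obtains z where "z \<in> C" "\<And>s. z \<noteq> c s" "\<And>s. 0 < sinang s z"
proof -
  obtain y where y: "y \<in> interior (ocone C)" using C_interior by auto
  then obtain r z where rz: "r > 0" "z \<in> C" "y = r *\<^sub>R z" using interior_subset by (force simp: ocone_def)
  have "ocone C \<subseteq> ocone K" using C(3) by (auto simp: ocone_def)
  then have yK: "y \<in> interior (ocone K)" using y interior_mono by blast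
  have d: "0 < det3 (c s) (velocity c s) z" for s
    using left_interior[OF yK, of s] rz by (simp add: det3_linear zero_less_mult_iff)
  have ne: "z \<noteq> c s" for s using d[of s] by auto
  have "0 < sinang s z" for s
    using d[of s] sn_c(1)[of z s] ne[of s] rz C by (auto simp: sinang_def)
  then show ?thesis using that rz(2) ne by blast
qed

text \<open>The trajectory from \<open>z\<close> reaches \<open>c s\<close> along a supporting line.
  Of the direction from \<open>c s\<close> to \<open>z\<close>, the outgoing line keeps the normal
  component and reverses the tangential one, so a touching point on it is seen under the negated
  cosine. Since that line supports \<open>C\<close>, this cosine is extreme on
  \<open>C\<close>.\<close>

lemma reflected_point:
  assumes s: "c s \<notin> C" and z: "z \<in> C" "0 < sinang s z"
    and side: "(\<forall>y\<in>C. 0 \<le> det3 (c s) z y) \<or> (\<forall>y\<in>C. det3 (c s) z y \<le> 0)"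
  obtains y where "y \<in> C" "cosang s y = - cosang s z"
    "(\<forall>z'\<in>C. cosang s z' \<le> cosang s y) \<or> (\<forall>z'\<in>C. cosang s y \<le> cosang s z')"
proof -
  define q T e where "q = c s" and "T = velocity c s" and "e = towards G q z"
  have zK: "z \<in> K" and zs: "z \<in> surface G" using z C C_surf by auto
  have ne: "q \<noteq> z" using s z by (auto simp: q_def)
  have qs: "q \<in> surface G" by (simp add: q_def c_surf)
  note tw = towards[OF qs zs ne]
  have sn: "sn G q z > 0" using sn_pos[OF qs zs ne] .
  have eT: "form G T e = cosang s z"
    using ang(1)[OF zK, of s] ne sn tw(3) form_c_v[of s]
    by (simp add: q_def T_def e_def towards_def form_linear cosang_def)
  have detz: "det3 q z x = sn G q z * det3 q e x" for x
    by (subst tw(3)) (simp add: det3_linear2 e_def)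
  have eN: "det3 q T e = sinang s z"
    using sn by (simp add: e_def towards_def det3_linear sinang_def q_def T_def)
  define u where "u = - e"
  define u' where "u' = (2 * form G u T) *\<^sub>R T - u"
  have "billiard_reflection G K q u u'"
    unfolding billiard_reflection_def
  proof (intro conjI)
    show "unit_tangent G q u" using tw(1) by (simp add: u_def e_def unit_tangent_minus)
    show "\<exists>\<delta>>0. \<forall>s\<in>{0..\<delta>}. geo G q (- u) s \<in> K"
    proof (intro exI[of _ "gdist G q z"] conjI ballI)
      show "0 < gdist G q z"
        using gdist_facts(2,3)[OF qs zs] sn by (metis less_eq_real_def sg_0 order_less_irrefl)
      show "geo G q (- u) r \<in> K" if "r \<in> {0..gdist G q z}" for r
      proof -
        have "geo G q (- u) r \<in> geodesic_segment G q z"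
          using tw(1,2) that unfolding geodesic_segment_def by (auto simp: u_def e_def)
        then show ?thesis using K(2) c_K[of s] zK by (auto simp: geo_convex_def q_def)
      qed
    qed
    show "\<exists>T. boundary_tangent G K q T \<and> u' = (2 * form G u T) *\<^sub>R T - u"
      using param unfolding boundary_tangent_def u'_def q_def T_def by blast
  qed
  moreover have "supporting_line G C q u"
    unfolding supporting_line_iff[OF C_surf]
  proof
    have "z = geo G q u (- gdist G q z)" using tw(2) by (simp add: geo_cg u_def e_def)
    then show "\<exists>y\<in>C. \<exists>t. y = geo G q u t" using z by blast
    show "(\<forall>z\<in>C. 0 \<le> det3 q u z) \<or> (\<forall>z\<in>C. det3 q u z \<le> 0)"
      using side sn unfolding u_def det3_linear2 q_def[symmetric] detz
      by (auto simp: zero_le_mult_iff mult_le_0_iff)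
  qed
  ultimately have "supporting_line G C q u'" by (rule reflect)
  then obtain y \<tau> where y: "y \<in> C" "y = geo G q u' \<tau>"
    and side': "(\<forall>z\<in>C. 0 \<le> det3 q u' z) \<or> (\<forall>z\<in>C. det3 q u' z \<le> 0)"
    unfolding supporting_line_iff[OF C_surf] by blast
  have yK: "y \<in> K" and yne: "y \<noteq> q" using y C s by (auto simp: q_def)
  have u'T: "form G T u' = - cosang s z"
    using eT form_v_v[of s] form_commute[of G e T] by (simp add: u'_def u_def form_linear T_def)
  have u'N: "det3 q T u' = sinang s z"
    using eN by (simp add: u'_def u_def det3_linear)
  have X: "form G T y = sg G \<tau> * (- cosang s z)"
    using form_c_v(2)[of s] u'T by (simp add: y(2) geo_cg form_linear T_def q_def)
  have Y: "det3 q T y = sg G \<tau> * sinang s z"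
    using u'N by (simp add: y(2) geo_cg det3_linear)
  have sny: "sn G q y > 0" using sn_c(1)[OF yK] yne by (simp add: q_def)
  \<comment> \<open>A touching point might lie behind \<open>q\<close> on the reflected geodesic; it
    does not, because the table is left of the tangent at \<open>q\<close>.\<close>
  have "0 \<le> sg G \<tau> * sinang s z" using left[OF yK, of s] Y by (simp add: q_def T_def)
  then have sg0: "0 \<le> sg G \<tau>" using z(2) by (simp add: zero_le_mult_iff)
  have "(sn G q y)\<^sup>2 = (sg G \<tau>)\<^sup>2 * ((cosang s z)\<^sup>2 + (sinang s z)\<^sup>2)"
    using sn_c(2)[OF yK, of s] yne X Y by (simp add: q_def T_def power_mult_distrib algebra_simps)
  also have "\<dots> = (sg G \<tau>)\<^sup>2" using ang(3)[OF zK, of s] ne by (simp add: q_def)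
  finally have sny': "sn G q y = sg G \<tau>" using sny sg0 by (simp add: power2_eq_iff_nonneg)
  have cy: "cosang s y = - cosang s z" and sy: "sinang s y > 0"
    using X Y sny sny' z(2) by (auto simp: cosang_def sinang_def q_def T_def)
  have dety: "det3 q y x = sg G \<tau> * det3 q u' x" for x
    by (simp add: y(2) geo_cg det3_linear2)
  have "(\<forall>z'\<in>C. cosang s z' \<le> cosang s y) \<or> (\<forall>z'\<in>C. cosang s y \<le> cosang s z')"
    using side'
  proof
    assume a: "\<forall>z\<in>C. 0 \<le> det3 q u' z"
    have "cosang s z' \<le> cosang s y" if "z' \<in> C" for z'
      using a that C s sy yne sg0 yK
      by (intro cosang_le_if_det3_nonneg) (auto simp: q_def[symmetric] dety)
    then show ?thesis by blast
  next
    assume a: "\<forall>z\<in>C. det3 q u' z \<le> 0"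
    have "cosang s y \<le> cosang s z'" if "z' \<in> C" for z'
    proof -
      have "0 \<le> det3 q z' y"
        using mult_nonneg_nonpos[OF sg0, of "det3 q u' z'"] a that dety[of z'] det3_swap23[of q z' y] by simp
      then show ?thesis using that C s sy yne yK
        by (intro cosang_le_if_det3_nonneg) (auto simp: q_def[symmetric])
    qed
    then show ?thesis by blast
  qed
  then show ?thesis using that y(1) cy by blast
qed

lemma extremes:
  assumes s: "c s \<notin> C"
  obtains z z' where "z \<in> C" "z' \<in> C" "\<And>y. y \<in> C \<Longrightarrow> cosang s y \<le> cosang s z" "\<And>y. y \<in> C \<Longrightarrow> cosang s z' \<le> cosang s y"
proof -
  have "sn G (c s) z \<noteq> 0" if "z \<in> C" for z
    using sn_c(1)[of z s] that s C by fastforce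
  then have "continuous_on C (cosang s)"
    unfolding cosang_def[abs_def] by (intro continuous_intros) auto
  moreover have "C \<noteq> {}" using C_point by blast
  ultimately show ?thesis
    using continuous_attains_sup[OF C(1)] continuous_attains_inf[OF C(1)] that by metis
qed

lemma extreme_side:
  assumes s: "c s \<notin> C" and z: "z \<in> C"
  shows "(\<And>y. y \<in> C \<Longrightarrow> cosang s y \<le> cosang s z) \<Longrightarrow> \<forall>y\<in>C. 0 \<le> det3 (c s) z y"
    and "(\<And>y. y \<in> C \<Longrightarrow> cosang s z \<le> cosang s y) \<Longrightarrow> \<forall>y\<in>C. det3 (c s) z y \<le> 0"
proof -
  show "\<forall>y\<in>C. 0 \<le> det3 (c s) z y" if "\<And>y. y \<in> C \<Longrightarrow> cosang s y \<le> cosang s z"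
    using that s z C by (intro ballI det3_nonneg_if_cosang_le) auto
  show "\<forall>y\<in>C. det3 (c s) z y \<le> 0" if m: "\<And>y. y \<in> C \<Longrightarrow> cosang s z \<le> cosang s y"
  proof
    fix y assume y: "y \<in> C"
    then have "0 \<le> det3 (c s) y z"
      using m s z C by (intro det3_nonneg_if_cosang_le) auto
    then show "det3 (c s) z y \<le> 0"
      using det3_swap23[of "c s" y z] by simp
  qed
qed

text \<open>The reflection of an extreme line is again extreme: either it is the other extreme, or
  the line is its own reflection and perpendicular to the boundary. A line tangent to the boundary
  is not covered by \<open>reflected_point\<close> and remains a separate case.\<close>

lemma opposite_extremes_or_tangent:
  assumes s: "c s \<notin> C" and z: "z \<in> C" "z' \<in> C"
    and max: "\<And>y. y \<in> C \<Longrightarrow> cosang s y \<le> cosang s z" and min: "\<And>y. y \<in> C \<Longrightarrow> cosang s z' \<le> cosang s y"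
  shows "cosang s z' = - cosang s z \<or> (cosang s z = 1 \<and> cosang s z' = 0) \<or> (cosang s z = 0 \<and> cosang s z' = -1)"
proof -
  obtain w where w: "w \<in> C" "\<And>s. w \<noteq> c s" "\<And>s. 0 < sinang s w" using C_point by blast
  have wK: "w \<in> K" using w C by auto
  have zK: "z \<in> K" "z \<noteq> c s" "z' \<in> K" "z' \<noteq> c s" using z s C by auto
  have "(cosang s w)\<^sup>2 \<noteq> 1" using ang(3)[OF wK w(2), of s] w(3)[of s] by auto
  then have "cosang s w \<noteq> 1" "cosang s w \<noteq> -1" by auto
  then have w1: "-1 < cosang s w" "cosang s w < 1" using ang(5)[OF wK w(2), of s] by linarith+
  have M: "cosang s z = 1 \<or> - cosang s z = cosang s z' \<or> cosang s z = 0"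
  proof (cases "0 < sinang s z")
    case True
    obtain y where "y \<in> C" "cosang s y = - cosang s z"
      "(\<forall>z'\<in>C. cosang s z' \<le> cosang s y) \<or> (\<forall>z'\<in>C. cosang s y \<le> cosang s z')"
      using reflected_point[OF s z(1) True] extreme_side(1)[OF s z(1) max] by blast
    then show ?thesis using max min z by fastforce
  next
    case False
    then show ?thesis using sinang_zero[OF zK(1,2)] max[OF w(1)] w1 by auto
  qed
  have m: "cosang s z' = -1 \<or> - cosang s z' = cosang s z \<or> cosang s z' = 0"
  proof (cases "0 < sinang s z'")
    case True
    obtain y where "y \<in> C" "cosang s y = - cosang s z'"
      "(\<forall>z'\<in>C. cosang s z' \<le> cosang s y) \<or> (\<forall>z'\<in>C. cosang s y \<le> cosang s z')"
      using reflected_point[OF s z(2) True] extreme_side(2)[OF s z(2) min] by blast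
    then show ?thesis using max min z by fastforce
  next
    case False
    then show ?thesis using sinang_zero[OF zK(3,4)] min[OF w(1)] w1 by auto
  qed
  show ?thesis using M m by auto
qed

text \<open>On the tangent geodesic \<open>c s\<close> lies between \<open>y1\<close> and
  \<open>y2\<close>; \<open>acute\<close> guarantees that the positive combination on its line is a
  positive multiple of \<open>c s\<close>, not of its negative.\<close>

lemma between_in_C:
  assumes y: "y1 \<in> C" "y2 \<in> C" "cosang s y1 = 1" "cosang s y2 = -1"
  shows "c s \<in> C"
proof (rule ccontr)
  assume s: "c s \<notin> C"
  have K12: "y1 \<in> K" "y2 \<in> K" "y1 \<noteq> c s" "y2 \<noteq> c s" using y C s by auto
  have "(sinang s y1)\<^sup>2 = 0" "(sinang s y2)\<^sup>2 = 0"
    using ang(3)[OF K12(1,3)] ang(3)[OF K12(2,4)] y by auto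
  then have 0: "sinang s y1 = 0" "sinang s y2 = 0" by auto
  define a b where "a = sn G (c s) y2" and "b = sn G (c s) y1"
  have ab: "a > 0" "b > 0" using sn_c(1)[OF K12(1,3)] sn_c(1)[OF K12(2,4)] by (auto simp: a_def b_def)
  have e1: "y1 = (curv G * form G (c s) y1) *\<^sub>R c s + b *\<^sub>R velocity c s"
    using fr.expand[of y1 s] ang(1,2)[OF K12(1,3)] 0 y by (simp add: fr.form_N b_def)
  have e2: "y2 = (curv G * form G (c s) y2) *\<^sub>R c s - a *\<^sub>R velocity c s"
    using fr.expand[of y2 s] ang(1,2)[OF K12(2,4)] 0 y by (simp add: fr.form_N a_def)
  define m where "m = a * (curv G * form G (c s) y1) + b * (curv G * form G (c s) y2)"
  have m: "a *\<^sub>R y1 + b *\<^sub>R y2 = m *\<^sub>R c s"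
    by (subst e1, subst e2) (simp add: m_def algebra_simps)
  have "m > 0" using acute[OF K12(1), of s] acute[OF K12(2), of s] ab by (simp add: m_def add_pos_pos)
  moreover have "m *\<^sub>R c s \<in> ocone C"
    unfolding m[symmetric] using ab y by (intro ocone_combination[OF C(2)]) auto
  ultimately have "c s \<in> ocone C" using ocone_scale[of "1 / m" "m *\<^sub>R c s" C] by simp
  then show False using ocone_surface[OF C_surf c_surf] s by blast
qed

text \<open>A reflection alone would allow the two supporting lines through a boundary point to be the
  tangent and the perpendicular.  Moving the point towards \<open>C\<close> along the tangent, which stays in
  the boundary, breaks the perpendicularity and so rules this out.\<close>

lemma tangent_perpendicular_impossible:
  assumes s: "c s \<notin> C" and \<sigma>: "\<sigma> = 1 \<or> \<sigma> = -1"
    and z1: "z1 \<in> C" "cosang s z1 = \<sigma>" and z2: "z2 \<in> C" "cosang s z2 = 0"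
  shows False
proof -
  define q T E d where "q = c s" and "T = velocity c s" and "E = \<sigma> *\<^sub>R T" and "d = gdist G q z1"
  have \<sigma>2: "\<sigma> * \<sigma> = 1" "\<sigma> * (\<sigma> * x) = x" for x using \<sigma> by auto
  have K12: "z1 \<in> K" "z2 \<in> K" "z1 \<noteq> c s" "z2 \<noteq> c s" using z1 z2 C s by auto
  have qs: "q \<in> surface G" and z1s: "z1 \<in> surface G" using c_surf z1 C_surf by (auto simp: q_def)
  have ne: "q \<noteq> z1" using K12 by (auto simp: q_def)
  note gd = gdist_facts[OF qs z1s]
  have sd: "sg G d > 0" using gd(2) sn_pos[OF qs z1s ne] by (simp add: d_def)
  have d0: "d > 0" using gd(3) sd by (auto simp: d_def less_le)
  have dpi: "G = Spherical \<Longrightarrow> d \<le> pi" using gd(4) by (simp add: d_def)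
  have "(sinang s z1)\<^sup>2 = 0" using ang(3)[OF K12(1,3)] z1 \<sigma> by auto
  then have "sinang s z1 = 0" by simp
  then have "det3 q T z1 = 0" "form G T z1 = sg G d * \<sigma>"
    using ang(1,2)[OF K12(1,3)] z1(2) gd(2) by (simp_all add: q_def T_def d_def)
  then have z1e: "z1 = cg G d *\<^sub>R q + sg G d *\<^sub>R E" and Yz1: "det3 q T z1 = 0"
    using fr.expand[of z1 s] gd(1) by (simp_all add: fr.form_N q_def T_def d_def E_def)
  have E: "unit_tangent G q E"
    using unit[of s] \<sigma> by (auto simp: E_def q_def T_def unit_tangent_minus)
  have fE: "form G q q = curv G" "form G q E = 0" "form G E q = 0" "form G E E = 1"
    using E surfaceD(1)[OF qs] by (auto simp: unit_tangent_def form_commute[of G E q])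
  \<comment> \<open>The complement of \<open>C\<close> is open, so a short move from
    \<open>q\<close> towards \<open>z1\<close> stays outside \<open>C\<close>.\<close>
  have "\<exists>r>0. r < d \<and> geo G q E r \<notin> C"
  proof -
    have "isCont (geo G q E) 0"
      unfolding geo_cg[abs_def] using continuous_on_cg[of UNIV "\<lambda>x. x" G] continuous_on_sg[of UNIV "\<lambda>x. x" G]
      by (intro continuous_intros) (auto simp: continuous_on_eq_continuous_at)
    moreover have "geo G q E 0 \<in> - C" using s by (simp add: geo_cg q_def)
    moreover have "open (- C)" using compact_imp_closed[OF C(1)] by auto
    ultimately have "\<forall>\<^sub>F r in at 0. geo G q E r \<in> - C"
      unfolding isCont_def by (metis topological_tendstoD)
    then obtain e where e: "e > 0" "\<And>r. r \<noteq> 0 \<Longrightarrow> \<bar>r\<bar> < e \<Longrightarrow> geo G q E r \<in> - C"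
      unfolding eventually_at by (auto simp: dist_real_def)
    show ?thesis using e d0 e(2)[of "min e d / 2"] by (intro exI[of _ "min e d / 2"]) auto
  qed
  then obtain r where r: "0 < r" "r < d" "geo G q E r \<notin> C" by blast
  have sr: "sg G r > 0" "sg G (d - r) > 0" using r dpi by (auto intro!: sg_pos)
  \<comment> \<open>\<open>V\<close> is the velocity, at \<open>q'\<close>, of the geodesic from
    \<open>q\<close> towards \<open>z1\<close>.\<close>
  define q' V where "q' = geo G q E r" and "V = (- curv G * sg G r) *\<^sub>R q + cg G r *\<^sub>R E"
  have q'e: "q' = cg G r *\<^sub>R q + sg G r *\<^sub>R E" by (simp add: q'_def geo_cg)
  have "q' \<in> geodesic_segment G q z1"
    unfolding geodesic_segment_def q'_def mem_Collect_eq d_def[symmetric]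
    using E r z1e by (intro exI[of _ E] exI[of _ r] conjI) (simp_all add: geo_cg)
  then have q'K: "q' \<in> K" using K(2) c_K[of s] K12 by (auto simp: geo_convex_def q_def)
  have "det3 q T q' = 0" by (simp add: q'e E_def det3_linear)
  then have "q' \<in> boundary G K"
    using q'K left_interior[of q' s] boundary_iff[OF K(1,3)] by (auto simp: q_def T_def)
  then obtain s' where s': "c s' = q'" using boundary_eq by auto
  have s'C: "c s' \<notin> C" using r s' by (simp add: q'_def)
  define T' where "T' = velocity c s'"
  have cs: "cg G r * cg G r + curv G * (sg G r * sg G r) = 1"
    using cg_sg_square[of G r] by (simp add: power2_eq_square)
  have fV: "form G q' V = 0" "form G V q' = 0" "form G V V = 1"
    using fE cs by (simp_all add: q'e V_def form_linear algebra_simps)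
  have detV: "det3 q' V y = \<sigma> * det3 q T y" for y
  proof -
    have "det3 q' V y = (cg G r * cg G r + curv G * (sg G r * sg G r)) * det3 q E y"
      by (simp add: q'e V_def det3_expand algebra_simps)
    then show ?thesis by (simp add: cs E_def det3_linear2)
  qed
  have qe: "q = cg G r *\<^sub>R q' - sg G r *\<^sub>R V"
  proof -
    have "cg G r *\<^sub>R q' - sg G r *\<^sub>R V = (cg G r * cg G r + curv G * (sg G r * sg G r)) *\<^sub>R q"
      by (simp add: q'e V_def algebra_simps)
    then show ?thesis by (simp add: cs)
  qed
  have z1e': "z1 = cg G (d - r) *\<^sub>R q' + sg G (d - r) *\<^sub>R V"
  proof -
    have 1: "cg G d = cg G (d - r) * cg G r - curv G * sg G (d - r) * sg G r"
      "sg G d = sg G (d - r) * cg G r + cg G (d - r) * sg G r"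
      using cg_add[of G "d - r" r] sg_add[of G "d - r" r] by simp_all
    show ?thesis unfolding z1e 1 by (simp add: q'e V_def algebra_simps)
  qed
  \<comment> \<open>On this geodesic \<open>q\<close> and \<open>z1\<close> lie on opposite sides of
    \<open>q'\<close>, but both are on the left of the tangent at \<open>q'\<close>; hence the
    geodesic is that tangent.\<close>
  have "0 \<le> det3 q' T' q" "0 \<le> det3 q' T' z1"
    using left[OF c_K, of s' s] left[OF K12(1), of s'] s' by (simp_all add: q_def T'_def)
  then have "0 \<le> - (sg G r * det3 q' T' V)" "0 \<le> sg G (d - r) * det3 q' T' V"
    by (simp_all add: qe z1e' det3_linear)
  then have V0: "det3 q' T' V = 0"
    using sr by (simp add: zero_le_mult_iff mult_le_0_iff)
  define a where "a = form G T' V"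
  have Va: "V = a *\<^sub>R T'"
    using fr.expand[of V s'] fr.form_N(1)[of s' V] s' fV V0 by (simp add: a_def T'_def)
  have "a * a = 1" using fV(3) form_v_v[of s'] unfolding Va by (simp add: form_linear T'_def)
  then have a1: "a = 1 \<or> a = -1" by (simp add: square_eq_1_iff)
  have a\<sigma>: "a = \<sigma>"
  proof -
    obtain w where w: "w \<in> C" "\<And>s. w \<noteq> c s" "\<And>s. 0 < sinang s w" using C_point by blast
    have "0 < det3 (c t) (velocity c t) w" for t
      using ang(2)[of w t] sn_c(1)[of w t] w C by auto
    then have "0 < det3 q T w" "0 < det3 q' T' w"
      using s' by (auto simp: q_def T_def T'_def)
    moreover have "a * det3 q' T' w = \<sigma> * det3 q T w"
      using detV[of w] by (simp add: Va det3_linear2)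
    ultimately show ?thesis using a1 \<sigma> by auto
  qed
  have T'V: "T' = \<sigma> *\<^sub>R V" unfolding Va a\<sigma> using \<sigma> by auto
  have K12': "z1 \<noteq> c s'" "z2 \<noteq> c s'" using s'C z1 z2 by auto
  have "form G T' z1 = \<sigma> * sg G (d - r)"
    using fV by (simp add: T'V z1e' form_linear)
  then have c1: "cosang s' z1 * sn G (c s') z1 = \<sigma> * sg G (d - r)"
    using ang(1)[OF K12(1) K12'(1)] by (simp add: T'_def mult.commute)
  have "det3 q' T' z1 = 0"
    using detV[of z1] Yz1 by (simp add: T'V det3_linear2)
  then have "sinang s' z1 = 0"
    using ang(2)[OF K12(1) K12'(1)] sn_c(1)[OF K12(1) K12'(1)] s' by (simp add: T'_def)
  then have "(cosang s' z1)\<^sup>2 = 1" using ang(3)[OF K12(1) K12'(1)] by simp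
  then have "cosang s' z1 = 1 \<or> cosang s' z1 = -1" by (simp add: power2_eq_1_iff)
  then have c1': "cosang s' z1 = \<sigma>"
    using c1 \<sigma> sr sn_c(1)[OF K12(1) K12'(1)] by auto
  \<comment> \<open>From \<open>q\<close> the direction of \<open>z2\<close> was perpendicular to
    the boundary; from \<open>q'\<close> the point \<open>z2\<close> appears strictly on the side
    opposite to \<open>z1\<close>, by \<open>acute\<close>.\<close>
  have "form G T' z2 = - (\<sigma> * sg G r * (curv G * form G q z2))"
    using ang(1)[OF K12(2,4)] z2(2) by (simp add: T'V V_def E_def form_linear T_def q_def algebra_simps)
  then have "\<sigma> * form G T' z2 = - (sg G r * (curv G * form G q z2))"
    using \<sigma>2 by (simp add: mult.assoc)
  then have "\<sigma> * form G T' z2 < 0" using sr acute[OF K12(2), of s] by (simp add: q_def)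
  then have "sn G (c s') z2 * (\<sigma> * cosang s' z2) < 0"
    using ang(1)[OF K12(2) K12'(2)] by (simp add: T'_def mult.left_commute)
  then have c2: "\<sigma> * cosang s' z2 < 0" using sn_c(1)[OF K12(2) K12'(2)] by (simp add: mult_less_0_iff)
  obtain z z' where zz: "z \<in> C" "z' \<in> C" "\<And>y. y \<in> C \<Longrightarrow> cosang s' y \<le> cosang s' z"
    "\<And>y. y \<in> C \<Longrightarrow> cosang s' z' \<le> cosang s' y" using extremes[OF s'C] by blast
  have "z \<noteq> c s'" "z' \<noteq> c s'" "z \<in> K" "z' \<in> K" using zz s'C C by auto
  then have "\<bar>cosang s' z\<bar> \<le> 1" "\<bar>cosang s' z'\<bar> \<le> 1" using ang(5) by auto
  \<comment> \<open>One extreme is tangent and some point lies strictly on the other side, so only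
    the extremes 1 and -1 remain, which \<open>between_in_C\<close> forbids outside
    \<open>C\<close>.\<close>
  then have "cosang s' z = 1 \<and> cosang s' z' = -1"
    using opposite_extremes_or_tangent[OF s'C zz] zz(3)[OF z1(1)] zz(4)[OF z1(1)] zz(3)[OF z2(1)] zz(4)[OF z2(1)]
      c1' c2 \<sigma> by auto
  then show False using between_in_C[OF zz(1,2)] s'C by blast
qed

lemma opposite_extremes:
  assumes s: "c s \<notin> C" and z: "z \<in> C" "z' \<in> C"
    and max: "\<And>y. y \<in> C \<Longrightarrow> cosang s y \<le> cosang s z" and min: "\<And>y. y \<in> C \<Longrightarrow> cosang s z' \<le> cosang s y"
  shows "cosang s z' = - cosang s z"
  using opposite_extremes_or_tangent[OF assms] tangent_perpendicular_impossible[OF s, of 1 z z']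
    tangent_perpendicular_impossible[OF s, of "-1" z' z] z by auto

text \<open>The cosine of the angle between the boundary and the tangent lines to \<open>C\<close>; at a point where
  \<open>C\<close> touches the boundary it is \<open>1\<close>, which makes it continuous.\<close>

definition tcos :: "real \<Rightarrow> real" where
  "tcos s = (if c s \<in> C then 1 else SUP z\<in>C. cosang s z)"

lemma tcos_attained:
  assumes s: "c s \<notin> C"
  obtains z z' where "z \<in> C" "z' \<in> C" "cosang s z = tcos s" "cosang s z' = - tcos s"
proof -
  obtain z z' where zz: "z \<in> C" "z' \<in> C" "\<And>y. y \<in> C \<Longrightarrow> cosang s y \<le> cosang s z"
    "\<And>y. y \<in> C \<Longrightarrow> cosang s z' \<le> cosang s y" using extremes[OF s] by blast
  have "tcos s = cosang s z"
    unfolding tcos_def using s zz by (auto intro!: cSup_eq_maximum)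
  then show ?thesis using that[OF zz(1,2)] opposite_extremes[OF s zz] by simp
qed

lemma tcos_bounds:
  assumes s: "c s \<notin> C" and y: "y \<in> C" shows "\<bar>cosang s y\<bar> \<le> tcos s"
proof -
  obtain z z' where zz: "z \<in> C" "z' \<in> C" "\<And>y. y \<in> C \<Longrightarrow> cosang s y \<le> cosang s z"
    "\<And>y. y \<in> C \<Longrightarrow> cosang s z' \<le> cosang s y" using extremes[OF s] by blast
  have "tcos s = cosang s z"
    unfolding tcos_def using s zz by (auto intro!: cSup_eq_maximum)
  then show ?thesis using zz(3,4)[OF y] opposite_extremes[OF s zz] by auto
qed

lemma tcos_le_1: "tcos s \<le> 1"
proof (cases "c s \<in> C")
  case False
  obtain z where z: "z \<in> C" "cosang s z = tcos s" using tcos_attained[OF False] by blast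
  moreover have "z \<in> K" "z \<noteq> c s" using z False C by auto
  ultimately show ?thesis using ang(5)[of z s] by auto
qed (simp add: tcos_def)

lemma tcos_pos: "tcos s > 0"
proof (cases "c s \<in> C")
  case False
  have "tcos s \<ge> 0" using tcos_bounds[OF False] C_point abs_ge_zero order_trans by metis
  moreover have "tcos s \<noteq> 0"
  proof
    assume 0: "tcos s = 0"
    \<comment> \<open>If the angle were right, all of \<open>C\<close> would lie on the geodesic
      perpendicular to the boundary, which is cut out by \<open>w\<close>.\<close>
    define w where "w = cross3 (c s) (fr.N s)"
    have w: "w \<bullet> z = det3 (c s) (fr.N s) z" for z by (simp add: w_def det3_def)
    have w': "w \<bullet> z = - form G (velocity c s) z" for z
      unfolding w fr.det3_expand_frame[of s] by (simp add: fr.N)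
    have w0: "w \<bullet> z = 0" if "z \<in> C" for z
    proof -
      have "cosang s z = 0" using tcos_bounds[OF False that] 0 by simp
      then show ?thesis using ang(1)[of z s] that False C unfolding w' by auto
    qed
    have "w \<noteq> 0" using w'[of "velocity c s"] form_v_v[of s] by auto
    moreover obtain y where y: "y \<in> interior (ocone C)" using C_interior by auto
    ultimately have "0 < w \<bullet> y" using interior_ocone_pos[of w C y] w0 by auto
    moreover obtain r z where "y = r *\<^sub>R z" "z \<in> C" using y interior_subset by (force simp: ocone_def)
    ultimately show False using w0[of z] by simp
  qed
  ultimately show ?thesis by simp
qed (simp add: tcos_def)

lemma tcos_period: "tcos (s + L) = tcos s"
  by (simp add: tcos_def cosang_def c_period v_period)

text \<open>Away from \<open>C\<close> the supremum is that of a uniformly continuous function over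
  a compact set. At a touching point, \<open>c s\<close> itself, seen from nearby boundary points,
  forces the value towards 1.\<close>

lemma tcos_cont: "isCont tcos s"
proof (cases "c s \<in> C")
  case True
  have "(tcos \<longlongrightarrow> 1) (at s)"
  proof (rule tendsto_sandwich[OF _ _ cosang_limit'[of s] tendsto_const[of 1]])
    show "\<forall>\<^sub>F t in at s. cosang t (c s) * sgn (s - t) \<le> tcos t"
      unfolding eventually_at_filter
    proof (intro always_eventually allI impI)
      fix t assume "t \<noteq> s"
      show "cosang t (c s) * sgn (s - t) \<le> tcos t"
      proof (cases "c t \<in> C")
        case True
        show ?thesis
        proof (cases "c t = c s")
          case True
          then have "sn G (c t) (c s) = 0" by (simp add: sn_def surfaceD(1)[OF c_surf] power2_eq_square)
          then show ?thesis using tcos_pos[of t] by (simp add: cosang_def)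
        next
          case False
          then have "\<bar>cosang t (c s)\<bar> \<le> 1" using ang(5)[of "c s" t] c_K[of s] by auto
          then have "\<bar>cosang t (c s) * sgn (s - t)\<bar> \<le> 1" using \<open>t \<noteq> s\<close> by (simp add: abs_mult abs_sgn_eq)
          then show ?thesis using \<open>c t \<in> C\<close> by (simp add: tcos_def)
        qed
      next
        case False
        have "\<bar>cosang t (c s) * sgn (s - t)\<bar> \<le> tcos t"
          using tcos_bounds[OF False \<open>c s \<in> C\<close>] \<open>t \<noteq> s\<close> by (simp add: abs_mult abs_sgn_eq)
        then show ?thesis by simp
      qed
    qed
  qed (use tcos_le_1 in auto)
  then show ?thesis using True by (simp add: isCont_def tcos_def)
next
  case False
  have "isCont c s" using c_cont[of UNIV] by (simp add: continuous_on_eq_continuous_at)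
  moreover have "open (- C)" using compact_imp_closed[OF C(1)] by auto
  ultimately have "\<forall>\<^sub>F t in at s. c t \<in> - C"
    using False unfolding isCont_def by (metis topological_tendstoD ComplI)
  then obtain e where e: "e > 0" "\<And>t. t \<noteq> s \<Longrightarrow> \<bar>t - s\<bar> < e \<Longrightarrow> c t \<in> - C"
    unfolding eventually_at by (auto simp: dist_real_def)
  define I where "I = {s - e/2..s + e/2}"
  have I: "c t \<notin> C" if "t \<in> I" for t
    using that e(2)[of t] False e(1) by (cases "t = s") (auto simp: I_def abs_if split: if_splits)
  have sI: "s \<in> I" using e by (auto simp: I_def)
  have "sn G (c t) z \<noteq> 0" if "t \<in> I" "z \<in> C" for t z
    using sn_c(1)[of z t] that I C by fastforce
  then have "continuous_on (I \<times> C) (\<lambda>p. cosang (fst p) (snd p))"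
    unfolding cosang_def
    by (intro continuous_intros continuous_on_compose2[OF v_cont[of UNIV]] continuous_on_compose2[OF c_cont[of UNIV]]) auto
  then have uc: "uniformly_continuous_on (I \<times> C) (\<lambda>p. cosang (fst p) (snd p))"
    using C(1) by (intro compact_uniformly_continuous compact_Times) (auto simp: I_def)
  show ?thesis unfolding continuous_at_eps_delta
  proof (intro allI impI)
    fix \<epsilon> :: real assume \<epsilon>: "\<epsilon> > 0"
    then obtain \<delta> where \<delta>: "\<delta> > 0" "\<And>p p'. p \<in> I \<times> C \<Longrightarrow> p' \<in> I \<times> C \<Longrightarrow> dist p' p < \<delta> \<Longrightarrow>
        dist (cosang (fst p') (snd p')) (cosang (fst p) (snd p)) < \<epsilon>"
      using uc unfolding uniformly_continuous_on_def by metis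
    have \<delta>': "\<bar>cosang t z - cosang s z\<bar> < \<epsilon>" if "t \<in> I" "\<bar>t - s\<bar> < \<delta>" "z \<in> C" for t z
      using \<delta>(2)[of "(s, z)" "(t, z)"] that sI by (auto simp: dist_Pair_Pair dist_real_def)
    have "\<bar>tcos t - tcos s\<bar> < \<epsilon>" if t: "t \<in> I" "\<bar>t - s\<bar> < \<delta>" for t
    proof -
      obtain z where z: "z \<in> C" "cosang s z = tcos s" using tcos_attained[OF False] by blast
      obtain y where y: "y \<in> C" "cosang t y = tcos t" using tcos_attained[OF I[OF t(1)]] by blast
      show ?thesis
        using \<delta>'[OF t z(1)] \<delta>'[OF t y(1)] z y tcos_bounds[OF False y(1)] tcos_bounds[OF I[OF t(1)] z(1)] by linarith
    qed
    moreover have "t \<in> I" if "\<bar>t - s\<bar> < e/2" for t using that unfolding I_def abs_less_iff by simp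
    ultimately show "\<exists>d>0. \<forall>t. dist t s < d \<longrightarrow> dist (tcos t) (tcos s) < \<epsilon>"
      using \<delta>(1) e(1) by (intro exI[of _ "min \<delta> (e/2)"]) (auto simp: dist_real_def)
  qed
qed

end

section \<open>The action of a chord\<close>

text \<open>At the last maximum of a row, \<open>P\<close> has just ceased to hold, so \<open>dU\<close> is nonnegative there.  Hence the
  row maximum has a nonnegative lower right derivative, and being periodic it is constant.\<close>

lemma row_maximum_constant:
  fixes U dU :: "real \<Rightarrow> real \<Rightarrow> real" and P :: "real \<Rightarrow> real \<Rightarrow> bool"
  assumes L: "L > 0"
    and cont: "continuous_on UNIV (\<lambda>p. U (fst p) (snd p))"
    and per: "\<And>s t. U (s + L) (t + L) = U s t"
    and diag: "\<And>s. U s s = 0" and diagL: "\<And>s. U s (s + L) \<le> 0"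
    and inc: "\<And>s t. s < t \<Longrightarrow> t < s + L \<Longrightarrow> P s t \<Longrightarrow> \<exists>d\<ge>0. (U s has_real_derivative d) (at t)"
    and ddU: "\<And>s t. s < t \<Longrightarrow> t < s + L \<Longrightarrow> ((\<lambda>r. U r t) has_real_derivative dU s t) (at s)"
    and contdU: "\<And>s t. s < t \<Longrightarrow> t < s + L \<Longrightarrow> isCont (dU s) t"
    and dU: "\<And>s t. s < t \<Longrightarrow> t < s + L \<Longrightarrow> \<not> P s t \<Longrightarrow> dU s t \<ge> 0"
    and shrink: "\<And>s r t. s < r \<Longrightarrow> r < t \<Longrightarrow> t < s + L \<Longrightarrow> P s t \<Longrightarrow> P s r"
  shows "\<exists>M\<ge>0. (\<forall>s t. s \<le> t \<and> t \<le> s + L \<longrightarrow> U s t \<le> M) \<and> (\<forall>s. \<exists>t\<in>{s..s+L}. U s t = M)"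
proof -
  have contr: "continuous_on A (U s)" for s A
    using continuous_on_compose2[OF cont, of A "\<lambda>t. (s, t)"] by (simp add: continuous_on_Pair)
  have "\<exists>t\<in>{s..s+L}. \<forall>t'\<in>{s..s+L}. U s t' \<le> U s t" for s
    using L by (intro continuous_attains_sup contr) auto
  then obtain \<tau> where \<tau>: "\<And>s. \<tau> s \<in> {s..s+L}" and \<tau>max: "\<And>s t. t \<in> {s..s+L} \<Longrightarrow> U s t \<le> U s (\<tau> s)"
    by metis
  define m where "m s = U s (\<tau> s)" for s
  have mge: "U s t \<le> m s" if "s \<le> t" "t \<le> s + L" for s t
    using \<tau>max[of t s] that by (auto simp: m_def)
  have m0: "m s \<ge> 0" for s using mge[of s s] diag L by auto
  have loc: "\<exists>d>0. \<forall>t\<in>{s<..<s+d}. m t \<ge> m s - e * (t - s)" if e: "e > 0" for s e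
  proof (cases "m s > 0")
    case False
    have "m t \<ge> m s - e * (t - s)" if "t > s" for t
      using m0[of t] False e that by (smt (verit) mult_pos_pos)
    then show ?thesis by (intro exI[of _ 1]) auto
  next
    case True
    define S where "S = {t\<in>{s..s+L}. U s t = m s}"
    have "closed S"
      unfolding S_def by (rule continuous_closed_preimage_constant[OF contr]) auto
    then have cS: "compact S"
      by (auto simp: compact_eq_bounded_closed S_def intro: bounded_subset[OF bounded_closed_interval])
    have "\<tau> s \<in> S" using \<tau> by (auto simp: S_def m_def)
    then obtain \<sigma> where \<sigma>: "\<sigma> \<in> S" and \<sigma>max: "\<And>t. t \<in> S \<Longrightarrow> t \<le> \<sigma>"
      using compact_attains_sup[OF cS] by auto
    have \<sigma>U: "U s \<sigma> = m s" using \<sigma> by (auto simp: S_def)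
    have \<sigma>1: "s < \<sigma>" "\<sigma> < s + L"
      using \<sigma> True diag[of s] diagL[of s] \<sigma>U by (auto simp: S_def less_le)
    \<comment> \<open>If \<open>P s t\<close> held, \<open>shrink\<close> would extend it back to
      \<open>\<sigma>\<close>, the row would not decrease from \<open>\<sigma>\<close> to
      \<open>t\<close>, and \<open>t\<close> would be a later maximum.\<close>
    have nP: "\<not> P s t" if t: "\<sigma> < t" "t < s + L" for t
    proof
      assume P: "P s t"
      have "U s \<sigma> \<le> U s t"
      proof (rule DERIV_nonneg_imp_nondecreasing[where f = "U s"])
        fix r assume r: "\<sigma> \<le> r" "r \<le> t"
        then have "P s r" using shrink[of s r t] P \<sigma>1 t by (cases "r = t") auto
        then show "\<exists>y. (U s has_real_derivative y) (at r) \<and> 0 \<le> y"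
          using inc[of s r] r \<sigma>1 t by auto
      qed (use t in auto)
      then have "t \<in> S" using mge[of s t] \<sigma>1 t \<sigma>U by (auto simp: S_def)
      then show False using \<sigma>max[of t] t by auto
    qed
    have "(dU s \<longlongrightarrow> dU s \<sigma>) (at_right \<sigma>)"
      using contdU[OF \<sigma>1] unfolding isCont_def by (rule filterlim_mono) (auto intro: at_le)
    moreover have "\<forall>\<^sub>F t in at_right \<sigma>. 0 \<le> dU s t"
      unfolding eventually_at_right_field using \<sigma>1 dU nP by (intro exI[of _ "s + L"]) auto
    ultimately have dU\<sigma>: "0 \<le> dU s \<sigma>"
      by (intro tendsto_lowerbound) auto
    have "((\<lambda>t. (U t \<sigma> - U s \<sigma>) / (t - s)) \<longlongrightarrow> dU s \<sigma>) (at s)"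
      using ddU[OF \<sigma>1] by (simp add: has_field_derivative_iff)
    then have "\<forall>\<^sub>F t in at s. (U t \<sigma> - U s \<sigma>) / (t - s) > - e"
      by (rule order_tendstoD) (use e dU\<sigma> in auto)
    then obtain d where d: "d > 0" "\<And>t. t \<noteq> s \<Longrightarrow> \<bar>t - s\<bar> < d \<Longrightarrow> (U t \<sigma> - U s \<sigma>) / (t - s) > - e"
      unfolding eventually_at by (auto simp: dist_real_def)
    show ?thesis
    proof (intro exI[of _ "min d (\<sigma> - s)"] conjI ballI)
      fix t assume t: "t \<in> {s<..<s + min d (\<sigma> - s)}"
      then have "(U t \<sigma> - U s \<sigma>) / (t - s) > - e" using d(2)[of t] by auto
      then have "U t \<sigma> - U s \<sigma> > - e * (t - s)"
        using t by (simp add: pos_less_divide_eq)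
      moreover have "U t \<sigma> \<le> m t" using mge[of t \<sigma>] t \<sigma>1 by auto
      ultimately show "m s - e * (t - s) \<le> m t" using \<sigma>U by linarith
    qed (use d \<sigma>1 in auto)
  qed
  have mono: "m a \<le> m b" if ab: "a < b" for a b
  proof (rule ccontr)
    assume "\<not> m a \<le> m b"
    then have gt: "m a > m b" by simp
    \<comment> \<open>Half the average slope of the supposed drop.\<close>
    define e where "e = (m a - m b) / (2 * (b - a))"
    have e: "e > 0" using gt ab by (auto simp: e_def)
    have eb: "m b + e * (b - a) < m a"
    proof -
      have "e * (b - a) = (m a - m b) / 2"
        using nonzero_mult_divide_mult_cancel_right[of "b - a" "m a - m b" 2] ab by (simp add: e_def)
      then show ?thesis using gt by (simp add: field_simps)
    qed
    \<comment> \<open>Continuity of \<open>m\<close> is avoided: the set of \<open>t\<close> with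
      \<open>m t + e * (t - a) \<ge> m a\<close> is compact as the projection of this compact
      set.\<close>
    define Q where "Q = {p \<in> {a..b} \<times> {0..L}. m a \<le> U (fst p) (fst p + snd p) + e * (fst p - a)}"
    have "continuous_on UNIV (\<lambda>p::real\<times>real. U (fst p) (fst p + snd p))"
      using continuous_on_compose2[OF cont, of UNIV "\<lambda>p. (fst p, fst p + snd p)"]
      by (simp add: continuous_on_Pair continuous_on_add continuous_on_fst continuous_on_snd)
    then have "closed {p. m a \<le> U (fst p) (fst p + snd p) + e * (fst p - a)}"
      by (intro closed_Collect_le continuous_intros)
    then have "compact Q"
      unfolding Q_def Collect_conj_eq
      by (auto intro!: compact_Int_closed compact_Times simp: Collect_mem_eq)
    then have cS: "compact (fst ` Q)"
      by (intro compact_continuous_image continuous_intros)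
    have Siff: "t \<in> fst ` Q \<longleftrightarrow> t \<in> {a..b} \<and> m a \<le> m t + e * (t - a)" for t
    proof
      assume "t \<in> fst ` Q"
      then obtain r where "t \<in> {a..b}" "r \<in> {0..L}" "m a \<le> U t (t + r) + e * (t - a)"
        by (auto simp: Q_def)
      then show "t \<in> {a..b} \<and> m a \<le> m t + e * (t - a)"
        using mge[of t "t + r"] by auto
    next
      assume "t \<in> {a..b} \<and> m a \<le> m t + e * (t - a)"
      then have "(t, \<tau> t - t) \<in> Q" using \<tau>[of t] by (auto simp: Q_def m_def)
      then show "t \<in> fst ` Q" by force
    qed
    have "a \<in> fst ` Q" using ab by (auto simp: Siff)
    then obtain t where t: "t \<in> fst ` Q" and tmax: "\<And>r. r \<in> fst ` Q \<Longrightarrow> r \<le> t"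
      using compact_attains_sup[OF cS] by auto
    have "t \<noteq> b" using t eb by (auto simp: Siff)
    then have tb: "a \<le> t" "t < b" using t by (auto simp: Siff)
    obtain d where d: "d > 0" "\<And>r. r \<in> {t<..<t+d} \<Longrightarrow> m r \<ge> m t - e * (r - t)"
      using loc[OF e] by blast
    define r where "r = (t + min b (t + d)) / 2"
    have r: "r \<in> {t<..<t+d}" "r < b" using tb d(1) by (auto simp: r_def min_def field_simps)
    have "m a \<le> m r + e * (r - a)"
      using d(2)[OF r(1)] t by (auto simp: Siff algebra_simps)
    then have "r \<in> fst ` Q" using r tb by (auto simp: Siff)
    then show False using tmax[of r] r by auto
  qed
  have mper: "m (s + L) = m s" for s
  proof (rule antisym)
    have "m (s + L) = U s (\<tau> (s + L) - L)"
      using per[of s "\<tau> (s + L) - L"] by (simp add: m_def)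
    then show "m (s + L) \<le> m s" using mge[of s "\<tau> (s+L) - L"] \<tau>[of "s + L"] by auto
    show "m s \<le> m (s + L)" using mono[of s "s + L"] L by simp
  qed
  have const: "m s = m 0" for s
  proof -
    have step: "m (s + real n * L) = m s" for n s
    proof (induction n)
      case (Suc n)
      have "s + real (Suc n) * L = (s + real n * L) + L" by (simp add: algebra_simps)
      then show ?case using Suc mper[of "s + real n * L"] by presburger
    qed simp
    have le: "m s \<le> m t" for s t
    proof -
      obtain n where "real n * L > s - t" using reals_Archimedean3[OF L] by blast
      then show ?thesis using mono[of s "t + real n * L"] step[of t n] by auto
    qed
    show ?thesis using le by (simp add: antisym)
  qed
  show ?thesis
  proof (intro exI[of _ "m 0"] conjI allI impI)
    show "U s t \<le> m 0" if "s \<le> t \<and> t \<le> s + L" for s t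
      using mge[of s t] const[of s] that by auto
    show "\<exists>t\<in>{s..s+L}. U s t = m 0" for s
      using \<tau>[of s] const[of s] by (auto simp: m_def)
  qed (rule m0)
qed

lemma at_right_le_at: "at_right (x::real) \<le> at x" and at_left_le_at: "at_left (x::real) \<le> at x"
  by (auto intro: at_le)

section \<open>Chords passing the caustic region on one side\<close>

context caustic
begin

text \<open>The oriented chord passes with all of \<open>C\<close> on its left. This is the
  condition \<open>P\<close> of the row lemma: while it holds, the action grows with
  \<open>t\<close>.\<close>

definition lefts :: "real \<Rightarrow> real \<Rightarrow> bool" where
  "lefts s t \<longleftrightarrow> (\<forall>z\<in>C. 0 \<le> det3 (c s) (c t) z)"

text \<open>Left of the chord means a smaller cosine seen from its start. If the chord is tangent to
  the boundary at \<open>c s\<close>, the reference point in \<open>C\<close> shows that it points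
  forwards.\<close>

lemma lefts_start:
  assumes st: "s < t" "t < s + L" and left: "lefts s t" and z: "z \<in> C" "z \<noteq> c s"
  shows "cosang s z \<le> cosang s (c t)"
proof (cases "0 < sinang s (c t)")
  case True
  then show ?thesis
    using left z C c_K c_ne'[OF st] by (intro cosang_le_if_det3_nonneg) (auto simp: lefts_def)
next
  case False
  note zero = sinang_zero[OF c_K c_ne'[OF st] False]
  have "cosang s (c t) \<noteq> -1"
  proof
    assume m: "cosang s (c t) = -1"
    obtain w where w: "w \<in> C" "\<And>s. w \<noteq> c s" "\<And>s. 0 < sinang s w" using C_point by blast
    have wK: "w \<in> K" using w C by auto
    have "det3 (c s) (c t) w < 0"
      unfolding det3_ang[OF c_K c_ne'[OF st] wK w(2)] zero(1) m
      using sn_c(1)[OF c_K c_ne'[OF st]] sn_c(1)[OF wK w(2), of s] w(3)[of s]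
      by (simp add: mult_less_0_iff zero_less_mult_iff)
    then show False using left w by (auto simp: lefts_def dest!: bspec[of _ _ w])
  qed
  then show ?thesis using zero(2) ang(5)[of z s] z C by auto
qed

lemma lefts_end:
  assumes st: "s < t" "t < s + L" and left: "lefts s t" and z: "z \<in> C" "z \<noteq> c t"
  shows "cosang t (c s) \<le> cosang t z"
proof (cases "0 < sinang t (c s)")
  case True
  have "0 \<le> det3 (c t) z (c s)" using left z det3_rotate[of "c s" "c t" z] by (auto simp: lefts_def)
  then show ?thesis
    using True z C c_K c_ne[OF st] by (intro cosang_le_if_det3_nonneg) auto
next
  case False
  note zero = sinang_zero[OF c_K c_ne[OF st] False]
  have "cosang t (c s) \<noteq> 1"
  proof
    assume m: "cosang t (c s) = 1"
    obtain w where w: "w \<in> C" "\<And>s. w \<noteq> c s" "\<And>s. 0 < sinang s w" using C_point by blast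
    have wK: "w \<in> K" using w C by auto
    have "det3 (c t) w (c s) < 0"
      unfolding det3_ang[OF wK w(2) c_K c_ne[OF st]] zero(1) m
      using sn_c(1)[OF c_K c_ne[OF st]] sn_c(1)[OF wK w(2), of t] w(3)[of t]
      by (simp add: mult_less_0_iff zero_less_mult_iff)
    then show False using left w det3_rotate[of "c s" "c t" w] by (auto simp: lefts_def dest!: bspec[of _ _ w])
  qed
  then show ?thesis using zero(2) ang(5)[of z t] z C by auto
qed

text \<open>Moving the end point back turns the chord to the right, away from
  \<open>C\<close>.\<close>

lemma lefts_shrink_right:
  assumes "s < r" "r < t" "t < s + L" "lefts s t" shows "lefts s r"
  unfolding lefts_def
proof
  fix z assume z: "z \<in> C"
  show "0 \<le> det3 (c s) (c r) z"
  proof (cases "z = c s")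
    case False
    have "cosang s z \<le> cosang s (c t)" using lefts_start[of s t z] assms z False by simp
    also have "\<dots> \<le> cosang s (c r)" using cosang_antitone[of s r t] assms by simp
    finally show ?thesis
      using assms z False C c_K c_ne'[of s r] by (intro det3_nonneg_if_cosang_le) auto
  qed simp
qed

text \<open>A shift by one period puts the moving points after the base point
  \<open>t\<close>.\<close>

lemma cosang_antitone':
  assumes "t < s + L" "s \<le> r" "r < t"
  shows "cosang t (c r) \<le> cosang t (c s)"
  using cosang_antitone[of t "s + L" "r + L"] assms by (simp add: c_period)

lemma lefts_shrink_left:
  assumes "s < r" "r < t" "t < s + L" "lefts s t" shows "lefts r t"
  unfolding lefts_def
proof
  fix z assume z: "z \<in> C"
  have "0 \<le> det3 (c t) z (c r)"
  proof (cases "z = c t")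
    case False
    have "cosang t (c r) \<le> cosang t (c s)" using cosang_antitone'[of t s r] assms by simp
    also have "\<dots> \<le> cosang t z" using lefts_end[of s t z] assms z False by simp
    finally show ?thesis
      using assms z False C c_K c_ne[of r t] by (intro det3_nonneg_if_cosang_le) auto
  qed simp
  then show "0 \<le> det3 (c r) (c t) z" by (simp only: det3_rotate[of "c r" "c t" z])
qed

lemma cosang_isCont:
  assumes "y \<in> K" "y \<noteq> c s" shows "isCont (\<lambda>r. cosang r y) s"
proof -
  have "isCont (\<lambda>r. form G (velocity c r) y) s" "isCont (\<lambda>r. sn G (c r) y) s"
    using continuous_on_form[OF v_cont[of UNIV] continuous_on_const[of UNIV y]]
      continuous_on_sn[OF c_cont[of UNIV] continuous_on_const[of UNIV y]]
    by (auto simp: continuous_on_eq_continuous_at)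
  then show ?thesis unfolding cosang_def
    using sn_c(1)[OF assms] by (intro continuous_intros) auto
qed

lemma cosang_isCont2:
  assumes "c t \<noteq> c s" shows "isCont (\<lambda>t. cosang s (c t)) t"
proof -
  have "isCont (\<lambda>r. form G (velocity c s) (c r)) t" "isCont (\<lambda>r. sn G (c s) (c r)) t"
    using continuous_on_form[OF continuous_on_const[of UNIV "velocity c s"] c_cont[of UNIV]]
      continuous_on_sn[OF continuous_on_const[of UNIV "c s"] c_cont[of UNIV]]
    by (auto simp: continuous_on_eq_continuous_at)
  then show ?thesis unfolding cosang_def
    using sn_c(1)[OF c_K assms] by (intro continuous_intros) auto
qed

text \<open>At a touching point \<open>tcos\<close> is 1 by definition, so the chord has to leave
  tangentially. Otherwise boundary points just after \<open>s\<close> either belong to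
  \<open>C\<close> and lie on the wrong side of the chord, or lie outside \<open>C\<close> and see
  it under a cosine close to 1, although the shortened chord still has \<open>C\<close> on its
  left.\<close>

lemma lefts_tcos_start:
  assumes st: "s < t" "t < s + L" and left: "lefts s t"
  shows "tcos s \<le> cosang s (c t)"
proof (cases "c s \<in> C")
  case False
  obtain z where z: "z \<in> C" "cosang s z = tcos s" using tcos_attained[OF False] by blast
  then have "z \<noteq> c s" using False by auto
  then show ?thesis using lefts_start[OF st left z(1)] z(2) by simp
next
  case True
  show ?thesis
  proof (rule ccontr)
    assume n: "\<not> tcos s \<le> cosang s (c t)"
    have t1: "tcos s = 1" using True by (simp add: tcos_def)
    define m where "m = (1 + cosang s (c t)) / 2"
    have m: "cosang s (c t) < m" "m < 1" using n t1 by (auto simp: m_def)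
    have "\<forall>\<^sub>F r in at s. cosang r (c t) < m"
      using cosang_isCont[OF c_K c_ne'[OF st]] m unfolding isCont_def by (auto intro: order_tendstoD)
    moreover have "\<forall>\<^sub>F r in at s. m < tcos r"
      using tcos_cont[of s] m t1 unfolding isCont_def by (auto intro: order_tendstoD)
    moreover have "\<forall>\<^sub>F r in at s. m < cosang s (c r) * sgn (r - s)"
      using cosang_limit[of s] m by (auto intro: order_tendstoD)
    ultimately have "\<forall>\<^sub>F r in at_right s. cosang r (c t) < m \<and> m < tcos r \<and> m < cosang s (c r) * sgn (r - s)"
      unfolding eventually_conj_iff using filter_leD[OF at_right_le_at] by blast
    moreover have "\<forall>\<^sub>F r in at_right s. s < r \<and> r < t"
      using st unfolding eventually_at_right_field by (intro exI[of _ t]) auto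
    ultimately have "\<forall>\<^sub>F r in at_right s. (cosang r (c t) < m \<and> m < tcos r \<and> m < cosang s (c r) * sgn (r - s)) \<and> s < r \<and> r < t"
      by (rule eventually_conj)
    then obtain r where r: "cosang r (c t) < m" "m < tcos r" "m < cosang s (c r) * sgn (r - s)" "s < r" "r < t"
      using eventually_happens'[OF trivial_limit_at_right_real] by blast
    show False
    proof (cases "c r \<in> C")
      case True
      then have "cosang s (c r) \<le> cosang s (c t)"
        using lefts_start[OF st left] c_ne'[of s r] r st by auto
      then show False using r m by simp
    next
      case False
      obtain z where z: "z \<in> C" "cosang r z = tcos r" using tcos_attained[OF False] by blast
      then have "z \<noteq> c r" using False by auto
      moreover have "lefts r t" using lefts_shrink_left r st left by blast
      ultimately have "tcos r \<le> cosang r (c t)" using lefts_start[of r t z] r st z by simp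
      then show False using r by simp
    qed
  qed
qed

lemma lefts_tcos_end:
  assumes st: "s < t" "t < s + L" and left: "lefts s t"
  shows "tcos t \<le> - cosang t (c s)"
proof (cases "c t \<in> C")
  case False
  obtain z where z: "z \<in> C" "cosang t z = - tcos t" using tcos_attained[OF False] by blast
  then have "z \<noteq> c t" using False by auto
  then show ?thesis using lefts_end[OF st left z(1)] z(2) by simp
next
  case True
  show ?thesis
  proof (rule ccontr)
    assume n: "\<not> tcos t \<le> - cosang t (c s)"
    have t1: "tcos t = 1" using True by (simp add: tcos_def)
    define m where "m = (1 - cosang t (c s)) / 2"
    have m: "- cosang t (c s) < m" "m < 1" using n t1 by (auto simp: m_def field_simps)
    have "((\<lambda>r. - cosang r (c s)) \<longlongrightarrow> - cosang t (c s)) (at t)"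
      using cosang_isCont[OF c_K c_ne[OF st]] unfolding isCont_def by (rule tendsto_minus)
    then have "\<forall>\<^sub>F r in at t. - cosang r (c s) < m"
      using m by (auto intro: order_tendstoD)
    moreover have "\<forall>\<^sub>F r in at t. m < tcos r"
      using tcos_cont[of t] m t1 unfolding isCont_def by (auto intro: order_tendstoD)
    moreover have "\<forall>\<^sub>F r in at t. m < cosang t (c r) * sgn (r - t)"
      using cosang_limit[of t] m by (auto intro: order_tendstoD)
    ultimately have "\<forall>\<^sub>F r in at_left t. - cosang r (c s) < m \<and> m < tcos r \<and> m < cosang t (c r) * sgn (r - t)"
      unfolding eventually_conj_iff using filter_leD[OF at_left_le_at] by blast
    moreover have "\<forall>\<^sub>F r in at_left t. s < r \<and> r < t"
      using st unfolding eventually_at_left_field by (intro exI[of _ s]) auto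
    ultimately have "\<forall>\<^sub>F r in at_left t. (- cosang r (c s) < m \<and> m < tcos r \<and> m < cosang t (c r) * sgn (r - t)) \<and> s < r \<and> r < t"
      by (rule eventually_conj)
    then obtain r where r: "- cosang r (c s) < m" "m < tcos r" "m < cosang t (c r) * sgn (r - t)" "s < r" "r < t"
      using eventually_happens'[OF trivial_limit_at_left_real] by blast
    show False
    proof (cases "c r \<in> C")
      case True
      then have "cosang t (c s) \<le> cosang t (c r)"
        using lefts_end[OF st left] c_ne[of r t] r st by auto
      then show False using r m by simp
    next
      case False
      obtain z where z: "z \<in> C" "cosang r z = - tcos r" using tcos_attained[OF False] by blast
      then have "z \<noteq> c r" using False by auto
      moreover have "lefts s r" using lefts_shrink_right r st left by blast
      ultimately have "cosang r (c s) \<le> - tcos r" using lefts_end[of s r z] r st z by simp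
      then show False using r by simp
    qed
  qed
qed

text \<open>A point of \<open>C\<close> strictly right of the chord has a larger cosine than
  \<open>c t\<close> at the start and a smaller one than \<open>c s\<close> at the end;
  \<open>tcos\<close> bounds its absolute value.\<close>

lemma not_lefts_tcos:
  assumes st: "s < t" "t < s + L" and left: "\<not> lefts s t"
  shows "cosang s (c t) \<le> tcos s" "- cosang t (c s) \<le> tcos t"
proof -
  obtain z where z: "z \<in> C" "det3 (c s) (c t) z < 0" using left by (auto simp: lefts_def not_le)
  have zK: "z \<in> K" using z C by auto
  have ne: "z \<noteq> c s" "z \<noteq> c t" using z(2) by auto
  show "cosang s (c t) \<le> tcos s"
  proof (cases "c s \<in> C")
    case True
    then show ?thesis using ang(5)[OF c_K c_ne'[OF st]] by (simp add: tcos_def)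
  next
    case False
    have "cosang s (c t) < cosang s z" using cosang_less_if_det3_neg[OF c_K c_ne'[OF st] zK ne(1) z(2)] .
    then show ?thesis using tcos_bounds[OF False z(1)] by linarith
  qed
  show "- cosang t (c s) \<le> tcos t"
  proof (cases "c t \<in> C")
    case True
    then show ?thesis using ang(5)[OF c_K c_ne[OF st]] by (simp add: tcos_def)
  next
    case False
    have "det3 (c t) z (c s) < 0" using z(2) by (simp only: det3_rotate[of "c s" "c t" z])
    then have "cosang t z < cosang t (c s)" using cosang_less_if_det3_neg[OF zK ne(2) c_K c_ne[OF st]] by blast
    then show ?thesis using tcos_bounds[OF False z(1)] by linarith
  qed
qed

section \<open>The action and the common value of its row and column maxima\<close>

definition tpot :: "real \<Rightarrow> real" where
  "tpot = (SOME F. \<forall>t. (F has_real_derivative tcos t) (at t))"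

lemma tpot_deriv: "(tpot has_real_derivative tcos t) (at t)"
proof -
  have "\<exists>F. \<forall>x. - \<infinity> < ereal x \<longrightarrow> ereal x < \<infinity> \<longrightarrow> (F has_vector_derivative tcos x) (at x)"
    by (rule einterval_antiderivative) (auto intro: tcos_cont)
  then have "\<exists>F. \<forall>t. (F has_real_derivative tcos t) (at t)"
    by (simp add: has_real_derivative_iff_has_vector_derivative)
  then show ?thesis unfolding tpot_def using someI_ex[of "\<lambda>F. \<forall>t. (F has_real_derivative tcos t) (at t)"] by blast
qed

lemma tpot_cont: "continuous_on A tpot"
  by (intro continuous_at_imp_continuous_on ballI DERIV_isCont[OF tpot_deriv])

lemma tpot_period: "tpot (t + L) - tpot t = tpot (s + L) - tpot s"
proof -
  have "((\<lambda>t. tpot (t + L) - tpot t) has_real_derivative 0) (at t)" for t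
  proof -
    have "((\<lambda>t. tpot (t + L)) has_real_derivative tcos (t + L)) (at t)"
      using tpot_deriv[of "t + L"] by (simp add: DERIV_shift)
    then show ?thesis using DERIV_diff[OF _ tpot_deriv, of "\<lambda>t. tpot (t + L)" "tcos (t + L)" t]
      by (simp add: tcos_period)
  qed
  then show ?thesis using DERIV_isconst_all by blast
qed

text \<open>For a smooth caustic, \<open>action s t\<close> with \<open>c t\<close> on a tangent line through \<open>c s\<close> is the string
  length: the two tangents at a boundary point minus the arc of the caustic between them.\<close>

definition action :: "real \<Rightarrow> real \<Rightarrow> real" where
  "action s t = gdist G (c s) (c t) - (tpot t - tpot s)"

text \<open>\<open>- cosang t (c s)\<close> is the cosine at which the chord arrives at
  \<open>c t\<close>, so the derivative compares the angle of the chord with that of the tangent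
  lines to \<open>C\<close>.\<close>

lemma action_deriv_end:
  assumes "s < t" "t < s + L"
  shows "(action s has_real_derivative - cosang t (c s) - tcos t) (at t)"
proof -
  have "((\<lambda>t. gdist G (c t) (c s)) has_real_derivative - cosang t (c s)) (at t)"
    unfolding cosang_def by (rule gdist_has_derivative[OF c_deriv c_surf c_surf]) (use c_ne[OF assms] in auto)
  then have "((\<lambda>t. gdist G (c t) (c s) - (tpot t - tpot s)) has_real_derivative - cosang t (c s) - (tcos t - 0)) (at t)"
    by (intro DERIV_diff tpot_deriv DERIV_const)
  moreover have "action s = (\<lambda>t. gdist G (c t) (c s) - (tpot t - tpot s))"
    using gdist_facts(5)[OF c_surf c_surf] by (auto simp: action_def)
  ultimately show ?thesis by simp
qed

lemma action_deriv_start: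
  assumes "s < t" "t < s + L"
  shows "((\<lambda>r. action r t) has_real_derivative - cosang s (c t) + tcos s) (at s)"
proof -
  have "((\<lambda>r. gdist G (c r) (c t)) has_real_derivative - cosang s (c t)) (at s)"
    unfolding cosang_def by (rule gdist_has_derivative[OF c_deriv c_surf c_surf]) (use c_ne[OF assms] in auto)
  then have "((\<lambda>r. gdist G (c r) (c t) - (tpot t - tpot r)) has_real_derivative - cosang s (c t) - (0 - tcos s)) (at s)"
    by (intro DERIV_diff tpot_deriv DERIV_const)
  then show ?thesis by (simp add: action_def)
qed

lemma action_cont: "continuous_on A (\<lambda>p. action (f p) (g p))"
  if "continuous_on A f" "continuous_on A g" for f g :: "'a::t2_space \<Rightarrow> real"
  unfolding action_def
  by (intro continuous_intros continuous_on_compose2[OF c_cont[of UNIV]]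
      continuous_on_compose2[OF tpot_cont[of UNIV]] that) (auto simp: c_surf)

lemma action_diag: "action s s = 0"
  by (simp add: action_def c_surf)

text \<open>The chord has shrunk to a point while the integral of a positive cosine remains.\<close>

lemma action_full: "action s (s + L) \<le> 0"
proof -
  have "tpot s \<le> tpot (s + L)"
    using L tpot_deriv tcos_pos by (intro DERIV_nonneg_imp_nondecreasing[where f = tpot]) (auto intro: less_imp_le)
  then show ?thesis by (simp add: action_def c_period c_surf)
qed

lemma action_period: "action (s + L) (t + L) = action s t"
  using tpot_period[of t s] by (simp add: action_def c_period)

text \<open>The row lemma gives a constant maximum over the end point. Reversing the boundary,
  \<open>U s t = action (- t) (- s)\<close>, gives one over the start point, and both are the
  maximum of the action over the same strip.\<close>

lemma action_max:
  obtains M where "M \<ge> 0" "\<And>s t. s \<le> t \<Longrightarrow> t \<le> s + L \<Longrightarrow> action s t \<le> M"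
    "\<And>s. \<exists>t\<in>{s..s+L}. action s t = M" "\<And>t. \<exists>s\<in>{t-L..t}. action s t = M"
proof -
  have "\<exists>M\<ge>0. (\<forall>s t. s \<le> t \<and> t \<le> s + L \<longrightarrow> action s t \<le> M) \<and> (\<forall>s. \<exists>t\<in>{s..s+L}. action s t = M)"
  proof (rule row_maximum_constant[where P = lefts and dU = "\<lambda>s t. - cosang s (c t) + tcos s", OF L])
    show "continuous_on UNIV (\<lambda>p. action (fst p) (snd p))"
      by (intro action_cont continuous_intros)
    show "\<exists>d\<ge>0. (action s has_real_derivative d) (at t)" if "s < t" "t < s + L" "lefts s t" for s t
      using action_deriv_end[OF that(1,2)] lefts_tcos_end[OF that] by (intro exI[of _ "- cosang t (c s) - tcos t"]) auto
    show "isCont (\<lambda>t. - cosang s (c t) + tcos s) t" if "s < t" "t < s + L" for s t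
      using cosang_isCont2[OF c_ne'[OF that]] by (intro continuous_intros)
    show "0 \<le> - cosang s (c t) + tcos s" if "s < t" "t < s + L" "\<not> lefts s t" for s t
      using not_lefts_tcos(1)[OF that] by simp
  qed (use action_period action_diag action_full action_deriv_start lefts_shrink_right in auto)
  then obtain M where M: "M \<ge> 0" "\<And>s t. s \<le> t \<Longrightarrow> t \<le> s + L \<Longrightarrow> action s t \<le> M"
    "\<And>s. \<exists>t\<in>{s..s+L}. action s t = M" by auto
  define U where "U s t = action (- t) (- s)" for s t
  have "\<exists>M\<ge>0. (\<forall>s t. s \<le> t \<and> t \<le> s + L \<longrightarrow> U s t \<le> M) \<and> (\<forall>s. \<exists>t\<in>{s..s+L}. U s t = M)"
  proof (rule row_maximum_constant[where P = "\<lambda>s t. lefts (- t) (- s)"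
        and dU = "\<lambda>s t. cosang (- s) (c (- t)) + tcos (- s)", OF L])
    show "continuous_on UNIV (\<lambda>p. U (fst p) (snd p))"
      unfolding U_def by (intro action_cont continuous_intros)
    show "U (s + L) (t + L) = U s t" for s t
      using action_period[of "- (t + L)" "- (s + L)"] by (simp add: U_def)
    show "U s s = 0" for s by (simp add: U_def action_diag)
    show "U s (s + L) \<le> 0" for s using action_full[of "- (s + L)"] by (simp add: U_def)
    show "\<exists>d\<ge>0. (U s has_real_derivative d) (at t)" if "s < t" "t < s + L" "lefts (- t) (- s)" for s t
    proof -
      have st: "- t < - s" "- s < - t + L" using that by auto
      have "((\<lambda>t. action (- t) (- s)) has_real_derivative (- cosang (- t) (c (- s)) + tcos (- t)) * - 1) (at t)"
        by (rule DERIV_chain2[where f = "\<lambda>r. action r (- s)" and g = uminus, OF action_deriv_start[OF st]])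
          (auto intro!: derivative_eq_intros)
      then show ?thesis using lefts_tcos_start[OF st that(3)] unfolding U_def[abs_def]
        by (intro exI[of _ "(- cosang (- t) (c (- s)) + tcos (- t)) * - 1"]) auto
    qed
    show "((\<lambda>r. U r t) has_real_derivative cosang (- s) (c (- t)) + tcos (- s)) (at s)"
      if "s < t" "t < s + L" for s t
    proof -
      have st: "- t < - s" "- s < - t + L" using that by auto
      have "((\<lambda>s. action (- t) (- s)) has_real_derivative (- cosang (- s) (c (- t)) - tcos (- s)) * - 1) (at s)"
        by (rule DERIV_chain2[where f = "action (- t)" and g = uminus, OF action_deriv_end[OF st]])
          (auto intro!: derivative_eq_intros)
      then show ?thesis by (simp add: U_def add.commute)
    qed
    show "isCont (\<lambda>t. cosang (- s) (c (- t)) + tcos (- s)) t" if "s < t" "t < s + L" for s t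
    proof -
      have "isCont (\<lambda>t. cosang (- s) (c t)) (- t)"
        using that by (intro cosang_isCont2 c_ne) auto
      moreover have "isCont uminus t" by (intro continuous_intros)
      ultimately have "isCont (\<lambda>t. cosang (- s) (c (- t))) t"
        using isCont_o2[of t uminus "\<lambda>t. cosang (- s) (c t)"] by simp
      then show ?thesis by (intro continuous_intros)
    qed
    show "0 \<le> cosang (- s) (c (- t)) + tcos (- s)" if "s < t" "t < s + L" "\<not> lefts (- t) (- s)" for s t
      using not_lefts_tcos(2)[of "- t" "- s"] that by simp
    show "lefts (- r) (- s)" if "s < r" "r < t" "t < s + L" "lefts (- t) (- s)" for s r t
      using lefts_shrink_left[of "- t" "- r" "- s"] that by simp
  qed
  then obtain M' where M': "\<And>s t. s \<le> t \<Longrightarrow> t \<le> s + L \<Longrightarrow> U s t \<le> M'"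
    "\<And>s. \<exists>t\<in>{s..s+L}. U s t = M'" by auto
  have "M' = M"
  proof (rule antisym)
    obtain t where "t \<in> {0..0+L}" "U 0 t = M'" using M'(2) by blast
    then show "M' \<le> M" using M(2)[of "- t" 0] by (simp add: U_def)
    obtain t where "t \<in> {0..0+L}" "action 0 t = M" using M(3) by blast
    then show "M \<le> M'" using M'(1)[of "- t" 0] by (simp add: U_def)
  qed
  have "\<exists>s\<in>{t-L..t}. action s t = M" for t
  proof -
    obtain r where "r \<in> {-t..-t+L}" "U (- t) r = M" using M'(2)[of "- t"] \<open>M' = M\<close> by blast
    then show ?thesis by (intro bexI[of _ "- r"]) (auto simp: U_def)
  qed
  then show ?thesis using that M by blast
qed

end

section \<open>Trigonometric estimates\<close>

text \<open>\<open>a\<close> and \<open>b\<close> are the chords at a vertex of a trajectory,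
  \<open>2 * d\<close> is their sum minus the chord joining the far ends, and \<open>w\<close> is
  the squared sine of the angle. \<open>t1\<close>, \<open>t2\<close> are the parts of a tangent
  chord, \<open>h\<close> is the perpendicular to the arc, and \<open>r1\<close>, \<open>r2\<close>
  are the hypotenuses given by Pythagoras. All of \<open>a\<close>, \<open>b\<close> and the
  relevant \<open>t\<close> are enlarged to \<open>D\<close>; for large \<open>d\<close> the bound
  \<open>2 * \<rho> \<le> D\<close> suffices.\<close>

lemma hyperbolic_estimate:
  fixes D a b d w :: real
  assumes a: "0 < a" "a \<le> D" and b: "0 < b" "b \<le> D" and d: "0 \<le> d" "d \<le> a" "d \<le> b"
    and eq: "sinh d * sinh (a + b - d) = w * sinh a * sinh b"
    and t: "0 < t1" "t1 \<le> D" "0 < t2" "t2 \<le> D"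
    and r: "cosh r1 = cosh h * cosh t1" "cosh r2 = cosh h * cosh t2" "0 \<le> r1" "0 \<le> r2"
    and M: "r1 + r2 - (t1 + t2) \<le> 2 * d"
    and rho: "0 \<le> \<rho>" "\<rho> \<le> h" "2 * \<rho> \<le> D"
  shows "(tanh \<rho>)\<^sup>2 \<le> 2 * w * (sinh D)\<^sup>2 / cosh D"
proof -
  have D: "D > 0" using a by simp
  have sD: "sinh D > 0" using D by simp
  \<comment> \<open>Says that \<open>sinh (u + x) / sinh u\<close> decreases in \<open>u\<close>, so
    that \<open>a\<close> and afterwards \<open>b\<close> may be replaced by
    \<open>D\<close>.\<close>
  have enlarge: "sinh u * sinh (D + x) \<le> sinh (u + x) * sinh D" if "0 \<le> x" "u \<le> D" for u x :: real
  proof -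
    have "sinh (u + x) * sinh D - sinh u * sinh (D + x) = sinh x * sinh (D - u)"
      unfolding sinh_add sinh_diff using hyperbolic_pythagoras[of x]
      by (simp add: algebra_simps power2_eq_square)
    moreover have "sinh x * sinh (D - u) \<ge> 0" using that by simp
    ultimately show ?thesis by linarith
  qed
  have s1: "sinh d * sinh (2 * D - d) \<le> w * (sinh D)\<^sup>2"
  proof -
    have "sinh a * (sinh d * sinh (D + (b - d))) \<le> sinh d * (sinh (a + (b - d)) * sinh D)"
      using mult_left_mono[OF enlarge[of "b - d" a], of "sinh d"] a d by (simp add: ac_simps)
    also have "\<dots> = sinh a * (w * sinh b * sinh D)"
      using eq by (simp add: algebra_simps)
    finally have 1: "sinh d * sinh (D + (b - d)) \<le> w * sinh b * sinh D"
      using a by simp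
    have "sinh b * (sinh d * sinh (D + (D - d))) \<le> sinh d * (sinh (b + (D - d)) * sinh D)"
      using mult_left_mono[OF enlarge[of "D - d" b], of "sinh d"] b d by (simp add: ac_simps)
    also have "\<dots> = sinh d * sinh (D + (b - d)) * sinh D"
      by (simp add: algebra_simps)
    also have "\<dots> \<le> w * sinh b * sinh D * sinh D"
      using 1 sD by (intro mult_right_mono) auto
    finally have "sinh b * (sinh d * sinh (D + (D - d))) \<le> sinh b * (w * (sinh D)\<^sup>2)"
      by (simp add: algebra_simps power2_eq_square)
    then show ?thesis using b by simp
  qed
  define y where "y = w * (sinh D)\<^sup>2 / cosh D"
  have yC: "cosh D * y = w * (sinh D)\<^sup>2" by (simp add: y_def)
  show ?thesis
  \<comment> \<open>The threshold is equivalent to \<open>D + d/2 \<le> 2 * D - d\<close>, which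
    compares the increment of \<open>cosh\<close> at \<open>D\<close> with the left side of
    \<open>s1\<close>.\<close>
  proof (cases "3 * d \<le> 2 * D")
    case True
    have "cosh h * cosh D \<le> cosh (D + d)"
    proof -
      \<comment> \<open>One of the two triangles has excess at most \<open>d\<close>. As
        \<open>cosh (t + d) / cosh t\<close> increases in \<open>t\<close>, its leg may be replaced
        by \<open>D\<close>.\<close>
      have main: "cosh h * cosh D \<le> cosh (D + d)"
        if "cosh q = cosh h * cosh t" "0 < t" "t \<le> D" "0 \<le> q" "q \<le> t + d" for q t
      proof -
        have "cosh (D + d) * cosh t - cosh (t + d) * cosh D = sinh d * sinh (D - t)"
          unfolding cosh_add sinh_diff by (simp add: algebra_simps)
        moreover have "sinh d * sinh (D - t) \<ge> 0" using d that by simp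
        moreover have "cosh h * cosh t \<le> cosh (t + d)"
          using that by (metis cosh_real_nonneg_le_iff order_trans)
        then have "(cosh h * cosh D) * cosh t \<le> cosh (t + d) * cosh D"
          using mult_right_mono[of _ _ "cosh D"] by (simp add: ac_simps)
        ultimately have "(cosh h * cosh D) * cosh t \<le> cosh (D + d) * cosh t" by linarith
        then show ?thesis by simp
      qed
      have "r1 \<le> t1 + d \<or> r2 \<le> t2 + d" using M by linarith
      then show ?thesis using main r t by blast
    qed
    also have "cosh (D + d) \<le> cosh D + sinh d * sinh (2 * D - d)"
    proof -
      have 1: "cosh (D + d) - cosh D = 2 * sinh (D + d/2) * sinh (d/2)"
      proof -
        have "cosh ((D + d/2) + d/2) - cosh ((D + d/2) - d/2) = 2 * sinh (D + d/2) * sinh (d/2)"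
          by (simp only: cosh_add cosh_diff)
        then show ?thesis by (simp add: add.commute)
      qed
      have 2: "sinh d = 2 * sinh (d/2) * cosh (d/2)" using sinh_double[of "d/2"] by simp
      have "sinh (D + d/2) \<le> sinh (2 * D - d)" using True by simp
      also have "\<dots> \<le> cosh (d/2) * sinh (2 * D - d)"
        using mult_right_mono[of 1 "cosh (d/2)" "sinh (2 * D - d)"] cosh_real_ge_1 a d by simp
      finally have "2 * sinh (d/2) * sinh (D + d/2) \<le> 2 * sinh (d/2) * (cosh (d/2) * sinh (2 * D - d))"
        using d by (intro mult_left_mono) auto
      then show ?thesis using 1 2 by (simp add: algebra_simps)
    qed
    also have "\<dots> \<le> cosh D * (1 + y)" using s1 yC by (simp add: algebra_simps)
    finally have X: "cosh h \<le> 1 + y" by (simp add: mult.commute)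
    have "cosh \<rho> \<le> 1 + y" using X rho by (metis cosh_real_nonneg_le_iff order_trans)
    then have c2: "(cosh \<rho>)\<^sup>2 \<le> (1 + y)\<^sup>2" by (intro power_mono) auto
    have y0: "y \<ge> 0" using X cosh_real_ge_1[of h] by simp
    \<comment> \<open>Cleared of denominators this will say
      \<open>1 - 1 / (1 + y)\<^sup>2 \<le> 2 * y\<close>, and \<open>cosh \<rho> \<le> 1 + y\<close>
      makes the left side a bound for \<open>(tanh \<rho>)\<^sup>2\<close>.\<close>
    have "(1 - 2 * y) * (1 + y)\<^sup>2 = 1 - y\<^sup>2 * (3 + 2 * y)"
      by (simp add: power2_eq_square algebra_simps)
    also have "\<dots> \<le> 1" using y0 by simp
    finally have p: "(1 - 2 * y) * (1 + y)\<^sup>2 \<le> 1" .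
    have "(1 - 2 * y) * (cosh \<rho>)\<^sup>2 \<le> 1"
    proof (cases "1 - 2 * y \<ge> 0")
      case True
      then show ?thesis using mult_left_mono[OF c2, of "1 - 2 * y"] p by linarith
    next
      case False
      then have "(1 - 2 * y) * (cosh \<rho>)\<^sup>2 \<le> 0" by (intro mult_nonpos_nonneg) auto
      then show ?thesis by simp
    qed
    then have "(sinh \<rho>)\<^sup>2 \<le> 2 * y * (cosh \<rho>)\<^sup>2"
      using cosh_square_eq[of \<rho>] by (simp add: algebra_simps)
    then have "(tanh \<rho>)\<^sup>2 \<le> 2 * y"
      by (simp add: tanh_def power_divide divide_le_eq)
    then show ?thesis by (simp add: y_def)
  next
    case False
    \<comment> \<open>Here \<open>d > D/2\<close> and \<open>2 * D - d \<ge> D\<close>, so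
      \<open>y\<close> is at least \<open>sinh (D/2) * tanh D\<close>, and hence at least
      \<open>(tanh (D/2))\<^sup>2\<close>.\<close>
    have "sinh (D/2) * sinh D \<le> sinh d * sinh (2 * D - d)"
      using False D d a by (intro mult_mono) auto
    then have "sinh (D/2) * sinh D \<le> cosh D * y" using s1 yC by simp
    then have y1: "sinh (D/2) * tanh D \<le> y"
      by (simp add: tanh_def divide_le_eq mult.commute)
    have t2: "tanh (D/2) \<le> tanh D" using D by simp
    have t3: "tanh (D/2) \<le> sinh (D/2)"
      using D cosh_real_ge_1[of "D/2"] mult_left_mono[of 1 "cosh (D/2)" "sinh (D/2)"]
      by (simp add: tanh_def divide_le_eq)
    have t0: "0 < tanh (D/2)" using D by simp
    have "(tanh \<rho>)\<^sup>2 \<le> (tanh (D/2))\<^sup>2" using rho by (intro power_mono) auto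
    also have "\<dots> \<le> sinh (D/2) * tanh D"
      unfolding power2_eq_square using t2 t3 t0 by (intro mult_mono) auto
    also have "\<dots> \<le> 2 * y" using y1 t0 t2 t3
      by (smt (verit) mult_pos_pos)
    finally show ?thesis by (simp add: y_def)
  qed
qed

lemma cos_pi_4_ge: "cos (pi/4) \<ge> (7/10::real)"
proof -
  have "(7/10::real)\<^sup>2 \<le> (sqrt 2 / 2)\<^sup>2" by (simp add: power2_eq_square)
  then have "7/10 \<le> sqrt 2 / (2::real)" by (rule power2_le_imp_le) simp
  then show ?thesis by (simp add: cos_45)
qed

lemma tan_half_sq: "1 + cos x \<noteq> 0 \<Longrightarrow> (tan (x/2))\<^sup>2 = (1 - cos x) / (1 + cos x)" for x :: real
proof -
  assume n: "1 + cos x \<noteq> 0"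
  have c: "cos x = 2 * (cos (x/2))\<^sup>2 - 1" using cos_double_cos[of "x/2"] by simp
  have s: "cos x = 1 - 2 * (sin (x/2))\<^sup>2" using cos_double_sin[of "x/2"] by simp
  have "(1 - cos x) / (1 + cos x) = (2 * (sin (x/2))\<^sup>2) / (2 * (cos (x/2))\<^sup>2)"
    using c s by simp
  then show ?thesis by (simp add: tan_def power_divide)
qed

text \<open>The argument follows \<open>hyperbolic_estimate\<close>, except that
  \<open>2 * D - d\<close> may exceed a right angle, where the sine decreases. Since
  \<open>pi > 3\<close>, it suffices to reach the constant 3/4, which leaves room for crude
  numerical bounds.\<close>

lemma spherical_estimate:
  fixes D a b d w :: real
  assumes D2: "D < pi / 2" and a: "0 < a" "a \<le> D" and b: "0 < b" "b \<le> D"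
    and d: "0 \<le> d" "d \<le> a" "d \<le> b"
    and eq: "sin d * sin (a + b - d) = w * sin a * sin b"
    and t: "0 < t1" "t1 \<le> D" "0 < t2" "t2 \<le> D"
    and r: "cos r1 = cos h * cos t1" "cos r2 = cos h * cos t2" "0 \<le> r1" "0 \<le> r2"
    and M: "r1 + r2 - (t1 + t2) \<le> 2 * d"
    and rho: "0 \<le> \<rho>" "\<rho> \<le> h" "2 * \<rho> \<le> D" and h: "h \<le> pi"
  shows "(tan (\<rho>/2))\<^sup>2 \<le> pi / 4 * w * (tan D)\<^sup>2"
proof -
  have D: "D > 0" using a by simp
  have sD: "sin D > 0" using D D2 by (intro sin_gt_zero) auto
  have cD: "cos D > 0" using D D2 by (intro cos_gt_zero_pi) auto
  have sd: "sin d \<ge> 0" using d a D2 by (intro sin_ge_zero) auto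
  have enlarge: "sin u * sin (D + x) \<le> sin (u + x) * sin D"
    if "0 \<le> x" "x \<le> D" "0 < u" "u \<le> D" for u x :: real
  proof -
    have "sin (u + x) * sin D - sin u * sin (D + x) = sin x * sin (D - u)"
      unfolding sin_add sin_diff by (simp add: algebra_simps)
    moreover have "sin x \<ge> 0" "sin (D - u) \<ge> 0" using that D2 by (auto intro!: sin_ge_zero)
    then have "sin x * sin (D - u) \<ge> 0" by simp
    ultimately show ?thesis by linarith
  qed
  have s1: "sin d * sin (2 * D - d) \<le> w * (sin D)\<^sup>2"
  proof -
    have sa: "sin a > 0" and sb: "sin b > 0" using a b D2 by (auto intro!: sin_gt_zero)
    have "sin a * (sin d * sin (D + (b - d))) \<le> sin d * (sin (a + (b - d)) * sin D)"
      using mult_left_mono[OF enlarge[of "b - d" a], of "sin d"] a b d sd by (simp add: ac_simps)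
    also have "\<dots> = sin a * (w * sin b * sin D)"
      using eq by (simp add: algebra_simps)
    finally have 1: "sin d * sin (D + (b - d)) \<le> w * sin b * sin D"
      using sa by simp
    have "sin b * (sin d * sin (D + (D - d))) \<le> sin d * (sin (b + (D - d)) * sin D)"
      using mult_left_mono[OF enlarge[of "D - d" b], of "sin d"] b d sd by (simp add: ac_simps)
    also have "\<dots> = sin d * sin (D + (b - d)) * sin D"
      by (simp add: algebra_simps)
    also have "\<dots> \<le> w * sin b * sin D * sin D"
      using 1 sD by (intro mult_right_mono) auto
    finally have "sin b * (sin d * sin (D + (D - d))) \<le> sin b * (w * (sin D)\<^sup>2)"
      by (simp add: algebra_simps power2_eq_square)
    then show ?thesis using sb by simp
  qed
  have w0: "w * (sin D)\<^sup>2 \<ge> 0"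
  proof -
    have "sin (2 * D - d) \<ge> 0" using d a D2 by (intro sin_ge_zero) auto
    then have "sin d * sin (2 * D - d) \<ge> 0" using sd by simp
    then show ?thesis using s1 by linarith
  qed
  have pi3: "pi / 4 \<ge> 3/4" using pi_gt3 by simp
  have goal: ?thesis if "(tan (\<rho>/2))\<^sup>2 * (cos D)\<^sup>2 \<le> 3/4 * (w * (sin D)\<^sup>2)"
  proof -
    have "3/4 * (w * (sin D)\<^sup>2) \<le> pi/4 * (w * (sin D)\<^sup>2)" using pi3 w0 by (intro mult_right_mono)
    then have "(tan (\<rho>/2))\<^sup>2 * (cos D)\<^sup>2 \<le> pi/4 * (w * (sin D)\<^sup>2)" using that by linarith
    then have "(tan (\<rho>/2))\<^sup>2 \<le> pi/4 * (w * (sin D)\<^sup>2) / (cos D)\<^sup>2"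
      using cD by (simp add: le_divide_eq)
    moreover have "(tan D)\<^sup>2 = (sin D)\<^sup>2 / (cos D)\<^sup>2" by (simp add: tan_def power_divide)
    ultimately show ?thesis by simp
  qed
  \<comment> \<open>Since \<open>\<rho> \<le> D/2 < pi/4\<close>, the denominator
    \<open>1 + cos \<rho>\<close> of the half angle formula is at least 17/10.\<close>
  have c\<rho>: "cos \<rho> \<ge> 7/10"
    using cos_monotone_0_pi_le[of \<rho> "pi/4"] rho D2 cos_pi_4_ge by auto
  show ?thesis
  proof (cases "2 * d \<le> D")
    case True
    have "cos (D + d) \<le> cos h * cos D"
    proof -
      have main: "cos (D + d) \<le> cos h * cos D"
        if "cos q = cos h * cos t" "0 < t" "t \<le> D" "0 \<le> q" "q \<le> t + d" for q t
      proof -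
        have "cos (t + d) * cos D - cos t * cos (D + d) = sin d * sin (D - t)"
          unfolding cos_add sin_diff by (simp add: algebra_simps)
        moreover have "sin (D - t) \<ge> 0" using that D2 by (intro sin_ge_zero) auto
        then have "sin d * sin (D - t) \<ge> 0" using sd by simp
        moreover have ct: "cos t > 0" using that D2 by (intro cos_gt_zero_pi) auto
        have "cos (t + d) \<le> cos h * cos t"
          using that(1)[symmetric] that d a D2 cos_monotone_0_pi_le[of q "t + d"] by auto
        then have "cos (t + d) * cos D \<le> (cos h * cos D) * cos t"
          using mult_right_mono[of _ _ "cos D"] cD by (simp add: ac_simps)
        ultimately have "cos (D + d) * cos t \<le> (cos h * cos D) * cos t"
          by (simp add: mult.commute)
        then show ?thesis using ct by simp
      qed
      have "r1 \<le> t1 + d \<or> r2 \<le> t2 + d" using M by linarith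
      then show ?thesis using main r t by blast
    qed
    also have "cos h * cos D \<le> cos \<rho> * cos D"
      using cD rho h by (intro mult_right_mono cos_monotone_0_pi_le) auto
    finally have 1: "(1 - cos \<rho>) * cos D \<le> cos D - cos (D + d)" by (simp add: algebra_simps)
    have 2: "cos D - cos (D + d) = 2 * sin (D + d/2) * sin (d/2)"
    proof -
      have "cos ((D + d/2) - d/2) - cos ((D + d/2) + d/2) = 2 * sin (D + d/2) * sin (d/2)"
        by (simp only: cos_add cos_diff)
      then show ?thesis by (simp add: add.commute)
    qed
    define x where "x = d/2"
    have x: "0 \<le> x" "4 * x \<le> D" using d True by (auto simp: x_def)
    have sx: "sin x \<ge> 0" and cx: "cos x > 0" and c2x: "cos (2 * x) > 0" and c4x: "cos (4 * x) > 0"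
      using x D2 by (auto intro!: sin_ge_zero cos_gt_zero_pi)
    \<comment> \<open>This is \<open>4 * tan x \<le> tan (4 * x) \<le> tan D\<close> cleared of
      denominators, where \<open>4 * x = 2 * d \<le> D\<close>.\<close>
    have s4: "4 * sin x * cos D \<le> sin D * cos x"
    proof -
      have "0 \<le> sin (D - 4 * x)" using x D2 by (intro sin_ge_zero) auto
      then have A: "cos D * sin (4 * x) \<le> sin D * cos (4 * x)" by (simp add: sin_diff)
      have B: "sin (4 * x) = 4 * sin x * cos x * cos (2 * x)"
        using sin_double[of "2 * x"] sin_double[of x] by simp
      have C: "cos (4 * x) \<le> (cos x)\<^sup>2 * cos (2 * x)"
      proof -
        have "cos (4 * x) = 2 * (cos (2 * x))\<^sup>2 - 1" using cos_double_cos[of "2 * x"] by simp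
        moreover have "(cos x)\<^sup>2 = (1 + cos (2 * x)) / 2" using cos_double_cos[of x] by simp
        moreover have "cos (2 * x) \<le> 1" by simp
        then have "(cos (2 * x) - 1) * (3 * cos (2 * x) + 2) \<le> 0"
          using c2x by (intro mult_nonpos_nonneg) auto
        then have "2 * (cos (2 * x))\<^sup>2 - 1 \<le> (1 + cos (2 * x)) / 2 * cos (2 * x)"
          by (simp add: power2_eq_square algebra_simps)
        ultimately show ?thesis by (metis times_divide_eq_left)
      qed
      have "cos D * (4 * sin x * cos x * cos (2 * x)) \<le> sin D * ((cos x)\<^sup>2 * cos (2 * x))"
        using order_trans[OF A[unfolded B] mult_left_mono[OF C, of "sin D"]] sD by auto
      then have "(cos x * cos (2 * x)) * (4 * sin x * cos D) \<le> (cos x * cos (2 * x)) * (sin D * cos x)"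
        by (simp add: algebra_simps power2_eq_square)
      then show ?thesis using cx c2x by (simp add: mult_le_cancel_left_pos)
    qed
    \<comment> \<open>Up to a right angle the comparison is with \<open>sin D\<close>, beyond it
      with \<open>sin (2 * D)\<close>.\<close>
    have s5: "sin D * cos D \<le> sin (2 * D - d)"
    proof (cases "2 * D - d \<le> pi/2")
      case True
      then have "sin D \<le> sin (2 * D - d)" using d a D D2 by (intro sin_monotone_2pi_le) auto
      moreover have "sin D * cos D \<le> sin D" using sD by simp
      ultimately show ?thesis by linarith
    next
      case False
      have "sin (2 * D) \<le> sin (2 * D - d)"
      proof -
        have "sin (pi - 2 * D) \<le> sin (pi - (2 * D - d))"
          using False d D2 D by (intro sin_monotone_2pi_le) auto
        then show ?thesis by (simp add: sin_diff)
      qed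
      moreover have "sin (2 * D) \<ge> sin D * cos D" using sD cD by (simp add: sin_double)
      ultimately show ?thesis by linarith
    qed
    have "(1 - cos \<rho>) * (cos D)\<^sup>2 \<le> (2 * sin (D + x) * sin x) * cos D"
      using mult_right_mono[OF 1, of "cos D"] 2 cD by (simp add: x_def power2_eq_square ac_simps)
    also have "\<dots> = 2 * sin x * (sin D * cos D * cos x + cos D * (sin x * cos D))"
      by (simp add: sin_add algebra_simps)
    also have "\<dots> \<le> 2 * sin x * (sin D * cos D * cos x + cos D * (sin D * cos x / 4))"
      using s4 sx cD by (intro mult_left_mono add_left_mono) auto
    \<comment> \<open>The factor 5/4 is 1 from the leading term plus 1/4 from
      \<open>s4\<close>.\<close>
    also have "\<dots> = 5/4 * (2 * sin x * cos x) * (sin D * cos D)"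
      by (simp add: algebra_simps)
    also have "\<dots> = 5/4 * (sin d * (sin D * cos D))"
      using sin_double[of x] by (simp add: x_def)
    also have "\<dots> \<le> 5/4 * (sin d * sin (2 * D - d))"
      using s5 sd by (intro mult_left_mono) auto
    also have "\<dots> \<le> 5/4 * (w * (sin D)\<^sup>2)" using s1 by simp
    \<comment> \<open>The margin is \<open>3/4 * 17/10 = 51/40\<close> against
      \<open>5/4 = 50/40\<close>.\<close>
    also have "\<dots> \<le> 3/4 * (w * (sin D)\<^sup>2) * (1 + cos \<rho>)"
    proof -
      have "3/4 * (w * (sin D)\<^sup>2) * (17/10) \<le> 3/4 * (w * (sin D)\<^sup>2) * (1 + cos \<rho>)"
        using c\<rho> w0 by (intro mult_left_mono) auto
      then show ?thesis using w0 by linarith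
    qed
    finally have "(1 - cos \<rho>) / (1 + cos \<rho>) * (cos D)\<^sup>2 \<le> 3/4 * (w * (sin D)\<^sup>2)"
      using c\<rho> by (simp add: divide_le_eq)
    then show ?thesis using goal c\<rho> tan_half_sq[of \<rho>] by auto
  next
    case False
    \<comment> \<open>For large \<open>d\<close> the bound \<open>\<rho> \<le> D/2\<close> is
      enough: both \<open>d\<close> and \<open>2 * D - d\<close> have sine at least
      \<open>sin (D/2)\<close>.\<close>
    have "sin (D/2) \<le> sin d" using False d a D2 by (intro sin_monotone_2pi_le) auto
    moreover have "sin (D/2) \<le> sin (2 * D - d)"
    proof (cases "2 * D - d \<le> pi/2")
      case True
      then show ?thesis using d a D D2 by (intro sin_monotone_2pi_le) auto
    next
      case F: False
      have "sin (D/2) \<le> sin (pi - (2 * D - d))"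
        using F False d D2 D a by (intro sin_monotone_2pi_le) auto
      then show ?thesis by simp
    qed
    moreover have sD2: "sin (D/2) \<ge> 0" using D D2 by (intro sin_ge_zero) auto
    ultimately have "sin (D/2) * sin (D/2) \<le> sin d * sin (2 * D - d)"
      by (intro mult_mono) auto
    then have A: "(sin (D/2))\<^sup>2 \<le> w * (sin D)\<^sup>2" using s1 by (simp add: power2_eq_square)
    have "cos (D/2) \<ge> 7/10"
      using cos_monotone_0_pi_le[of "D/2" "pi/4"] D D2 cos_pi_4_ge by auto
    then have p: "(sin (D/2))\<^sup>2 = (1 - cos (D/2)) * (1 + cos (D/2))" "1 + cos (D/2) \<ge> 17/10" "1 - cos (D/2) \<ge> 0"
      using sin_cos_squared_add[of "D/2"] by (auto simp: algebra_simps power2_eq_square)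
    have "(tan (\<rho>/2))\<^sup>2 = (1 - cos \<rho>) / (1 + cos \<rho>)" using tan_half_sq[of \<rho>] c\<rho> by auto
    also have "\<dots> \<le> (1 - cos (D/2)) / (1 + cos (D/2))"
    proof -
      have "cos (D/2) \<le> cos \<rho>" using rho D D2 by (intro cos_monotone_0_pi_le) auto
      then show ?thesis using p c\<rho> by (intro frac_le) auto
    qed
    also have "\<dots> \<le> 3/4 * ((1 - cos (D/2)) * (1 + cos (D/2)))"
    proof -
      have "17/10 * (17/10) \<le> (1 + cos (D/2)) * (1 + cos (D/2))"
        using p(2) by (intro mult_mono) auto
      then have "1 \<le> 3/4 * (1 + cos (D/2)) * (1 + cos (D/2))"
        unfolding mult.assoc by linarith
      then have "(1 - cos (D/2)) * 1 \<le> (1 - cos (D/2)) * (3/4 * (1 + cos (D/2)) * (1 + cos (D/2)))"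
        using p(3) by (intro mult_left_mono) auto
      also have "\<dots> = 3/4 * ((1 - cos (D/2)) * (1 + cos (D/2))) * (1 + cos (D/2))"
        by (simp only: mult_ac)
      finally have le: "1 - cos (D/2) \<le> 3/4 * ((1 - cos (D/2)) * (1 + cos (D/2))) * (1 + cos (D/2))"
        by simp
      have "0 < 1 + cos (D/2)" using p(2) by linarith
      from pos_divide_le_eq[OF this] le show ?thesis by blast
    qed
    finally have B: "(tan (\<rho>/2))\<^sup>2 \<le> 3/4 * (w * (sin D)\<^sup>2)" using A p(1) by simp
    have "(tan (\<rho>/2))\<^sup>2 * (cos D)\<^sup>2 \<le> (tan (\<rho>/2))\<^sup>2 * 1"
      by (intro mult_left_mono) (auto simp: power_le_one abs_square_le_1)
    then show ?thesis using goal B by simp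
  qed
qed

section \<open>Upper and lower bounds for the maximal action\<close>

text \<open>\<open>curv G * cg G\<close> decreases on nonnegative arguments, up to \<open>pi\<close>
  on the sphere, so one comparison serves both geometries.\<close>

lemma cg_le_imp:
  assumes "0 \<le> x" "0 \<le> y" "G = Spherical \<Longrightarrow> x \<le> pi \<and> y \<le> pi" "curv G * cg G x \<le> curv G * cg G y"
  shows "y \<le> x"
proof (cases G)
  case Hyperbolic
  then show ?thesis using assms by (simp add: cg_def cosh_real_nonneg_le_iff)
next
  case Spherical
  show ?thesis
  proof (rule ccontr)
    assume "\<not> y \<le> x"
    then have "cos y < cos x" using assms Spherical by (intro cos_monotone_0_pi) auto
    then show False using assms(4) Spherical by (simp add: cg_def)
  qed
qed

text \<open>Derivatives are asked for only inside the interval, since the distance is not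
  differentiable where two boundary points coincide.\<close>

lemma nondecreasing_from_open:
  fixes f :: "real \<Rightarrow> real"
  assumes "a \<le> b" "continuous_on {a..b} f"
    and "\<And>x. a < x \<Longrightarrow> x < b \<Longrightarrow> \<exists>d\<ge>0. (f has_real_derivative d) (at x)"
  shows "f a \<le> f b"
proof (cases "a = b")
  case False
  then have ab: "a < b" using assms(1) by simp
  have "\<And>x. a < x \<Longrightarrow> x < b \<Longrightarrow> f differentiable (at x)"
    using assms(3) by (auto simp: real_differentiable_def)
  then obtain l z where z: "a < z" "z < b" "(f has_real_derivative l) (at z)" "f b - f a = (b - a) * l"
    using MVT[OF ab assms(2)] by blast
  then have "l \<ge> 0" using assms(3)[of z] DERIV_unique by blast
  then show ?thesis using z(4) ab by (smt (verit) mult_nonneg_nonneg)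
qed simp

section \<open>The diameter and the second variation of distance\<close>

context table
begin

text \<open>The supremum is informative only for a set bounded above; compactness of one period
  supplies the bound.\<close>

lemma gdist_c_le: "gdist G (c s) (c t) \<le> table_diameter G K"
proof -
  have red: "\<exists>r\<in>{0..L}. c r = c s" for s
    using boundary_point[OF c_boundary[of s], of 0] by force
  have "continuous_on ({0..L} \<times> {0..L}) (\<lambda>p. gdist G (c (fst p)) (c (snd p)))"
    by (intro continuous_intros continuous_on_compose2[OF c_cont[of UNIV]]) (auto simp: c_surf)
  then have "compact ((\<lambda>p. gdist G (c (fst p)) (c (snd p))) ` ({0..L} \<times> {0..L}))"
    by (intro compact_continuous_image compact_Times) auto
  moreover have "{gdist G x y | x y. x \<in> boundary G K \<and> y \<in> boundary G K}
      \<subseteq> (\<lambda>p. gdist G (c (fst p)) (c (snd p))) ` ({0..L} \<times> {0..L})"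
  proof
    fix d assume "d \<in> {gdist G x y | x y. x \<in> boundary G K \<and> y \<in> boundary G K}"
    then obtain s t where d: "d = gdist G (c s) (c t)" unfolding boundary_eq by auto
    obtain s' t' where "s' \<in> {0..L}" "c s' = c s" "t' \<in> {0..L}" "c t' = c t" using red by metis
    then show "d \<in> (\<lambda>p. gdist G (c (fst p)) (c (snd p))) ` ({0..L} \<times> {0..L})"
      using d by (intro image_eqI[of _ _ "(s', t')"]) auto
  qed
  ultimately have "bdd_above {gdist G x y | x y. x \<in> boundary G K \<and> y \<in> boundary G K}"
    by (meson bdd_above_mono compact_imp_bounded bounded_imp_bdd_above)
  then show ?thesis unfolding table_diameter_def
    using c_boundary by (intro cSup_upper) auto
qed

text \<open>Second variation of distance: the curvature of the boundary turns the velocity, and the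
  cotangent \<open>cg / sg\<close> of the distance measures how the direction to \<open>y\<close>
  turns.\<close>

lemma cosang_has_derivative:
  assumes y: "y \<in> K" "y \<noteq> c t"
  shows "((\<lambda>s. cosang s y) has_real_derivative geodesic_curvature G c t * sinang t y
    - cg G (gdist G (c t) y) / sg G (gdist G (c t) y) * (sinang t y)\<^sup>2) (at t)"
proof -
  have ys: "y \<in> surface G" using y K by auto
  define B B' S where "B = form G (c t) y" and "B' = form G (velocity c t) y" and "S = sn G (c t) y"
  have S: "S > 0" "S\<^sup>2 = curv G * (1 - B\<^sup>2)" using sn_c(1)[OF y] sn_square(1)[OF c_surf ys] by (auto simp: S_def B_def)
  have pos: "curv G * (1 - B\<^sup>2) > 0" using S by (metis zero_less_power)
  have dB: "((\<lambda>s. form G (c s) y) has_real_derivative B') (at t)" unfolding B'_def by (rule form_c_deriv)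
  have dS: "((\<lambda>s. sn G (c s) y) has_real_derivative - (curv G * B * B' / S)) (at t)"
  proof -
    have "((\<lambda>s. sqrt (curv G * (1 - (form G (c s) y)\<^sup>2))) has_real_derivative
        - (curv G * (2 * B * B')) / (2 * S)) (at t)"
      using pos by (auto intro!: derivative_eq_intros dB simp: S_def sn_def B_def field_simps)
    then show ?thesis by (simp add: sn_def mult.assoc)
  qed
  have "((\<lambda>s. cosang s y) has_real_derivative
      (form G (acceleration c t) y * S - B' * (- (curv G * B * B' / S))) / (S * S)) (at t)"
    unfolding cosang_def B'_def S_def using S(1) dS form_v_deriv
    by (intro DERIV_divide) (auto simp: B'_def S_def)
  moreover have "(form G (acceleration c t) y * S - B' * (- (curv G * B * B' / S))) / (S * S)
      = geodesic_curvature G c t * sinang t y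
        - cg G (gdist G (c t) y) / sg G (gdist G (c t) y) * (sinang t y)\<^sup>2"
  proof -
    define \<kappa> h g where "\<kappa> = geodesic_curvature G c t" and "h = sinang t y" and "g = cosang t y"
    have acc: "form G (acceleration c t) y = \<kappa> * (S * h) - curv G * B"
      unfolding acceleration_expand ang(2)[OF y] by (simp add: \<kappa>_def S_def h_def B_def)
    have B': "B' = S * g" using ang(1)[OF y] by (simp add: B'_def S_def g_def)
    have g2: "g\<^sup>2 = 1 - h\<^sup>2" using ang(3)[OF y] by (simp add: g_def h_def)
    have "(form G (acceleration c t) y * S - B' * (- (curv G * B * B' / S))) / (S * S)
      = ((\<kappa> * (S * h) - curv G * B) * S + curv G * B * S * g\<^sup>2) / (S * S)"
      using S(1) by (simp add: acc B' power2_eq_square)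
    also have "\<dots> = \<kappa> * h - curv G * B / S * h\<^sup>2"
      unfolding g2 using S(1) by (simp add: field_simps power2_eq_square)
    finally show ?thesis using gdist_facts(1,2)[OF c_surf ys, of t] by (simp add: \<kappa>_def h_def B_def S_def)
  qed
  ultimately show ?thesis by simp
qed

end

context caustic
begin

text \<open>\<open>c p\<close> and \<open>c r\<close> come from maximisers of the action in the
  column and the row of \<open>t\<close>; stationarity in \<open>t\<close> gives both chords the
  angle of the tangent lines, so they form a path reflected at \<open>c t\<close>. The witnesses are
  the chord lengths \<open>a\<close>, \<open>b\<close>, half their excess \<open>d\<close> over the
  chord from \<open>c p\<close> to \<open>c r\<close>, and \<open>w = h\<^sup>2\<close>, the squared
  sine of the angle.\<close>

lemma upper_bound:
  assumes D: "D = table_diameter G K" "G = Spherical \<Longrightarrow> D < pi / 2"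
    and M: "\<And>s t. s \<le> t \<Longrightarrow> t \<le> s + L \<Longrightarrow> action s t \<le> M"
      "\<And>s. \<exists>t\<in>{s..s+L}. action s t = M" "\<And>t. \<exists>s\<in>{t-L..t}. action s t = M" and M0: "M > 0"
  obtains a b d w where "0 < a" "a \<le> D" "0 < b" "b \<le> D" "0 \<le> d" "d \<le> a" "d \<le> b"
    "sg G d * sg G (a + b - d) = w * sg G a * sg G b" "M \<le> 2 * d"
    "0 \<le> w" "w * (cg G D)\<^sup>2 \<le> (geodesic_curvature G c t)\<^sup>2 * (sg G D)\<^sup>2"
proof -
  obtain r where r: "t \<le> r" "r \<le> t + L" "action t r = M" using M(2)[of t] by auto
  obtain p where p: "t - L \<le> p" "p \<le> t" "action p t = M" using M(3)[of t] by auto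
  have rt: "t < r" "r < t + L" using r M0 action_diag[of t] action_full[of t] by (auto simp: less_le)
  have pt: "p < t" "t < p + L"
    using p M0 action_diag[of t] action_full[of p] by (auto simp: less_le)
  have ne: "c r \<noteq> c t" "c p \<noteq> c t" using c_ne'[of t r] c_ne[of p t] rt pt by auto
  have dr: "((\<lambda>s. action s r) has_real_derivative - cosang t (c r) + tcos t) (at t)"
    by (rule action_deriv_start[OF rt])
  have dp: "(action p has_real_derivative - cosang t (c p) - tcos t) (at t)"
    by (rule action_deriv_end[OF pt])
  define e where "e = min (min (r - t) (t + L - r)) (min (t - p) (p + L - t))"
  have e: "e > 0" using rt pt by (auto simp: e_def)
  have er: "t' < r" "r < t' + L" "p < t'" "t' < p + L" if "\<bar>t' - t\<bar> < e" for t'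
    using that by (auto simp: e_def abs_if split: if_splits)
  \<comment> \<open>As \<open>M\<close> bounds the action everywhere, \<open>t\<close> also
    maximises it with \<open>r\<close> held fixed.\<close>
  have cr: "cosang t (c r) = tcos t"
    using DERIV_local_max[OF dr e] M(1)[of _ r] er r(3) by (simp add: abs_minus_commute less_imp_le)
  have cp: "cosang t (c p) = - tcos t"
    using DERIV_local_max[OF dp e] M(1)[of p] er p(3) by (simp add: abs_minus_commute less_imp_le)
  define h where "h = sinang t (c r)"
  have h: "h \<ge> 0" "h\<^sup>2 = 1 - (tcos t)\<^sup>2" using ang(3,4)[OF c_K ne(1)] cr by (auto simp: h_def)
  have hp: "sinang t (c p) = h"
  proof -
    have "(sinang t (c p))\<^sup>2 = h\<^sup>2" using ang(3)[OF c_K ne(2)] cp h by simp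
    then show ?thesis using ang(4)[OF c_K ne(2)] h(1) by (simp add: power2_eq_iff_nonneg)
  qed
  define a b where "a = gdist G (c t) (c p)" and "b = gdist G (c t) (c r)"
  note ga = gdist_facts[OF c_surf c_surf, of t p, folded a_def]
  note gb = gdist_facts[OF c_surf c_surf, of t r, folded b_def]
  have sa: "sg G a > 0" "sn G (c t) (c p) = sg G a" and sb: "sg G b > 0" "sn G (c t) (c r) = sg G b"
    using ga gb sn_c(1)[OF c_K ne(1)] sn_c(1)[OF c_K ne(2)] by auto
  have a0: "0 < a" "0 < b" using sa sb ga(3) gb(3) by (auto simp: less_le)
  have aD: "a \<le> D" "b \<le> D" using gdist_c_le by (auto simp: a_def b_def D)
  have Dpi: "G = Spherical \<Longrightarrow> D \<le> pi" using D(2) pi_half_less_two pi_gt3 by linarith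
  define \<kappa> where "\<kappa> = geodesic_curvature G c t"
  have second: "0 \<le> 2 * \<kappa> * h - (cg G a / sg G a + cg G b / sg G b) * h\<^sup>2"
  proof -
    \<comment> \<open>Minus the length of the path through \<open>c s\<close>. In
      \<open>action p s + action s r\<close> the potential at \<open>s\<close> cancels, and at
      \<open>s = t\<close> both summands attain \<open>M\<close>.\<close>
    define f where "f s = - (gdist G (c s) (c p) + gdist G (c s) (c r))" for s
    have "0 \<le> (\<kappa> * h - cg G a / sg G a * h\<^sup>2) + (\<kappa> * h - cg G b / sg G b * h\<^sup>2)"
    proof (rule second_derivative_min(2)[OF e, where f = f and F = "\<lambda>s. cosang s (c p) + cosang s (c r)" and x = t])
      fix y assume y: "\<bar>y - t\<bar> < e"
      have "c y \<noteq> c p" "c y \<noteq> c r" using c_ne'[of p y] c_ne[of y r] er[OF y] by auto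
      then have "(f has_real_derivative - (- cosang y (c p) + - cosang y (c r))) (at y)"
        unfolding f_def[abs_def] cosang_def
        by (intro DERIV_minus DERIV_add gdist_has_derivative c_deriv c_surf) auto
      then show "(f has_real_derivative cosang y (c p) + cosang y (c r)) (at y)" by (simp add: add.commute)
      have "action p y + action y r \<le> 2 * M" using M(1)[of p y] M(1)[of y r] er[OF y] by auto
      moreover have "action p t + action t r = 2 * M" using p r by simp
      ultimately show "f t \<le> f y"
        using gdist_facts(5)[OF c_surf c_surf, of t p] gdist_facts(5)[OF c_surf c_surf, of y p]
        by (simp add: f_def action_def)
    next
      show "((\<lambda>s. cosang s (c p) + cosang s (c r)) has_real_derivative
          \<kappa> * h - cg G a / sg G a * h\<^sup>2 + (\<kappa> * h - cg G b / sg G b * h\<^sup>2)) (at t)"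
        using cosang_has_derivative[OF c_K ne(2)] cosang_has_derivative[OF c_K ne(1)]
        unfolding hp h_def[symmetric] a_def b_def \<kappa>_def by (rule DERIV_add)
    qed
    then show ?thesis by (simp add: algebra_simps)
  qed
  \<comment> \<open>The cotangent decreases, in a form cleared of denominators.\<close>
  have cotD: "cg G D * sg G x \<le> cg G x * sg G D" if "0 < x" "x \<le> D" for x
  proof -
    have "0 \<le> sg G (D - x)"
    proof (cases "x = D")
      case False
      then show ?thesis using that Dpi by (intro less_imp_le sg_pos) auto
    qed simp
    then show ?thesis by (simp add: sg_diff mult.commute)
  qed
  have sD: "sg G D > 0" using a0 aD D(2) by (intro sg_pos) (auto simp: field_simps)
  have cD: "cg G D \<ge> 0"
    using D(2) a0 aD by (cases G) (auto simp: cg_def intro!: cos_ge_zero)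
  have w: "h\<^sup>2 * (cg G D)\<^sup>2 \<le> \<kappa>\<^sup>2 * (sg G D)\<^sup>2"
  proof (cases "h = 0")
    case False
    then have hpos: "h > 0" using h by simp
    have "cg G D / sg G D \<le> cg G a / sg G a" "cg G D / sg G D \<le> cg G b / sg G b"
      using cotD[OF a0(1) aD(1)] cotD[OF a0(2) aD(2)] sa sb sD by (auto simp: field_simps)
    then have "h * (2 * (cg G D / sg G D)) \<le> h * (cg G a / sg G a + cg G b / sg G b)"
      using hpos by (intro mult_left_mono) auto
    moreover have "h * (cg G a / sg G a + cg G b / sg G b) \<le> 2 * \<kappa>"
    proof -
      have "0 \<le> h * (2 * \<kappa> - h * (cg G a / sg G a + cg G b / sg G b))"
        using second by (simp add: power2_eq_square algebra_simps)
      then show ?thesis using hpos by (simp add: zero_le_mult_iff)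
    qed
    moreover have "h * (2 * (cg G D / sg G D)) = 2 * (h * (cg G D / sg G D))" by simp
    ultimately have "2 * (h * (cg G D / sg G D)) \<le> 2 * \<kappa>" by (metis order_trans)
    then have "h * (cg G D / sg G D) \<le> \<kappa>" unfolding mult_le_cancel_left_pos[OF zero_less_numeral] .
    then have "h * cg G D \<le> \<kappa> * sg G D" using sD by (simp add: field_simps)
    then have "(h * cg G D)\<^sup>2 \<le> (\<kappa> * sg G D)\<^sup>2" using hpos cD by (intro power_mono) auto
    then show ?thesis by (simp add: power_mult_distrib)
  qed simp
  define l where "l = gdist G (c p) (c r)"
  note gl = gdist_facts[OF c_surf c_surf, of p r, folded l_def]
  define d where "d = (a + b - l) / 2"
  \<comment> \<open>The bound \<open>M\<close> holds only within one period. If \<open>r\<close> lay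
    beyond \<open>p + L\<close>, antitonicity would contradict the opposite signs of the two
    cosines.\<close>
  have rp: "r \<le> p + L"
  proof (rule ccontr)
    assume "\<not> r \<le> p + L"
    then have "cosang t (c r) \<le> cosang t (c (p + L))" using pt rt by (intro cosang_antitone) auto
    then show False using cr cp tcos_pos[of t] by (simp add: c_period)
  qed
  have Md: "M \<le> 2 * d"
  proof -
    have "action p r \<le> M" using M(1)[of p r] rp pt rt by auto
    moreover have "action p t + action t r = 2 * M" using p r by simp
    moreover have "gdist G (c p) (c t) = a" using gdist_facts(5)[OF c_surf c_surf, of p t] by (simp add: a_def)
    ultimately show ?thesis by (simp add: action_def b_def l_def d_def)
  qed
  \<comment> \<open>Law of cosines at \<open>c t\<close>: the angle between the chords is
    \<open>pi\<close> minus twice the angle with the boundary.\<close>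
  have cl: "cg G l = cg G a * cg G b + curv G * sg G a * sg G b * (2 * h\<^sup>2 - 1)"
  proof -
    have X: "form G (velocity c t) (c p) = - sg G a * tcos t" "form G (velocity c t) (c r) = sg G b * tcos t"
      "det3 (c t) (velocity c t) (c p) = sg G a * h" "det3 (c t) (velocity c t) (c r) = sg G b * h"
      using ang(1,2)[OF c_K ne(1)] ang(1,2)[OF c_K ne(2)] sa sb cr cp hp by (auto simp: h_def)
    have "form G (c p) (c r) = curv G * (form G (c t) (c p) * form G (c t) (c r))
       + sg G a * sg G b * (h\<^sup>2 - (tcos t)\<^sup>2)"
      unfolding fr.form_expand[of "c p" "c r" t] fr.form_N X
      by (simp add: power2_eq_square algebra_simps)
    then have "cg G l = form G (c t) (c p) * form G (c t) (c r)
       + curv G * (sg G a * sg G b * (h\<^sup>2 - (tcos t)\<^sup>2))"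
      using gl(1) by (simp add: distrib_left)
    moreover have "cg G a * cg G b = form G (c t) (c p) * form G (c t) (c r)"
      using ga(1) gb(1) by (simp add: mult.assoc mult.left_commute[of "form G (c t) (c p)"])
    ultimately show ?thesis using h(2) by (simp add: mult.assoc)
  qed
  \<comment> \<open>Both sides arise from \<open>cg G l - cg G (a + b)\<close>, once as a difference
    of cosines and once by the law of cosines.\<close>
  have prod: "sg G d * sg G (a + b - d) = h\<^sup>2 * sg G a * sg G b"
  proof -
    have "cg G ((a + b - d) - d) - cg G ((a + b - d) + d) = 2 * (curv G * (sg G d * sg G (a + b - d)))"
      using cg_add[of G "a + b - d" "- d"] cg_add[of G "a + b - d" d] by simp
    moreover have "(a + b - d) - d = l" by (simp add: d_def field_simps)
    moreover have "cg G ((a + b - d) + d) = cg G a * cg G b - curv G * sg G a * sg G b"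
      using cg_add[of G a b] by simp
    ultimately have e: "cg G l - (cg G a * cg G b - curv G * sg G a * sg G b) = 2 * (curv G * (sg G d * sg G (a + b - d)))"
      by simp
    have "cg G l - (cg G a * cg G b - curv G * sg G a * sg G b) = 2 * (curv G * (h\<^sup>2 * sg G a * sg G b))"
      unfolding cl by (simp add: algebra_simps)
    then have "2 * (curv G * (sg G d * sg G (a + b - d))) = 2 * (curv G * (h\<^sup>2 * sg G a * sg G b))"
      unfolding e .
    then show ?thesis using curv_nonzero[of G] by (metis mult_left_cancel zero_neq_numeral)
  qed
  \<comment> \<open>The triangle inequality, equivalent to \<open>d \<le> a\<close> and
    \<open>d \<le> b\<close>, read off from the law of cosines.\<close>
  have ab: "\<bar>a - b\<bar> \<le> l"
  proof (rule cg_le_imp)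
    have "cg G \<bar>a - b\<bar> = cg G (a - b)" by (simp add: abs_if cg_minus[of G "a - b", symmetric])
    also have "\<dots> = cg G a * cg G b + curv G * sg G a * sg G b" using cg_add[of G a "- b"] by simp
    finally have cab: "cg G \<bar>a - b\<bar> = cg G a * cg G b + curv G * sg G a * sg G b" .
    have "curv G * cg G l - curv G * cg G \<bar>a - b\<bar> = curv G * (curv G * (sg G a * sg G b * (2 * h\<^sup>2 - 2)))"
      unfolding cl cab by (simp add: algebra_simps)
    also have "\<dots> = sg G a * sg G b * (2 * h\<^sup>2 - 2)" by simp
    also have "\<dots> \<le> 0" using sa sb h(2) by (intro mult_nonneg_nonpos) auto
    finally show "curv G * cg G l \<le> curv G * cg G \<bar>a - b\<bar>" by simp
    show "l \<le> pi \<and> \<bar>a - b\<bar> \<le> pi" if "G = Spherical"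
      using gl(4) a0 aD Dpi that by auto
  qed (use gl in auto)
  show ?thesis
    by (rule that[of a b d "h\<^sup>2"]) (use a0 aD prod Md M0 w ab in \<open>auto simp: d_def \<kappa>_def\<close>)
qed

text \<open>A supporting geodesic at \<open>x\<close> gives a chord with \<open>C\<close> on its
  left. The action along its row grows up to this chord and falls afterwards, so the chord attains
  \<open>M\<close>; each of the two arcs into which the perpendicular at \<open>x\<close> splits the
  arc cut off has action at most \<open>M\<close>.\<close>

lemma lower_bound:
  assumes D: "D = table_diameter G K"
    and M: "\<And>s t. s \<le> t \<Longrightarrow> t \<le> s + L \<Longrightarrow> action s t \<le> M" "\<And>s. \<exists>t\<in>{s..s+L}. action s t = M"
    and x: "x \<in> boundary G C" "x \<notin> boundary G K"
  obtains t1 t2 h r1 r2 where "0 < t1" "0 < t2" "t1 + t2 \<le> D" "0 < h" "G = Spherical \<Longrightarrow> h < pi"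
    "cg G r1 = cg G h * cg G t1" "cg G r2 = cg G h * cg G t2" "0 \<le> r1" "0 \<le> r2"
    "r1 + r2 - (t1 + t2) \<le> M"
    "dist_to_set G x (boundary G K) \<le> h" "2 * dist_to_set G x (boundary G K) \<le> D"
    "0 \<le> dist_to_set G x (boundary G K)"
proof -
  have xC: "x \<in> C" "x \<notin> interior (ocone C)" using x(1) boundary_iff[OF C(1) C_surf] by auto
  have xK: "x \<in> K" and xs: "x \<in> surface G" using xC C C_surf by auto
  have xI: "x \<in> interior (ocone K)" using x(2) xK boundary_iff[OF K(1,3)] by auto
  obtain w where w: "w \<noteq> 0" "w \<bullet> x = 0" "\<And>z. z \<in> C \<Longrightarrow> 0 \<le> w \<bullet> z"
    using supporting_functional[OF C(2) xC C_interior] by blast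
  \<comment> \<open>The functional \<open>w\<close> vanishes at \<open>x\<close> and acts on the
    tangent plane there; \<open>v\<close> is its gradient turned by a right angle and normalised, so
    that \<open>det3 x v\<close> is a positive multiple of \<open>w\<close>.\<close>
  have "\<exists>v. unit_tangent G x v \<and> (\<forall>z\<in>C. 0 \<le> det3 x v z)"
  proof -
    obtain T where T: "unit_tangent G x T" using unit_tangent_exists[OF xs] by blast
    interpret f: frame G x T by unfold_locales fact
    define \<alpha> \<beta> where "\<alpha> = w \<bullet> T" and "\<beta> = w \<bullet> f.N"
    have wz: "w \<bullet> z = form G T z * \<alpha> + form G f.N z * \<beta>" for z
      by (subst f.expand[of z]) (simp add: inner_add_right w \<alpha>_def \<beta>_def)
    define R where "R = sqrt (\<alpha>\<^sup>2 + \<beta>\<^sup>2)"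
    have "\<alpha> \<noteq> 0 \<or> \<beta> \<noteq> 0" using wz[of w] w(1) by auto
    then have R: "R > 0" "R * R = \<alpha>\<^sup>2 + \<beta>\<^sup>2" by (auto simp: R_def sum_power2_gt_zero_iff)
    define v where "v = (1 / R) *\<^sub>R (\<beta> *\<^sub>R T - \<alpha> *\<^sub>R f.N)"
    have "form G (\<beta> *\<^sub>R T - \<alpha> *\<^sub>R f.N) (\<beta> *\<^sub>R T - \<alpha> *\<^sub>R f.N) = R * R"
      unfolding R(2) by (simp add: form_linear f.qT f.N power2_eq_square)
    then have "unit_tangent G x v"
      using R(1) xs unfolding unit_tangent_def v_def bounded_bilinear.scaleR_left[OF bounded_bilinear_form]
        bounded_bilinear.scaleR_right[OF bounded_bilinear_form]
      by (simp add: form_linear f.qT f.N)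
    moreover have "det3 x v z = (w \<bullet> z) / R" for z
      unfolding f.det3_expand_frame[of v z] wz[of z] using R(1)
      by (simp add: v_def form_linear f.qT f.N field_simps)
    ultimately show ?thesis using w(3) R(1) by (intro exI[of _ v]) auto
  qed
  then obtain v where v: "unit_tangent G x v" and vC: "\<And>z. z \<in> C \<Longrightarrow> 0 \<le> det3 x v z" by blast
  interpret f: frame G x v by unfold_locales fact
  obtain a b where ab: "a > 0" "b > 0" "sg G a > 0" "sg G b > 0" "sg G (a + b) > 0"
    "geo G x v a \<in> boundary G K" "geo G x (- v) b \<in> boundary G K"
    "gdist G (geo G x v a) (geo G x (- v) b) = a + b"
    "sg G (a + b) *\<^sub>R x = sg G b *\<^sub>R geo G x v a + sg G a *\<^sub>R geo G x (- v) b"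
    using geodesic_chord[OF K(1,3) xK x(2) v] by blast
  define p p' where "p = geo G x (- v) b" and "p' = geo G x v a"
  obtain s where s: "c s = p" using ab(7) boundary_eq by (auto simp: p_def)
  obtain s' where s': "s \<le> s'" "s' < s + L" "c s' = p'" using boundary_point[OF ab(6)] p'_def by metis
  have ps: "p \<in> surface G" "p' \<in> surface G" using s s' c_surf by metis+
  have dpp: "gdist G p p' = a + b" using ab(8) gdist_facts(5)[OF ps] by (simp add: p_def p'_def)
  have "p \<noteq> p'" using dpp gdist_self[OF ps(1)] ab by auto
  then have ss: "s < s'" using s s' by (auto simp: less_le)
  have pe: "p = cg G b *\<^sub>R x - sg G b *\<^sub>R v" "p' = cg G a *\<^sub>R x + sg G a *\<^sub>R v"
    by (simp_all add: p_def p'_def geo_cg)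
  have detpp: "det3 p p' z = sg G (a + b) * det3 x v z" for z
    by (simp add: pe sg_add det3_expand algebra_simps)
  have left: "lefts s s'" using vC ab(5) by (simp add: lefts_def s s' detpp)
  have xe: "sg G (a + b) *\<^sub>R x = sg G b *\<^sub>R p' + sg G a *\<^sub>R p" using ab(9) by (simp add: p_def p'_def)
  \<comment> \<open>As \<open>x\<close> is interior to the table, it is strictly left of each
    boundary tangent, so the ends of the chord never both lie on one tangent.\<close>
  have detx: "0 < sg G b * det3 (c t) (velocity c t) p' + sg G a * det3 (c t) (velocity c t) p" for t
  proof -
    have "0 < sg G (a + b) * det3 (c t) (velocity c t) x" using left_interior[OF xI, of t] ab(5) by simp
    also have "\<dots> = det3 (c t) (velocity c t) (sg G (a + b) *\<^sub>R x)" by (simp add: det3_linear)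
    finally show ?thesis unfolding xe by (simp add: det3_linear)
  qed
  have pK: "p \<in> K" "p' \<in> K" using s s' c_K by metis+
  have nonneg: "0 \<le> det3 (c t) (velocity c t) p" "0 \<le> det3 (c t) (velocity c t) p'" for t
    using left pK by (auto intro: table.left[OF table_axioms])
  \<comment> \<open>If a later chord still had \<open>C\<close> on its left, antitonicity would put
    \<open>c r\<close> in the same direction from \<open>c s\<close> as \<open>c s'\<close>. Then
    three boundary points lie on one geodesic through the interior point \<open>x\<close>, and the
    tangents at \<open>c s'\<close> and \<open>c r\<close> force these two to coincide.\<close>
  have not_left: "\<not> lefts s r" if r: "s' < r" "r < s + L" for r
  proof
    assume "lefts s r"
    then have "0 \<le> det3 p (c r) (sg G (a + b) *\<^sub>R x)"
      using xC(1) ab(5) s by (simp add: lefts_def det3_linear)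
    then have "0 \<le> det3 p (c r) p'" using ab(4) unfolding xe by (simp add: det3_linear zero_le_mult_iff)
    then have d1: "0 \<le> det3 (c s) (c r) (c s')" by (simp add: s s')
    have ner: "c r \<noteq> c s" "c s' \<noteq> c s" using c_ne'[of s r] c_ne'[of s s'] r ss by auto
    have sp: "0 < sinang s (c s')"
    proof -
      have "0 < det3 (c s) (velocity c s) p'" using detx[of s] ab(4) s by (simp add: zero_less_mult_iff)
      then show ?thesis using sn_c(1)[OF c_K ner(2)] s' by (simp add: sinang_def)
    qed
    have "cosang s (c s') \<le> cosang s (c r)"
      using d1 sp ner c_K by (intro cosang_le_if_det3_nonneg) auto
    moreover have "cosang s (c r) \<le> cosang s (c s')" using r ss by (intro cosang_antitone) auto
    ultimately have ceq: "cosang s (c r) = cosang s (c s')" by simp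
    then have "(sinang s (c r))\<^sup>2 = (sinang s (c s'))\<^sup>2"
      using ang(3)[OF c_K ner(1)] ang(3)[OF c_K ner(2)] by simp
    then have seq: "sinang s (c r) = sinang s (c s')"
      using ang(4)[OF c_K ner(1)] ang(4)[OF c_K ner(2)] by (simp add: power2_eq_iff_nonneg)
    define \<beta> where "\<beta> = sn G (c s) (c r) / sn G (c s) (c s')"
    have \<beta>: "\<beta> > 0" "sn G (c s) (c r) = \<beta> * sn G (c s) (c s')"
      using sn_c(1)[OF c_K ner(1)] sn_c(1)[OF c_K ner(2)] by (auto simp: \<beta>_def)
    define \<alpha> where "\<alpha> = curv G * form G (c s) (c r) - \<beta> * (curv G * form G (c s) (c s'))"
    have e: "c r = \<alpha> *\<^sub>R p + \<beta> *\<^sub>R p'"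
    proof -
      have 1: "c r = (curv G * form G (c s) (c r)) *\<^sub>R c s + sn G (c s) (c r) *\<^sub>R (cosang s (c s') *\<^sub>R velocity c s + sinang s (c s') *\<^sub>R fr.N s)"
        using fr.expand[of "c r" s] ang(1,2)[OF c_K ner(1)] by (simp add: fr.form_N ceq seq scaleR_add_right add.assoc)
      have 2: "c s' = (curv G * form G (c s) (c s')) *\<^sub>R c s + sn G (c s) (c s') *\<^sub>R (cosang s (c s') *\<^sub>R velocity c s + sinang s (c s') *\<^sub>R fr.N s)"
        using fr.expand[of "c s'" s] ang(1,2)[OF c_K ner(2)] by (simp add: fr.form_N scaleR_add_right add.assoc)
      define V where "V = cosang s (c s') *\<^sub>R velocity c s + sinang s (c s') *\<^sub>R fr.N s"
      have "\<alpha> *\<^sub>R c s + \<beta> *\<^sub>R c s' = (curv G * form G (c s) (c r)) *\<^sub>R c s + sn G (c s) (c r) *\<^sub>R V"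
        by (subst 2) (simp add: \<alpha>_def \<beta>(2) V_def[symmetric] algebra_simps)
      then show ?thesis using 1 s s' by (simp add: V_def)
    qed
    have "0 < det3 (c s') (velocity c s') p" using detx[of s'] ab(3) s' by (simp add: zero_less_mult_iff)
    moreover have "0 \<le> det3 (c s') (velocity c s') (c r)" by (rule table.left[OF table_axioms c_K])
    then have "0 \<le> \<alpha> * det3 (c s') (velocity c s') p" using s' by (simp add: e det3_linear)
    ultimately have \<alpha>: "\<alpha> \<ge> 0" by (simp add: zero_le_mult_iff)
    have "det3 (c r) (velocity c r) (\<alpha> *\<^sub>R p + \<beta> *\<^sub>R p') = 0" unfolding e[symmetric] by simp
    then have sum0: "\<alpha> * det3 (c r) (velocity c r) p + \<beta> * det3 (c r) (velocity c r) p' = 0"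
      by (simp add: det3_linear)
    have n1: "0 \<le> \<alpha> * det3 (c r) (velocity c r) p" "0 \<le> \<beta> * det3 (c r) (velocity c r) p'"
      using \<alpha> \<beta> nonneg[of r] by auto
    then have z: "\<alpha> * det3 (c r) (velocity c r) p = 0" "\<beta> * det3 (c r) (velocity c r) p' = 0"
      using sum0 by linarith+
    then have "det3 (c r) (velocity c r) p' = 0" using \<beta> by simp
    moreover then have "det3 (c r) (velocity c r) p \<noteq> 0" using detx[of r] by auto
    ultimately have "\<alpha> = 0" using z by simp
    then have "c r = \<beta> *\<^sub>R c s'" using e s' by simp
    then have "\<beta> = 1" using surface_scale_eq[OF c_surf[of s'], of \<beta>] c_surf[of r] by simp
    then show False using \<open>c r = \<beta> *\<^sub>R c s'\<close> c_ne[of s' r] r ss by simp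
  qed
  have Upp: "action s s' = M"
  proof (rule antisym)
    show "action s s' \<le> M" using M(1)[of s s'] ss s' by simp
    obtain \<tau> where \<tau>: "s \<le> \<tau>" "\<tau> \<le> s + L" "action s \<tau> = M" using M(2)[of s] by auto
    have cont: "continuous_on A (action s)" for A by (intro action_cont continuous_intros)
    show "M \<le> action s s'"
    proof (cases "\<tau> \<le> s'")
      case True
      have "action s \<tau> \<le> action s s'"
      proof (rule nondecreasing_from_open[OF True cont])
        fix r assume r: "\<tau> < r" "r < s'"
        then have "lefts s r" using lefts_shrink_right[of s r s'] left \<tau> s' by simp
        then show "\<exists>d\<ge>0. (action s has_real_derivative d) (at r)"
          using action_deriv_end[of s r] lefts_tcos_end[of s r] r \<tau> s' by (intro exI[of _ "- cosang r (c s) - tcos r"]) auto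
      qed
      then show ?thesis using \<tau> by simp
    next
      case False
      have "- action s s' \<le> - action s \<tau>"
      proof (rule nondecreasing_from_open[where f = "\<lambda>r. - action s r"])
        fix r assume r: "s' < r" "r < \<tau>"
        then have sr: "s < r" "r < s + L" using ss \<tau> by auto
        have "((\<lambda>r. - action s r) has_real_derivative - (- cosang r (c s) - tcos r)) (at r)"
          using action_deriv_end[OF sr] by (rule DERIV_minus)
        moreover have "0 \<le> - (- cosang r (c s) - tcos r)"
          using not_lefts_tcos(2)[OF sr not_left] r sr by simp
        ultimately show "\<exists>d\<ge>0. ((\<lambda>r. - action s r) has_real_derivative d) (at r)" by blast
      qed (use False cont in \<open>auto intro: continuous_on_minus\<close>)
      then show ?thesis using \<tau> by simp
    qed
  qed
  \<comment> \<open>\<open>- f.N\<close> points to the right of the chord, away from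
    \<open>C\<close> and towards the arc from \<open>s\<close> to \<open>s'\<close>.\<close>
  have nT: "unit_tangent G x (- f.N)"
    using xs by (simp add: unit_tangent_minus) (simp add: unit_tangent_def f.N)
  obtain h where h: "h > 0" "G = Spherical \<longrightarrow> h < pi" "geo G x (- f.N) h \<in> boundary G K"
    using geodesic_exit[OF K(1,3) xK x(2) nT] by blast
  define q where "q = geo G x (- f.N) h"
  have qe: "q = cg G h *\<^sub>R x - sg G h *\<^sub>R f.N" by (simp add: q_def geo_cg)
  have sh: "sg G h > 0" using h by (intro sg_pos) auto
  obtain \<tau> where \<tau>: "s \<le> \<tau>" "\<tau> < s + L" "c \<tau> = q" using boundary_point[OF h(3)] q_def by metis
  have qs: "q \<in> surface G" using \<tau> c_surf by metis
  have "det3 x v q = - sg G h" by (simp add: qe det3_linear f.form_N[symmetric] f.N)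
  then have dq: "det3 (c s) (c s') (c \<tau>) < 0" using detpp[of q] ab(5) sh by (simp add: s s' \<tau> mult_pos_neg)
  have "\<tau> \<noteq> s" using dq by auto
  moreover have "\<tau> < s'"
  proof (rule ccontr)
    assume "\<not> \<tau> < s'"
    then have st: "s' \<le> \<tau>" by simp
    have "cosang s (c \<tau>) \<le> cosang s (c s')" using st ss \<tau> by (intro cosang_antitone) auto
    then have "0 \<le> det3 (c s) (c s') (c \<tau>)"
      using c_ne'[of s s'] c_ne'[of s \<tau>] ss s' st \<tau> c_K by (intro det3_nonneg_if_cosang_le) auto
    then show False using dq by simp
  qed
  ultimately have \<tau>': "s < \<tau>" "\<tau> < s'" using \<tau> by auto
  define r1 r2 where "r1 = gdist G p q" and "r2 = gdist G p' q"
  have "action s \<tau> + action \<tau> s' \<le> 2 * M" using M(1)[of s \<tau>] M(1)[of \<tau> s'] \<tau>' s' by simp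
  then have rM: "r1 + r2 - (b + a) \<le> M"
    using Upp dpp gdist_facts(5)[OF ps(2) qs] by (simp add: action_def r1_def r2_def s s' \<tau>)
  \<comment> \<open>Pythagoras for the two triangles with a right angle at \<open>x\<close>.\<close>
  have cr: "cg G r1 = cg G h * cg G b" "cg G r2 = cg G h * cg G a"
    unfolding r1_def r2_def gdist_facts(1)[OF ps(1) qs] gdist_facts(1)[OF ps(2) qs]
    by (simp_all add: pe qe form_linear f.qT f.N)
  have bdd: "bdd_below (gdist G x ` boundary G K)"
    using gdist_facts(3)[OF xs] c_surf by (intro bdd_belowI[of _ 0]) (auto simp: boundary_eq)
  have dle: "dist_to_set G x (boundary G K) \<le> t"
    if "geo G x u t \<in> boundary G K" "unit_tangent G x u" "0 < t" "G = Spherical \<longrightarrow> t \<le> pi" for u t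
  proof -
    have "geo G x u t \<in> surface G" using that(1) c_surf by (auto simp: boundary_eq)
    then have "gdist G x (geo G x u t) = t"
      using gdist_eqI[OF xs] form_geo(2)[OF that(2)] that by auto
    then show ?thesis unfolding dist_to_set_def using cINF_lower[OF bdd that(1)] by simp
  qed
  have abpi: "G = Spherical \<longrightarrow> a + b \<le> pi" using gdist_facts(4)[OF ps] dpp by metis
  have d1: "dist_to_set G x (boundary G K) \<le> h" using dle[OF h(3) nT h(1)] h(2) by auto
  \<comment> \<open>Both ends of the chord are boundary points, so twice the distance from
    \<open>x\<close> to the boundary is at most \<open>a + b\<close>, hence at most
    \<open>D\<close>.\<close>
  have d2: "dist_to_set G x (boundary G K) \<le> a" using dle[OF ab(6) v ab(1)] abpi ab by auto
  have d3: "dist_to_set G x (boundary G K) \<le> b"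
    using dle[OF ab(7) _ ab(2)] v abpi ab by (auto simp: unit_tangent_minus)
  have abD: "a + b \<le> D" using gdist_c_le[of s s'] dpp s s' D by simp
  have d0: "0 \<le> dist_to_set G x (boundary G K)"
    unfolding dist_to_set_def
    using gdist_facts(3)[OF xs] c_surf by (intro cINF_greatest) (auto simp: boundary_eq)
  show ?thesis
    by (rule that[of b a h r1 r2])
      (use ab abD h cr rM d0 d1 d2 d3 gdist_facts(3)[OF ps(1) qs] gdist_facts(3)[OF ps(2) qs] in \<open>auto simp: r1_def r2_def\<close>)
qed

end

text \<open>The diameter bounds distances between boundary points. Any further point of the table is
  a positive multiple of a positive combination of the ends of a chord, and the form is
  linear.\<close>

lemma (in table) acute_of_diameter:
  assumes D: "G = Spherical \<Longrightarrow> table_diameter G K < pi / 2" and z: "z \<in> K"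
  shows "0 < curv G * form G (c t) z"
proof -
  have zs: "z \<in> surface G" using z K by auto
  have bd: "0 < curv G * form G (c t) (c s)" for s
  proof (cases G)
    case Hyperbolic
    then show ?thesis using form_pos_self(1)[OF c_surf c_surf, of t s] by simp
  next
    case Spherical
    have "gdist G (c t) (c s) < pi / 2" "0 \<le> gdist G (c t) (c s)"
      using D[OF Spherical] gdist_c_le[of t s] gdist_facts(3)[OF c_surf c_surf] by (linarith, blast)
    then have "0 < cos (gdist G (c t) (c s))" by (intro cos_gt_zero_pi) linarith+
    then show ?thesis using gdist_facts(1)[OF c_surf c_surf, of t s] Spherical by (simp add: cg_def)
  qed
  show ?thesis
  proof (cases "z \<in> boundary G K")
    case True
    then show ?thesis using bd by (auto simp: boundary_eq)
  next
    case False
    obtain v where v: "unit_tangent G z v" using unit_tangent_exists[OF zs] by blast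
    obtain a b where ab: "sg G a > 0" "sg G b > 0" "sg G (a + b) > 0"
      "geo G z v a \<in> boundary G K" "geo G z (- v) b \<in> boundary G K"
      "sg G (a + b) *\<^sub>R z = sg G b *\<^sub>R geo G z v a + sg G a *\<^sub>R geo G z (- v) b"
      using geodesic_chord[OF K(1,3) z False v] by blast
    have p: "0 < curv G * form G (c t) (geo G z v a)" "0 < curv G * form G (c t) (geo G z (- v) b)"
      using bd ab(4,5) by (auto simp: boundary_eq)
    have "sg G (a + b) * (curv G * form G (c t) z) = curv G * form G (c t) (sg G (a + b) *\<^sub>R z)"
      by (simp add: form_linear)
    also have "\<dots> = sg G b * (curv G * form G (c t) (geo G z v a)) + sg G a * (curv G * form G (c t) (geo G z (- v) b))"
      unfolding ab(6) by (simp add: form_linear algebra_simps)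
    also have "\<dots> > 0" using mult_pos_pos[OF ab(2) p(1)] mult_pos_pos[OF ab(1) p(2)] by linarith
    finally show ?thesis using ab(3) by (simp add: zero_less_mult_iff)
  qed
qed

section \<open>Combination of both bounds, and passage to the minimal curvature\<close>

lemma (in caustic) caustic_estimate:
  assumes D: "D = table_diameter G K" "G = Spherical \<Longrightarrow> D < pi / 2"
    and x: "x \<in> boundary G C" "x \<notin> boundary G K"
    and \<rho>: "\<rho> = dist_to_set G x (boundary G K)"
  shows "G = Hyperbolic \<Longrightarrow> tanh \<rho> \<le> geodesic_curvature G c t * (sqrt 2 * tanh D powr (3/2) * sinh D powr (1/2))"
    and "G = Spherical \<Longrightarrow> tan (\<rho> / 2) \<le> geodesic_curvature G c t * (sqrt pi / 2 * (tan D)\<^sup>2)"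
    and "2 * \<rho> \<le> D"
proof -
  define \<kappa> where "\<kappa> = geodesic_curvature G c t"
  have \<kappa>: "\<kappa> \<ge> 0" by (simp add: \<kappa>_def curvature_nonneg)
  obtain M where M: "M \<ge> 0" "\<And>s t. s \<le> t \<Longrightarrow> t \<le> s + L \<Longrightarrow> action s t \<le> M"
    "\<And>s. \<exists>t\<in>{s..s+L}. action s t = M" "\<And>t. \<exists>s\<in>{t-L..t}. action s t = M"
    using action_max by blast
  obtain t1 t2 h r1 r2 where low: "0 < t1" "0 < t2" "t1 + t2 \<le> D" "0 < h" "G = Spherical \<Longrightarrow> h < pi"
    "cg G r1 = cg G h * cg G t1" "cg G r2 = cg G h * cg G t2" "0 \<le> r1" "0 \<le> r2"
    "r1 + r2 - (t1 + t2) \<le> M" "\<rho> \<le> h" "2 * \<rho> \<le> D" "0 \<le> \<rho>"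
    using lower_bound[OF D(1) M(2,3) x, folded \<rho>] by blast
  show "2 * \<rho> \<le> D" by (rule low)
  have D0: "D > 0" using low by linarith
  have "\<exists>a b d w. 0 < a \<and> a \<le> D \<and> 0 < b \<and> b \<le> D \<and> 0 \<le> d \<and> d \<le> a \<and> d \<le> b \<and>
    sg G d * sg G (a + b - d) = w * sg G a * sg G b \<and> M \<le> 2 * d \<and>
    0 \<le> w \<and> w * (cg G D)\<^sup>2 \<le> \<kappa>\<^sup>2 * (sg G D)\<^sup>2"
  proof (cases "M = 0")
    \<comment> \<open>For \<open>M = 0\<close> the maximum may sit at the ends of a period, where no
      vertex can be extracted; \<open>a = b = D\<close> and \<open>d = w = 0\<close> meet all
      requirements.\<close>
    case True
    then show ?thesis using D0 by (intro exI[of _ D] exI[of _ 0]) auto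
  next
    case False
    then have "M > 0" using M(1) by simp
    show ?thesis unfolding \<kappa>_def
      by (rule upper_bound[OF D M(2-4) \<open>M > 0\<close>, of t]) (assumption | intro exI conjI; assumption)+
  qed
  then obtain a b d w where up: "0 < a" "a \<le> D" "0 < b" "b \<le> D" "0 \<le> d" "d \<le> a" "d \<le> b"
    "sg G d * sg G (a + b - d) = w * sg G a * sg G b" "M \<le> 2 * d"
    "0 \<le> w" "w * (cg G D)\<^sup>2 \<le> \<kappa>\<^sup>2 * (sg G D)\<^sup>2" by blast
  have rM: "r1 + r2 - (t1 + t2) \<le> 2 * d" using low up by linarith
  show "tanh \<rho> \<le> geodesic_curvature G c t * (sqrt 2 * tanh D powr (3/2) * sinh D powr (1/2))" if H: "G = Hyperbolic"
  proof -
    have "(tanh \<rho>)\<^sup>2 \<le> 2 * w * (sinh D)\<^sup>2 / cosh D"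
      by (rule hyperbolic_estimate[of a D b d w t1 t2 r1 h r2])
        (use low up rM H in \<open>auto simp: cg_def sg_def\<close>)
    also have "\<dots> \<le> 2 * (\<kappa>\<^sup>2 * (tanh D)\<^sup>2) * (sinh D)\<^sup>2 / cosh D"
    proof -
      have "w * (cosh D)\<^sup>2 \<le> \<kappa>\<^sup>2 * (sinh D)\<^sup>2" using up(11) H by (simp add: cg_def sg_def)
      then have "w \<le> \<kappa>\<^sup>2 * (sinh D)\<^sup>2 / (cosh D)\<^sup>2" by (simp add: pos_le_divide_eq)
      then have "w \<le> \<kappa>\<^sup>2 * (tanh D)\<^sup>2" by (simp add: tanh_def power_divide)
      then show ?thesis by (intro divide_right_mono mult_right_mono mult_left_mono) auto
    qed
    \<comment> \<open>The exponents 3/2 and 1/2 come from \<open>(tanh D)\<^sup>2 * (sinh D)\<^sup>2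
      / cosh D = (tanh D)^3 * sinh D\<close>.\<close>
    also have "\<dots> = (\<kappa> * (sqrt 2 * tanh D powr (3/2) * sinh D powr (1/2)))\<^sup>2"
    proof -
      have t0: "tanh D > 0" "sinh D > 0" using D0 by auto
      have "(tanh D powr (3/2))\<^sup>2 = tanh D ^ 3" "(sinh D powr (1/2))\<^sup>2 = sinh D"
        using t0 by (simp_all add: powr_power powr_numeral)
      then have "(\<kappa> * (sqrt 2 * tanh D powr (3/2) * sinh D powr (1/2)))\<^sup>2 = 2 * \<kappa>\<^sup>2 * (tanh D ^ 3 * sinh D)"
        by (simp add: power_mult_distrib)
      also have "tanh D ^ 3 * sinh D = (tanh D)\<^sup>2 * (sinh D)\<^sup>2 / cosh D"
        by (simp add: tanh_def power2_eq_square power3_eq_cube)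
      finally show ?thesis by simp
    qed
    finally show ?thesis
      unfolding \<kappa>_def[symmetric] by (rule power2_le_imp_le) (use \<kappa> D0 in auto)
  qed
  show "tan (\<rho> / 2) \<le> geodesic_curvature G c t * (sqrt pi / 2 * (tan D)\<^sup>2)" if S: "G = Spherical"
  proof -
    have cD: "cos D > 0" using D(2)[OF S] D0 by (intro cos_gt_zero_pi) linarith+
    have "(tan (\<rho>/2))\<^sup>2 \<le> pi / 4 * w * (tan D)\<^sup>2"
      by (rule spherical_estimate[of D a b d w t1 t2 r1 h r2])
        (use low up rM S D in \<open>auto simp: cg_def sg_def\<close>)
    also have "\<dots> \<le> pi / 4 * (\<kappa>\<^sup>2 * (tan D)\<^sup>2) * (tan D)\<^sup>2"
    proof -
      have "w * (cos D)\<^sup>2 \<le> \<kappa>\<^sup>2 * (sin D)\<^sup>2" using up(11) S by (simp add: cg_def sg_def)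
      then have "w \<le> \<kappa>\<^sup>2 * (sin D)\<^sup>2 / (cos D)\<^sup>2" using cD by (simp add: pos_le_divide_eq)
      then have "w \<le> \<kappa>\<^sup>2 * (tan D)\<^sup>2" by (simp add: tan_def power_divide)
      then show ?thesis by (intro mult_right_mono mult_left_mono) auto
    qed
    also have "\<dots> = (\<kappa> * (sqrt pi / 2 * (tan D)\<^sup>2))\<^sup>2"
      by (simp add: power_mult_distrib power_divide power2_eq_square)
    finally show ?thesis
      unfolding \<kappa>_def[symmetric] by (rule power2_le_imp_le) (use \<kappa> D0 in auto)
  qed
qed

text \<open>The infimum is reached by dividing through \<open>b\<close>; for \<open>b = 0\<close> a
  single element of \<open>S\<close> decides.\<close>

lemma le_Inf_mult:
  fixes S :: "real set"
  assumes "S \<noteq> {}" "b \<ge> 0" "y \<ge> 0" "\<And>k. k \<in> S \<Longrightarrow> k \<ge> 0 \<and> y \<le> k * b"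
  shows "y \<le> Inf S * b"
proof (cases "b = 0")
  case True
  obtain k where "k \<in> S" using assms(1) by auto
  then show ?thesis using assms(4)[of k] True by simp
next
  case False
  then have "y / b \<le> k" if "k \<in> S" for k using assms(2) assms(4)[OF that] by (simp add: pos_divide_le_eq)
  then have "y / b \<le> Inf S" using assms(1) by (intro cInf_greatest)
  then show ?thesis using False assms(2) by (simp add: pos_divide_le_eq)
qed

theorem theorem1p1:
  fixes G :: geometry and K \<Gamma> :: "(real^3) set" and x :: "real^3"
  assumes "convex_table G K" and "C2_boundary G K"
    and "G = Spherical \<Longrightarrow> table_diameter G K < pi / 2"
    and "convex_caustic G K \<Gamma>" and "x \<in> \<Gamma>"
  shows "ereal (dist_to_set G x (boundary G K))
           \<le> caustic_eps G (min_curvature G K) (table_diameter G K)"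
proof -
  define D \<rho> \<kappa> where "D = table_diameter G K" and "\<rho> = dist_to_set G x (boundary G K)"
    and "\<kappa> = min_curvature G K"
  define S where "S = {geodesic_curvature G c t | L c t. boundary_param G K L c}"
  obtain L0 c0 where par0: "boundary_param G K L0 c0" using assms(2) by (auto simp: C2_boundary_def)
  interpret t0: table G K L0 c0 by unfold_locales fact+
  have S0: "S \<noteq> {}" using par0 by (auto simp: S_def)
  have Spos: "0 \<le> k" if k: "k \<in> S" for k
  proof -
    obtain L c t where p: "boundary_param G K L c" "k = geodesic_curvature G c t" using k by (auto simp: S_def)
    interpret table G K L c by unfold_locales fact+
    show ?thesis using curvature_nonneg p by simp
  qed
  obtain C where C: "compact C" "geo_convex G C" "boundary G C = \<Gamma>"
    and refl: "\<And>q u u'. billiard_reflection G K q u u' \<Longrightarrow> supporting_line G C q u \<Longrightarrow> supporting_line G C q u'"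
    and \<Gamma>: "simple_closed_curve \<Gamma>" "\<Gamma> \<subseteq> K"
    using assms(4) unfolding convex_caustic_def by blast
  have Cs: "C \<subseteq> surface G" using C by (auto simp: geo_convex_def)
  have CK: "C \<subseteq> K" using subset_if_boundary_subset[OF C(1) Cs t0.K(2)] \<Gamma> C by simp
  have Ci: "interior (ocone C) \<noteq> {}" using caustic_region_interior[of G C] \<Gamma> C by simp
  have xK: "x \<in> K" and xs: "x \<in> surface G" using assms(5) \<Gamma> t0.K by auto
  have bdd: "bdd_below (gdist G x ` boundary G K)"
    using gdist_facts(3)[OF xs t0.c_surf] by (intro bdd_belowI[of _ 0]) (auto simp: t0.boundary_eq)
  have \<rho>0: "0 \<le> \<rho>"
    unfolding \<rho>_def dist_to_set_def
    using gdist_facts(3)[OF xs t0.c_surf] by (intro cINF_greatest) (auto simp: t0.boundary_eq)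
  have D0: "0 \<le> D"
    using t0.gdist_c_le[of 0 0] by (simp add: D_def t0.c_surf)
  \<comment> \<open>The minimal curvature is an infimum over all parametrisations, so each curvature
    value is treated with its own parametrisation. For \<open>x\<close> on the boundary of the table
    the distance is 0.\<close>
  have est: "(G = Hyperbolic \<longrightarrow> tanh \<rho> \<le> k * (sqrt 2 * tanh D powr (3/2) * sinh D powr (1/2))) \<and>
     (G = Spherical \<longrightarrow> tan (\<rho> / 2) \<le> k * (sqrt pi / 2 * (tan D)\<^sup>2)) \<and> 2 * \<rho> \<le> D" if k: "k \<in> S" for k
  proof (cases "x \<in> boundary G K")
    case True
    have "\<rho> \<le> gdist G x x" unfolding \<rho>_def dist_to_set_def by (rule cINF_lower[OF bdd True])
    then have "\<rho> = 0" using \<rho>0 xs by simp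
    then show ?thesis using Spos[OF k] D0 by simp
  next
    case False
    obtain L c t where p: "boundary_param G K L c" "k = geodesic_curvature G c t" using k by (auto simp: S_def)
    interpret tb: table G K L c by unfold_locales fact+
    interpret ca: caustic G K L c C
      by unfold_locales (use C CK Ci refl tb.acute_of_diameter assms(3) in auto)
    have xC: "x \<in> boundary G C" using assms(5) C by simp
    show ?thesis
      using ca.caustic_estimate(1,2)[OF D_def _ xC False \<rho>_def, of t]
        ca.caustic_estimate(3)[OF D_def _ xC False \<rho>_def] assms(3) p(2) unfolding D_def by blast
  qed
  have \<kappa>: "\<kappa> = Inf S" by (simp add: \<kappa>_def min_curvature_def S_def)
  show ?thesis
  proof (cases G)
    case Hyperbolic
    define e where "e = sqrt 2 * \<kappa> * tanh D powr (3/2) * sinh D powr (1/2)"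
    have "tanh \<rho> \<le> \<kappa> * (sqrt 2 * tanh D powr (3/2) * sinh D powr (1/2))"
      unfolding \<kappa> using S0 Spos est Hyperbolic \<rho>0 by (intro le_Inf_mult) auto
    then have le: "tanh \<rho> \<le> e" by (simp add: e_def ac_simps)
    show ?thesis
    proof (cases "e \<ge> 1")
      case True
      then show ?thesis using Hyperbolic by (simp add: e_def \<kappa>_def D_def Let_def)
    next
      case False
      have t0: "0 \<le> tanh \<rho>" "tanh \<rho> < 1" using \<rho>0 tanh_real_lt_1 by auto
      then have pos: "0 < 1 + tanh \<rho>" "0 < 1 - tanh \<rho>" "0 < 1 - e" "0 < 1 + e"
        using False le by linarith+
      have "\<rho> = artanh (tanh \<rho>)" by (simp add: artanh_tanh_real)
      \<comment> \<open>\<open>artanh\<close> is half the logarithm of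
        \<open>(1 + x) / (1 - x)\<close>, which grows with \<open>x\<close> below 1.\<close>
      also have "\<dots> \<le> artanh e"
        unfolding artanh_def
        by (intro divide_right_mono ln_mono frac_le divide_pos_pos) (use pos le in linarith)+
      finally have "\<rho> \<le> artanh e" .
      then show ?thesis using False Hyperbolic
        by (simp add: e_def \<kappa>_def D_def \<rho>_def Let_def)
    qed
  next
    case Spherical
    have Dp: "D < pi / 2" using assms(3) Spherical by (simp add: D_def)
    obtain k where "k \<in> S" using S0 by auto
    then have "2 * \<rho> \<le> D" using est by blast
    \<comment> \<open>Inverting the tangent requires \<open>\<rho> / 2\<close> to be below a right
      angle.\<close>
    then have \<rho>p: "\<rho> < pi" using Dp \<rho>0 D0 pi_gt_zero by linarith
    have "\<rho> \<le> 2 * arctan (\<kappa> * (sqrt pi / 2 * (tan D)\<^sup>2))"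
    proof -
      have "tan (\<rho> / 2) \<le> \<kappa> * (sqrt pi / 2 * (tan D)\<^sup>2)"
        unfolding \<kappa> using S0 Spos est Spherical \<rho>0 \<rho>p
        by (intro le_Inf_mult) (auto intro!: tan_pos_pi2_le)
      then have "arctan (tan (\<rho> / 2)) \<le> arctan (\<kappa> * (sqrt pi / 2 * (tan D)\<^sup>2))"
        by (rule arctan_monotone')
      moreover have "arctan (tan (\<rho> / 2)) = \<rho> / 2" using \<rho>0 \<rho>p by (intro arctan_tan) auto
      ultimately show ?thesis by simp
    qed
    then show ?thesis using Spherical
      by (simp add: \<kappa>_def D_def \<rho>_def ac_simps)
  qed
qed

end
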